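(* Let $H=(H^1,\dots,H^m)\in C^{1,1}_{\mathrm{loc}}(\mathbb R^d;\mathbb R^m)$, $u_0\in BUC(\mathbb R^d)$ and $B\in C([0,\infty);\mathbb R^m)$ with $B(0)=0$. There exists a unique $u\in BUC(\mathbb R^d\times[0,\infty))$ such that the following holds. For any families $(B^\varepsilon)_{\varepsilon>0}$ in $C^1([0,\infty);\mathbb R^m)$ with $B^\varepsilon(0)=0$ and $(u_0^\varepsilon)_{\varepsilon>0}$ in $BUC(\mathbb R^d)$ which, as $\varepsilon\to0$, approximate respectively $B$ in $C([0,\infty);\mathbb R^m)$ and $u_0$ in $BUC(\mathbb R^d)$, if $u^\varepsilon\in BUC(\mathbb R^d\times[0,\infty))$ is the unique viscosity solution of $$u^\varepsilon_t=\sum_{i=1}^mH^i(Du^\varepsilon)\,\dot B^\varepsilon_i\quad\text{in }\mathbb R^d\times(0,\infty),\qquad u^\varepsilon(\cdot,0)=u_0^\varepsilon,$$ then, as $\varepsilon\to0$, $u^\varepsilon\to u$ uniformly in $\mathbb R^d\times[0,\infty)$.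
   Context: $BUC$ denotes the space of bounded uniformly continuous functions, with the topology of uniform convergence. Viscosity solutions are in the usual (Crandall–Lions) sense. The function $u$ is the candidate for the solution of the Hamilton–Jacobi equation $du=\sum_{i=1}^mH^i(Du)\cdot dB_i$, $u(\cdot,0)=u_0$, driven by the merely continuous path $B$.
   Formalization: BUC(R^d×[0,∞)) is read as BUC on R^d×[0,T] for every T (literally false: H=1, u_0=0, B(t)=t gives u=t); convergence is proved both as B^ε→B locally uniformly giving u^ε→u uniformly on each R^d×[0,T], and as uniform on [0,∞) giving uniform on R^d×[0,∞), with uniqueness for each. *)

theory Defs
  imports "HOL-Analysis.Analysis"
begin

definition BUC :: "'a::metric_space set \<Rightarrow> ('a \<Rightarrow> real) set" where
  "BUC S = {f. bounded (f ` S) \<and> uniformly_continuous_on S f}"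

text \<open>
  The space \<open>BUC(\<real>\<^sup>d \<times> [0,\<infinity>))\<close>, with boundedness and uniform continuity understood on
  \<open>\<real>\<^sup>d \<times> [0,T]\<close> for every finite \<open>T\<close>. Constant initial data \<open>c\<close> give the
  solution \<open>c + H(0) \<cdot> B(t)\<close>, and \<open>H(p) = p\<close> (\<open>m = d\<close>) gives \<open>u\<^sub>0(x + B(t))\<close>; for a general
  continuous \<open>B\<close> these are neither bounded nor uniformly continuous on all of
  \<open>\<real>\<^sup>d \<times> [0,\<infinity>)\<close>.
\<close>

definition BUC_time :: "((real^'d) \<times> real \<Rightarrow> real) set" where
  "BUC_time = {u. \<forall>T\<ge>0. u \<in> BUC (UNIV \<times> {0..T})}"

definition C11_loc :: "(real^'d \<Rightarrow> real^'m) \<Rightarrow> bool" where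
  "C11_loc H \<longleftrightarrow>
    (\<exists>H' :: real^'d \<Rightarrow> (real^'d) \<Rightarrow>\<^sub>L (real^'m).
      (\<forall>p. (H has_derivative blinfun_apply (H' p)) (at p)) \<and>
      (\<forall>K. compact K \<longrightarrow> (\<exists>L. L-lipschitz_on K H')))"

text \<open>
  \<open>C\<^sup>1([0,\<infinity>); \<real>\<^sup>m)\<close>: the derivative at \<open>0\<close> is one-sided, so that values at negative times
  are irrelevant.
\<close>

definition C1_path :: "(real \<Rightarrow> real^'m) \<Rightarrow> bool" where
  "C1_path B \<longleftrightarrow>
    (\<exists>B'. continuous_on {0..} B' \<and>
      (\<forall>t\<ge>0. (B has_vector_derivative B' t) (at t within {0..})))"

text \<open>
  \<open>\<phi> \<in> C\<^sup>1(\<real>\<^sup>d \<times> (0,\<infinity>))\<close> with spatial gradient \<open>D\<phi>\<close> and time derivative \<open>\<phi>t\<close>.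
\<close>

definition C1_test ::
  "((real^'d) \<times> real \<Rightarrow> real) \<Rightarrow> ((real^'d) \<times> real \<Rightarrow> real^'d) \<Rightarrow>
   ((real^'d) \<times> real \<Rightarrow> real) \<Rightarrow> bool" where
  "C1_test \<phi> D\<phi> \<phi>t \<longleftrightarrow>
    (\<forall>z \<in> UNIV \<times> {0<..}.
      (\<phi> has_derivative (\<lambda>(h, s). D\<phi> z \<bullet> h + \<phi>t z * s)) (at z)) \<and>
    continuous_on (UNIV \<times> {0<..}) D\<phi> \<and> continuous_on (UNIV \<times> {0<..}) \<phi>t"

text \<open>
  Crandall--Lions solutions of \<open>u\<^sub>t = F(t, Du)\<close> in \<open>\<real>\<^sup>d \<times> (0,\<infinity>)\<close>. That set is open, so
  a neighbourhood in the whole space gives the right notion of local extremum.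
\<close>

definition viscosity_subsolution ::
  "(real \<Rightarrow> real^'d \<Rightarrow> real) \<Rightarrow> ((real^'d) \<times> real \<Rightarrow> real) \<Rightarrow> bool" where
  "viscosity_subsolution F u \<longleftrightarrow>
    (\<forall>\<phi> D\<phi> \<phi>t x t. C1_test \<phi> D\<phi> \<phi>t \<longrightarrow> t > 0 \<longrightarrow>
      (\<forall>\<^sub>F z in nhds (x, t). u z - \<phi> z \<le> u (x, t) - \<phi> (x, t)) \<longrightarrow>
      \<phi>t (x, t) \<le> F t (D\<phi> (x, t)))"

definition viscosity_supersolution ::
  "(real \<Rightarrow> real^'d \<Rightarrow> real) \<Rightarrow> ((real^'d) \<times> real \<Rightarrow> real) \<Rightarrow> bool" where
  "viscosity_supersolution F u \<longleftrightarrow>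
    (\<forall>\<phi> D\<phi> \<phi>t x t. C1_test \<phi> D\<phi> \<phi>t \<longrightarrow> t > 0 \<longrightarrow>
      (\<forall>\<^sub>F z in nhds (x, t). u z - \<phi> z \<ge> u (x, t) - \<phi> (x, t)) \<longrightarrow>
      \<phi>t (x, t) \<ge> F t (D\<phi> (x, t)))"

definition viscosity_solution ::
  "(real \<Rightarrow> real^'d \<Rightarrow> real) \<Rightarrow> ((real^'d) \<times> real \<Rightarrow> real) \<Rightarrow> bool" where
  "viscosity_solution F u \<longleftrightarrow>
    continuous_on (UNIV \<times> {0<..}) u \<and>
    viscosity_subsolution F u \<and> viscosity_supersolution F u"

definition HJ_solution ::
  "(real^'d \<Rightarrow> real^'m) \<Rightarrow> (real \<Rightarrow> real^'m) \<Rightarrow> (real^'d \<Rightarrow> real) \<Rightarrow>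
   ((real^'d) \<times> real \<Rightarrow> real) \<Rightarrow> bool" where
  "HJ_solution H B u0 u \<longleftrightarrow>
    viscosity_solution
      (\<lambda>t p. \<Sum>i\<in>UNIV. H p $ i * vector_derivative B (at t) $ i) u \<and>
    (\<forall>x. u (x, 0) = u0 x)"

text \<open>
  \<open>approximation_limit \<J> H u\<^sub>0 B u\<close>: the solutions driven by any \<open>C\<^sup>1\<close> approximations of
  \<open>(B, u\<^sub>0)\<close> converge to \<open>u\<close>. Convergence in time, for both the paths and the
  solutions, is uniform on each member of \<open>\<J>\<close>; in space it is always uniform on \<open>\<real>\<^sup>d\<close>.
\<close>

definition approximation_limit ::
  "real set set \<Rightarrow> (real^'d \<Rightarrow> real^'m) \<Rightarrow> (real^'d \<Rightarrow> real) \<Rightarrow> (real \<Rightarrow> real^'m) \<Rightarrow>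
   ((real^'d) \<times> real \<Rightarrow> real) \<Rightarrow> bool" where
  "approximation_limit \<J> H u0 B u \<longleftrightarrow>
    (\<forall>(B\<epsilon> :: real \<Rightarrow> real \<Rightarrow> real^'m) (u0\<epsilon> :: real \<Rightarrow> real^'d \<Rightarrow> real)
      (u\<epsilon> :: real \<Rightarrow> (real^'d) \<times> real \<Rightarrow> real).
      (\<forall>\<epsilon>>0. C1_path (B\<epsilon> \<epsilon>) \<and> B\<epsilon> \<epsilon> 0 = 0) \<longrightarrow>
      (\<forall>\<epsilon>>0. u0\<epsilon> \<epsilon> \<in> BUC UNIV) \<longrightarrow>
      (\<forall>J\<in>\<J>. uniform_limit J B\<epsilon> B (at_right 0)) \<longrightarrow>
      uniform_limit UNIV u0\<epsilon> u0 (at_right 0) \<longrightarrow>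
      (\<forall>\<epsilon>>0. u\<epsilon> \<epsilon> \<in> BUC_time \<and> HJ_solution H (B\<epsilon> \<epsilon>) (u0\<epsilon> \<epsilon>) (u\<epsilon> \<epsilon>)) \<longrightarrow>
      (\<forall>J\<in>\<J>. uniform_limit (UNIV \<times> J) u\<epsilon> u (at_right 0)))"

text \<open>
  The two uniform structures in time: uniform on every \<open>[0,T]\<close> (the usual topology of
  \<open>C([0,\<infinity>))\<close>), and uniform on the whole of \<open>[0,\<infinity>)\<close>. They cannot be mixed: for
  \<open>H(p) = p\<close>, paths converging only on compact time intervals do not give uniform
  convergence of \<open>u\<^sub>0(x + B\<^sup>\<epsilon>(t))\<close> on \<open>\<real>\<^sup>d \<times> [0,\<infinity>)\<close>.
\<close>

definition compact_times :: "real set set" where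
  "compact_times = {{0..T} | T. 0 \<le> T}"

definition all_times :: "real set set" where
  "all_times = {{0..}}"

end

(* For constant p the function p . z + xi . H(p) - kappa |p|^2 is affine in (z, xi), so the maximum Psi
   over |p| <= R is convex, and for small xi the C^{1,1} bound on H makes the maximiser unique; then Psi is C^1
   with gradient (p, H p), and Psi(z, B1(t) - B2(t)) is a classical solution of the equation driven by
   B1 - B2. Used as the coupling in the doubling-of-variables argument it gives
     u1(x,t) - u2(y,t) <= Psi(x - y, B1(t) - B2(t)) + sup (u1 - u2 - Psi) at time 0,
   hence a modulus of continuity of the solution with respect to path and initial datum that depends only
   on the sup distance of the paths and not on the time horizon. Existence for C^1 paths and Lipschitz data
   comes from a Lax-Friedrichs scheme that commutes with translations: its half-relaxed limits are
   automatically Lipschitz, and the comparison result identifies them. The solution for a continuous path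
   is the uniform limit along C^1 approximations. *)
theory Submission
  imports Defs
begin

subsection \<open>Test functions defined locally\<close>

text \<open>With the usual coupling |x - y|^2, the two inequalities at a maximum leave H(p) . (b1 -
  b2). This involves the derivatives of the paths and is not controlled by their sup distance; a
  coupling that itself solves the equation removes it. Psi is known to be C^1 only for small xi, so
  only nearby paths are compared, which is enough for a Cauchy argument. Confining p to a ball makes
  the growth of H irrelevant; its radius comes from the modulus of continuity of u0. Uniqueness
  rests on existence: without solutions for smooth paths, the approximation property would hold
  vacuously for every candidate. Comparison is available only inside \<open>BUC_time\<close>, so the
  limits of the scheme must be uniformly continuous before they can be compared; hence a scheme that
  preserves Lipschitz constants. That constant also bounds every gradient the equation sees, so H
  may be truncated outside a ball and a CFL condition imposed. One u serves both time topologies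
  because B is approximated uniformly on the whole half-line.\<close>

lemma has_derivative_pos_part_sq:
  "((\<lambda>y::real. (max 0 y)\<^sup>2) has_derivative (\<lambda>h. 2 * max 0 y * h)) (at y)"
proof -
  have "((\<lambda>y::real. (max 0 y)\<^sup>2) has_real_derivative 2 * max 0 y) (at y)"
  proof (cases "y = 0")
    case True
    have "((\<lambda>x::real. (max 0 x)\<^sup>2 / x) \<longlongrightarrow> 0) (at 0)"
    proof (rule Lim_null_comparison)
      show "\<forall>\<^sub>F x::real in at 0. norm ((max 0 x)\<^sup>2 / x) \<le> \<bar>x\<bar>"
        by (rule always_eventually) (auto simp: max_def power2_eq_square)
      show "((\<lambda>x::real. \<bar>x\<bar>) \<longlongrightarrow> 0) (at 0)"
        by (rule tendsto_rabs_zero) (rule tendsto_ident_at)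
    qed
    then show ?thesis using True by (simp add: has_field_derivative_iff)
  next
    case False
    then consider "y < 0" | "y > 0" by linarith
    then show ?thesis
    proof cases
      case 1
      have "((\<lambda>y::real. 0) has_real_derivative 2 * max 0 y) (at y)" using 1 by simp
      then show ?thesis
        by (rule has_field_derivative_transform_within_open[where S="{..<0}"]) (use 1 in auto)
    next
      case 2
      have "((\<lambda>y::real. y\<^sup>2) has_real_derivative 2 * max 0 y) (at y)" using 2
        by (auto intro!: derivative_eq_intros)
      then show ?thesis
        by (rule has_field_derivative_transform_within_open[where S="{0<..}"]) (use 2 in auto)
    qed
  qed
  then show ?thesis by (simp add: has_field_derivative_def)
qed

text \<open>Test functions need only be C^1, so two nested squared positive parts do the work of a
  smooth bump: with a = r^2/2, \<theta> is 1 where |z - z0|^2 \<le> a and 0 where |z - z0|^2 \<ge>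
  2a. Radial symmetry makes the gradient a multiple \<open>c z\<close> of z - z0.\<close>

lemma C1_cutoff:
  fixes z0 :: "'a::euclidean_space"
  assumes "r > 0"
  obtains \<theta> :: "'a \<Rightarrow> real" and c :: "'a \<Rightarrow> real"
  where "\<And>z. (\<theta> has_derivative (\<lambda>h. c z * ((z - z0) \<bullet> h))) (at z)"
    and "continuous_on UNIV \<theta>" and "continuous_on UNIV c"
    and "\<And>z. z \<notin> ball z0 r \<Longrightarrow> \<theta> z = 0" and "\<And>z. z \<notin> ball z0 r \<Longrightarrow> c z = 0"
    and "\<forall>\<^sub>F z in nhds z0. \<theta> z = 1" and "c z0 = 0"
proof -
  define a where "a = r\<^sup>2 / 2"
  have a: "a > 0" using assms by (simp add: a_def)
  define q where "q z = (max 0 ((z - z0) \<bullet> (z - z0) - a))\<^sup>2" for z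
  define \<theta> where "\<theta> z = (max 0 (1 - q z / a\<^sup>2))\<^sup>2" for z
  define c where "c z = 2 * max 0 (1 - q z / a\<^sup>2) *
      (- (2 * max 0 ((z - z0) \<bullet> (z - z0) - a) * 2 / a\<^sup>2))" for z
  have dq: "(q has_derivative (\<lambda>h. 2 * max 0 ((z - z0) \<bullet> (z - z0) - a) * (2 * ((z - z0) \<bullet> h)))) (at z)" for z
    unfolding q_def
    by (rule has_derivative_compose[OF _ has_derivative_pos_part_sq, of "\<lambda>z. (z - z0) \<bullet> (z - z0) - a", THEN has_derivative_eq_rhs])
       (auto intro!: derivative_eq_intros simp: inner_commute)
  have d: "(\<theta> has_derivative (\<lambda>h. c z * ((z - z0) \<bullet> h))) (at z)" for z
    unfolding \<theta>_def
    by (rule has_derivative_compose[OF _ has_derivative_pos_part_sq, of "\<lambda>z. 1 - q z / a\<^sup>2", THEN has_derivative_eq_rhs])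
       (use a in \<open>auto intro!: derivative_eq_intros dq simp: c_def field_simps\<close>)
  have cq: "continuous_on UNIV q" unfolding q_def by (intro continuous_intros)
  have c1: "continuous_on UNIV \<theta>" unfolding \<theta>_def using a by (intro continuous_intros cq) auto
  have c2: "continuous_on UNIV c" unfolding c_def using a by (intro continuous_intros cq) auto
  have out: "1 - q z / a\<^sup>2 \<le> 0" if "z \<notin> ball z0 r" for z
  proof -
    have "r \<le> norm (z - z0)" using that by (simp add: dist_norm norm_minus_commute)
    then have "r\<^sup>2 \<le> (norm (z - z0))\<^sup>2" using assms by (intro power_mono) auto
    then have "a \<le> (z - z0) \<bullet> (z - z0) - a" by (simp add: a_def power2_norm_eq_inner)
    then have "a\<^sup>2 \<le> q z" unfolding q_def using a by (intro power_mono) auto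
    then show ?thesis using a by simp
  qed
  have "q z = 0" if "dist z z0 < sqrt a" for z
  proof -
    have "(norm (z - z0))\<^sup>2 < (sqrt a)\<^sup>2" using that by (intro power_strict_mono) (auto simp: dist_norm)
    then show ?thesis using a by (simp add: q_def power2_norm_eq_inner)
  qed
  then have e: "\<forall>\<^sub>F z in nhds z0. \<theta> z = 1"
    unfolding eventually_nhds_metric using a by (auto simp: \<theta>_def intro!: exI[of _ "sqrt a"])
  show ?thesis
  proof (rule that[OF d c1 c2 _ _ e])
    show "\<theta> z = 0" "c z = 0" if "z \<notin> ball z0 r" for z
      using out[OF that] by (simp_all add: \<theta>_def c_def max_def)
    show "c z0 = 0" using a by (simp add: c_def)
  qed
qed

lemma has_derivative_pair_inner:
  fixes f :: "(real^'d) \<times> real \<Rightarrow> real"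
  shows "(f has_derivative (\<lambda>(h, s). p \<bullet> h + a * s)) F \<longleftrightarrow> (f has_derivative (\<lambda>h. (p, a) \<bullet> h)) F"
  by (rule arg_cong[where f="\<lambda>g. (f has_derivative g) F"]) (auto simp: fun_eq_iff inner_prod_def)

text \<open>\<open>C1_test\<close> asks for differentiability at all positive times, but the
  coupling along a path is known to be C^1 only where the path increment is small. Multiplication by
  a cutoff leaves the function unchanged near (x, t). Its regularity is glued from two open sets: W,
  where the product rule applies, and the complement of the ball, where the product
  vanishes.\<close>

lemma subsolution_local_test:
  fixes u \<phi> :: "(real^'d) \<times> real \<Rightarrow> real"
  assumes sub: "viscosity_subsolution F u"
    and W: "open W" "(x, t) \<in> W" and t: "t > 0"
    and d: "\<And>z. z \<in> W \<Longrightarrow> (\<phi> has_derivative (\<lambda>h. G z \<bullet> h)) (at z)"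
    and G: "continuous_on W G"
    and mx: "\<forall>\<^sub>F z in nhds (x, t). u z - \<phi> z \<le> u (x, t) - \<phi> (x, t)"
  shows "snd (G (x, t)) \<le> F t (fst (G (x, t)))"
proof -
  obtain r where r: "r > 0" "cball (x, t) r \<subseteq> W" using W open_contains_cball by blast
  obtain \<theta> c where chi: "\<And>z. (\<theta> has_derivative (\<lambda>h. c z * ((z - (x,t)) \<bullet> h))) (at z)"
     "continuous_on UNIV \<theta>" "continuous_on UNIV c"
    "\<And>z. z \<notin> ball (x,t) r \<Longrightarrow> \<theta> z = (0::real)" "\<And>z. z \<notin> ball (x,t) r \<Longrightarrow> c z = (0::real)"
    "\<forall>\<^sub>F z in nhds (x,t). \<theta> z = 1" "c (x,t) = 0"
    by (rule C1_cutoff[OF r(1), of "(x,t)"]) blast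
  define f where "f z = \<theta> z * \<phi> z" for z
  define E where "E z = \<theta> z *\<^sub>R G z + (c z * \<phi> z) *\<^sub>R (z - (x,t))" for z
  let ?V = "- cball (x,t) r"
  have cover: "W \<union> ?V = UNIV" using r by auto
  have dW: "(f has_derivative (\<lambda>h. E z \<bullet> h)) (at z)" if "z \<in> W" for z
    unfolding f_def
    by (rule has_derivative_mult[OF chi(1) d[OF that], THEN has_derivative_eq_rhs])
       (auto simp: E_def fun_eq_iff algebra_simps)
  have E0: "E z = 0" "f z = 0" if "z \<in> ?V" for z
    using that chi(4,5)[of z] by (auto simp: E_def f_def)
  have dV: "(f has_derivative (\<lambda>h. E z \<bullet> h)) (at z)" if "z \<in> ?V" for z
  proof -
    have "((\<lambda>z. 0::real) has_derivative (\<lambda>h. E z \<bullet> h)) (at z)" using E0[OF that] by simp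
    then show ?thesis
      by (rule has_derivative_transform_within_open[where s="?V"]) (use that E0 in auto)
  qed
  have df: "(f has_derivative (\<lambda>h. E z \<bullet> h)) (at z)" for z using dW dV cover by blast
  have cp: "continuous_on W \<phi>"
    by (meson continuous_at_imp_continuous_on d has_derivative_continuous)
  have "continuous_on W E" unfolding E_def
    by (intro continuous_intros G cp continuous_on_subset[OF chi(2)] continuous_on_subset[OF chi(3)]) auto
  moreover have "continuous_on ?V E"
    using continuous_on_cong[of ?V ?V E "\<lambda>_. 0"] E0 by auto
  ultimately have cE: "continuous_on UNIV E"
    using continuous_on_open_Un[of W ?V E] W cover by auto
  have test: "C1_test f (fst \<circ> E) (snd \<circ> E)"
    unfolding C1_test_def has_derivative_pair_inner
    using df cE by (auto simp: o_def intro!: continuous_intros continuous_on_subset[OF cE])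
  have at: "\<theta> (x,t) = 1" using chi(6) by (rule eventually_nhds_x_imp_x)
  have "\<forall>\<^sub>F z in nhds (x, t). u z - f z \<le> u (x, t) - f (x, t)"
    using mx chi(6) by eventually_elim (use at in \<open>auto simp: f_def\<close>)
  then have "(snd \<circ> E) (x, t) \<le> F t ((fst \<circ> E) (x, t))"
    using sub[unfolded viscosity_subsolution_def, rule_format, OF test t] by blast
  then show ?thesis using at by (simp add: E_def)
qed

lemma C1_test_minus:
  assumes "C1_test \<phi> D \<tau>"
  shows "C1_test (\<lambda>z. - \<phi> z) (\<lambda>z. - D z) (\<lambda>z. - \<tau> z)"
  unfolding C1_test_def
proof (intro conjI ballI)
  fix z assume "z \<in> (UNIV :: (real^'a) set) \<times> {0::real<..}"
  then have "(\<phi> has_derivative (\<lambda>h. (D z, \<tau> z) \<bullet> h)) (at z)"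
    using assms unfolding C1_test_def has_derivative_pair_inner by blast
  then have "((\<lambda>z. - \<phi> z) has_derivative (\<lambda>h. - ((D z, \<tau> z) \<bullet> h))) (at z)"
    by (rule has_derivative_minus)
  moreover have "(\<lambda>h. - ((D z, \<tau> z) \<bullet> h)) = (\<lambda>h. (- D z, - \<tau> z) \<bullet> h)"
    by (auto simp: fun_eq_iff inner_prod_def)
  ultimately show "((\<lambda>z. - \<phi> z) has_derivative (\<lambda>(h, s). - D z \<bullet> h + - \<tau> z * s)) (at z)"
    using has_derivative_pair_inner[of "\<lambda>z. - \<phi> z" "- D z" "- \<tau> z"] by simp
qed (use assms in \<open>auto simp: C1_test_def intro!: continuous_intros\<close>)

text \<open>Reflection p \<mapsto> -F(t, -p) allows the test-function and scheme arguments to be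
  carried out for subsolutions alone.\<close>

lemma subsolution_minus_iff:
  "viscosity_subsolution (\<lambda>t p. - F t (- p)) (\<lambda>z. - u z) \<longleftrightarrow> viscosity_supersolution F u"
  (is "?L \<longleftrightarrow> ?R")
proof
  assume L: ?L
  show ?R unfolding viscosity_supersolution_def
  proof (intro allI impI)
    fix \<phi> D\<phi> \<phi>t x and t :: real
    assume A: "C1_test \<phi> D\<phi> \<phi>t" "0 < t" "\<forall>\<^sub>F z in nhds (x, t). u (x, t) - \<phi> (x, t) \<le> u z - \<phi> z"
    have "\<forall>\<^sub>F z in nhds (x, t). - u z - - \<phi> z \<le> - u (x, t) - - \<phi> (x, t)"
      using A(3) by eventually_elim auto
    from L[unfolded viscosity_subsolution_def, rule_format, OF C1_test_minus[OF A(1)] A(2) this]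
    show "F t (D\<phi> (x, t)) \<le> \<phi>t (x, t)" by simp
  qed
next
  assume R: ?R
  show ?L unfolding viscosity_subsolution_def
  proof (intro allI impI)
    fix \<phi> D\<phi> \<phi>t x and t :: real
    assume A: "C1_test \<phi> D\<phi> \<phi>t" "0 < t" "\<forall>\<^sub>F z in nhds (x, t). - u z - \<phi> z \<le> - u (x, t) - \<phi> (x, t)"
    have "\<forall>\<^sub>F z in nhds (x, t). u (x, t) - - \<phi> (x, t) \<le> u z - - \<phi> z"
      using A(3) by eventually_elim auto
    from R[unfolded viscosity_supersolution_def, rule_format, OF C1_test_minus[OF A(1)] A(2) this]
    show "\<phi>t (x, t) \<le> - F t (- D\<phi> (x, t))" by simp
  qed
qed

subsection \<open>The coupling function\<close>

definition penal :: "(real^'d \<Rightarrow> real^'m) \<Rightarrow> real \<Rightarrow> (real^'d) \<times> (real^'m) \<Rightarrow> real^'d \<Rightarrow> real" where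
  "penal H \<kappa> w p = (p, H p) \<bullet> w - \<kappa> * (p \<bullet> p)"

definition maximizer :: "(real^'d \<Rightarrow> real^'m) \<Rightarrow> real \<Rightarrow> real \<Rightarrow> (real^'d) \<times> (real^'m) \<Rightarrow> real^'d" where
  "maximizer H R \<kappa> w = (SOME p. p \<in> cball 0 R \<and> (\<forall>q\<in>cball 0 R. penal H \<kappa> w q \<le> penal H \<kappa> w p))"

text \<open>Hopf's formula for a convex initial function, with total path increment \<xi> in place
  of time. For \<kappa> > 0 that initial function, \<open>Psi H R \<kappa> (z, 0)\<close>, is the
  Huber function: |z|^2/(4 \<kappa>) for |z| \<le> 2 \<kappa> R, and R |z| - \<kappa> R^2
  beyond.\<close>

definition Psi :: "(real^'d \<Rightarrow> real^'m) \<Rightarrow> real \<Rightarrow> real \<Rightarrow> (real^'d) \<times> (real^'m) \<Rightarrow> real" where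
  "Psi H R \<kappa> w = penal H \<kappa> w (maximizer H R \<kappa> w)"

context
  fixes H :: "real^'d \<Rightarrow> real^'m" and R \<kappa> :: real
  assumes R: "R \<ge> 0" and H: "continuous_on (cball 0 R) H"
begin

lemma continuous_on_penal:
  assumes "continuous_on S f" "continuous_on S g" "g ` S \<subseteq> cball 0 R"
  shows "continuous_on S (\<lambda>z. penal H \<kappa> (f z) (g z))"
proof -
  have "continuous_on S (\<lambda>z. H (g z))"
    by (rule continuous_on_compose2[OF H assms(2,3)])
  then show ?thesis unfolding penal_def by (intro continuous_intros assms)
qed

lemma maximizer:
  "maximizer H R \<kappa> w \<in> cball 0 R"
  "q \<in> cball 0 R \<Longrightarrow> penal H \<kappa> w q \<le> Psi H R \<kappa> w"
proof -
  have "\<exists>p\<in>cball 0 R. \<forall>q\<in>cball 0 R. penal H \<kappa> w q \<le> penal H \<kappa> w p"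
    using R by (intro continuous_attains_sup continuous_on_penal continuous_intros) auto
  then have "maximizer H R \<kappa> w \<in> cball 0 R \<and> (\<forall>q\<in>cball 0 R. penal H \<kappa> w q \<le> penal H \<kappa> w (maximizer H R \<kappa> w))"
    unfolding maximizer_def Bex_def by (rule someI_ex)
  then show "maximizer H R \<kappa> w \<in> cball 0 R" "q \<in> cball 0 R \<Longrightarrow> penal H \<kappa> w q \<le> Psi H R \<kappa> w"
    unfolding Psi_def by blast+
qed

text \<open>Since \<open>penal\<close> is affine in w, a maximiser at one endpoint is a competitor
  at the other. This bound and its companion trap every increment of Psi between the slopes at the
  two endpoints, so differentiability will follow from mere continuity of the maximiser.\<close>

lemma Psi_diff_le:
  "Psi H R \<kappa> w' - Psi H R \<kappa> w \<le> (maximizer H R \<kappa> w', H (maximizer H R \<kappa> w')) \<bullet> (w' - w)"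
  using maximizer(2)[OF maximizer(1)[of w'], of w]
  by (simp add: Psi_def penal_def inner_diff_right)

lemma Psi_diff_ge:
  "Psi H R \<kappa> w' - Psi H R \<kappa> w \<ge> (maximizer H R \<kappa> w, H (maximizer H R \<kappa> w)) \<bullet> (w' - w)"
  using maximizer(2)[OF maximizer(1)[of w], of w']
  by (simp add: Psi_def penal_def inner_diff_right)

text \<open>This is where the sup distance of two paths enters the final estimate: moving \<xi>
  costs at most the bound of H on the ball.\<close>

lemma Psi_lipschitz_snd:
  assumes "\<And>p. p \<in> cball 0 R \<Longrightarrow> norm (H p) \<le> C"
  shows "Psi H R \<kappa> (z, \<xi>) \<le> Psi H R \<kappa> (z, \<eta>) + C * norm (\<xi> - \<eta>)"
proof -
  let ?p = "maximizer H R \<kappa> (z, \<xi>)"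
  have "(?p, H ?p) \<bullet> ((z, \<xi>) - (z, \<eta>)) = H ?p \<bullet> (\<xi> - \<eta>)" by simp
  also have "\<dots> \<le> norm (H ?p) * norm (\<xi> - \<eta>)" by (rule norm_cauchy_schwarz)
  also have "\<dots> \<le> C * norm (\<xi> - \<eta>)" by (intro mult_right_mono assms maximizer(1)) auto
  finally show ?thesis using Psi_diff_le[of "(z, \<xi>)" "(z, \<eta>)"] by linarith
qed

lemma Psi_zero_le:
  assumes "\<kappa> \<ge> 0"
  shows "Psi H R \<kappa> (0, 0) \<le> 0"
  using assms by (simp add: Psi_def penal_def inner_prod_def)

lemma continuous_on_Psi: "continuous_on UNIV (Psi H R \<kappa>)"
proof -
  obtain C where C: "\<And>p. p \<in> cball 0 R \<Longrightarrow> norm (p, H p) \<le> C"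
  proof -
    have "compact ((\<lambda>p. (p, H p)) ` cball 0 R)"
      by (intro compact_continuous_image continuous_intros H) auto
    then show ?thesis using that by (metis (no_types, lifting) bounded_iff compact_imp_bounded image_eqI)
  qed
  have *: "Psi H R \<kappa> w' - Psi H R \<kappa> w \<le> C * norm (w' - w)" for w w'
  proof -
    let ?p = "maximizer H R \<kappa> w'"
    have "(?p, H ?p) \<bullet> (w' - w) \<le> norm (?p, H ?p) * norm (w' - w)" by (rule norm_cauchy_schwarz)
    also have "\<dots> \<le> C * norm (w' - w)" by (intro mult_right_mono C maximizer(1)) auto
    finally show ?thesis using Psi_diff_le[of w' w] by linarith
  qed
  have "C \<ge> 0" using C[of 0] R norm_ge_zero[of "(0, H 0)"] by (smt (verit) centre_in_cball)
  moreover have "\<bar>Psi H R \<kappa> w' - Psi H R \<kappa> w\<bar> \<le> C * norm (w' - w)" for w w'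
    using *[of w' w] *[of w w'] by (simp add: norm_minus_commute)
  ultimately have "C-lipschitz_on UNIV (Psi H R \<kappa>)"
    by (intro lipschitz_onI) (simp_all only: dist_norm real_norm_def)
  then show ?thesis by (rule lipschitz_on_continuous_on)
qed

context
  fixes L :: real
  assumes mid: "\<And>p q. p \<in> cball 0 R \<Longrightarrow> q \<in> cball 0 R \<Longrightarrow>
    norm (H p + H q - 2 *\<^sub>R H ((1/2) *\<^sub>R (p + q))) \<le> L / 2 * (norm (p - q))\<^sup>2"
begin

text \<open>For \<open>L |\<xi>| < \<kappa>\<close> the penalty dominates the concavity defect of \<open>\<xi> \<bullet> H\<close>,
  so that the maximised function is strictly midpoint concave.\<close>

lemma maximizer_unique:
  assumes "L * norm (snd w) < \<kappa>" and p: "p \<in> cball 0 R" "Psi H R \<kappa> w \<le> penal H \<kappa> w p"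
  shows "p = maximizer H R \<kappa> w"
proof (rule ccontr)
  define q where "q = maximizer H R \<kappa> w"
  assume "p \<noteq> maximizer H R \<kappa> w"
  then have pq: "norm (p - q) > 0" by (simp add: q_def)
  define m where "m = (1/2) *\<^sub>R (p + q)"
  have q: "q \<in> cball 0 R" unfolding q_def by (rule maximizer(1))
  have "m \<in> cball 0 R"
    using convexD[OF convex_cball p(1) q, of "1/2" "1/2"] by (simp add: m_def scaleR_add_right)
  \<comment> \<open>Two maximisers are tested against their midpoint. The parallelogram identity
    gains \<kappa> |p - q|^2 / 2, while the concavity defect of H costs at most L |\<xi>| |p - q|^2
    / 2.\<close>
  then have "2 * penal H \<kappa> w m \<le> penal H \<kappa> w p + penal H \<kappa> w q"
    using maximizer(2)[of m w] p(2) by (simp add: Psi_def q_def)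
  then have "0 \<le> (H p + H q - 2 *\<^sub>R H m) \<bullet> snd w - \<kappa> * (p \<bullet> p + q \<bullet> q - 2 * (m \<bullet> m)) + (p + q - 2 *\<^sub>R m) \<bullet> fst w"
    by (simp add: penal_def inner_prod_def algebra_simps)
  moreover have "p + q - 2 *\<^sub>R m = 0" by (simp add: m_def)
  moreover have "p \<bullet> p + q \<bullet> q - 2 * (m \<bullet> m) = (norm (p - q))\<^sup>2 / 2"
    by (simp add: m_def power2_norm_eq_inner algebra_simps inner_commute)
  moreover have "(H p + H q - 2 *\<^sub>R H m) \<bullet> snd w \<le> L / 2 * (norm (p - q))\<^sup>2 * norm (snd w)"
    using mid[OF p(1) q] unfolding m_def
    by (intro order_trans[OF norm_cauchy_schwarz] mult_right_mono) simp_all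
  ultimately have "0 \<le> L / 2 * (norm (p - q))\<^sup>2 * norm (snd w) - \<kappa> * ((norm (p - q))\<^sup>2 / 2)"
    by (metis (no_types, lifting) add.right_neutral diff_right_mono inner_zero_left order_trans)
  then have "0 \<le> (L * norm (snd w) - \<kappa>) * ((norm (p - q))\<^sup>2 / 2)"
    by (simp add: algebra_simps)
  then show False using assms(1) pq by (simp add: zero_le_mult_iff)
qed

text \<open>A map into a compact set with closed graph is continuous. Uniqueness identifies the
  graph with the set where \<open>penal\<close> reaches \<open>Psi\<close>, which is closed because
  both are continuous.\<close>

lemma continuous_on_maximizer:
  "continuous_on {w. L * norm (snd w) < \<kappa>} (maximizer H R \<kappa>)"
proof -
  let ?W = "{w. L * norm (snd w) < \<kappa>} :: ((real^'d) \<times> (real^'m)) set" and ?K = "cball 0 R :: (real^'d) set"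
  let ?g = "\<lambda>z :: ((real^'d) \<times> (real^'m)) \<times> (real^'d). penal H \<kappa> (fst z) (snd z) - Psi H R \<kappa> (fst z)"
  have cont: "continuous_on (?W \<times> ?K) ?g"
    by (intro continuous_intros continuous_on_penal continuous_on_compose2[OF continuous_on_Psi]) auto
  have "(\<lambda>w. (w, maximizer H R \<kappa> w)) ` ?W = ?W \<times> ?K \<inter> ?g -` {0..}"
    using maximizer(1) maximizer_unique by (auto simp: Psi_def)
  then have "closedin (top_of_set (?W \<times> ?K)) ((\<lambda>w. (w, maximizer H R \<kappa> w)) ` ?W)"
    using continuous_closedin_preimage[OF cont, of "{0..}"] by simp
  then show ?thesis
    using continuous_closed_graph_eq[of ?K "maximizer H R \<kappa>" ?W] maximizer(1) by auto
qed

text \<open>Envelope theorem: by the two increment bounds the first-order remainder at v lies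
  between 0 and |D v - D w| |v - w|, and D is continuous at w.\<close>

lemma Psi_has_derivative:
  assumes w: "L * norm (snd w) < \<kappa>"
  shows "(Psi H R \<kappa> has_derivative
    (\<lambda>h. (maximizer H R \<kappa> w, H (maximizer H R \<kappa> w)) \<bullet> h)) (at w)"
proof -
  let ?W = "{w. L * norm (snd w) < \<kappa>} :: ((real^'d) \<times> (real^'m)) set"
  define D where "D v = (maximizer H R \<kappa> v, H (maximizer H R \<kappa> v))" for v
  have opn: "open ?W"
    by (rule open_Collect_less[OF _ continuous_on_const]) (intro continuous_on_mult_left continuous_on_norm continuous_on_snd continuous_on_id)
  have "continuous_on ?W (\<lambda>v. H (maximizer H R \<kappa> v))"
    by (rule continuous_on_compose2[OF H continuous_on_maximizer]) (use maximizer(1) in auto)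
  then have "continuous_on ?W D"
    unfolding D_def by (rule continuous_on_Pair[OF continuous_on_maximizer])
  then have "isCont D w"
    using continuous_on_eq_continuous_at[OF opn, of D] w by blast
  then have lim: "((\<lambda>v. norm (D v - D w)) \<longlongrightarrow> 0) (at w)"
    unfolding isCont_def by (intro tendsto_norm_zero LIM_zero)
  show ?thesis
  proof (rule has_derivativeI_sandwich[where e=1 and H="\<lambda>v. norm (D v - D w)"])
    show "bounded_linear (\<lambda>h. (maximizer H R \<kappa> w, H (maximizer H R \<kappa> w)) \<bullet> h)"
      by (rule bounded_linear_inner_right)
    show "((\<lambda>v. norm (D v - D w)) \<longlongrightarrow> 0) (at w)" by (rule lim)
    fix v assume v: "v \<in> UNIV" "v \<noteq> w" "dist v w < 1"
    let ?e = "Psi H R \<kappa> v - Psi H R \<kappa> w - D w \<bullet> (v - w)"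
    have "?e \<ge> 0" using Psi_diff_ge[of w v] by (simp add: D_def)
    moreover have "?e \<le> (D v - D w) \<bullet> (v - w)" using Psi_diff_le[of v w] by (simp only: D_def inner_diff_left)
    then have "?e \<le> norm (D v - D w) * norm (v - w)"
      by (rule order_trans[OF _ norm_cauchy_schwarz])
    ultimately show "norm (Psi H R \<kappa> v - Psi H R \<kappa> w - (maximizer H R \<kappa> w, H (maximizer H R \<kappa> w)) \<bullet> (v - w)) / norm (v - w) \<le> norm (D v - D w)"
      unfolding D_def[of w, symmetric] using v by (simp add: pos_divide_le_eq)
  qed simp
qed

end

end

text \<open>All that the argument takes from \<open>C\<^sup>1\<^sup>,\<^sup>1\<close> regularity beyond \<open>C\<^sup>1\<close>.\<close>

lemma C11_loc_midpoint:
  fixes H :: "real^'d \<Rightarrow> real^'m"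
  assumes "C11_loc H"
  obtains L where "L > 0" and "\<And>p q. p \<in> cball 0 R \<Longrightarrow> q \<in> cball 0 R \<Longrightarrow>
    norm (H p + H q - 2 *\<^sub>R H ((1/2) *\<^sub>R (p + q))) \<le> L / 2 * (norm (p - q))\<^sup>2"
proof -
  obtain H' :: "real^'d \<Rightarrow> (real^'d) \<Rightarrow>\<^sub>L (real^'m)" where
    "(\<forall>p. (H has_derivative blinfun_apply (H' p)) (at p)) \<and> (\<forall>K. compact K \<longrightarrow> (\<exists>L. L-lipschitz_on K H'))"
    using assms unfolding C11_loc_def ..
  then have H': "\<And>p. (H has_derivative blinfun_apply (H' p)) (at p)"
    and "\<exists>L. L-lipschitz_on (cball 0 R) H'"
    by simp_all
  then obtain L where L: "L-lipschitz_on (cball 0 R) H'" by blast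
  have L0: "L \<ge> 0" using L by (rule lipschitz_on_nonneg)
  \<comment> \<open>The Lipschitz constant may be 0; adding 1 makes it positive, so that later
    thresholds such as \<kappa> / (2 L) make sense.\<close>
  have "norm (H p + H q - 2 *\<^sub>R H ((1/2) *\<^sub>R (p + q))) \<le> (L + 1) / 2 * (norm (p - q))\<^sup>2"
    if pq: "p \<in> cball 0 R" "q \<in> cball 0 R" for p q
  proof -
    define m h where "m = (1/2) *\<^sub>R (p + q)" and "h = (1/2) *\<^sub>R (p - q)"
    \<comment> \<open>The symmetric sum turns a second difference into k 1 - k 0. Its derivative
      compares H' at points at most 2 |h| apart, hence is at most 2 L |h|^2, and |h| = |p - q| /
      2.\<close>
    define k where "k s = H (m + s *\<^sub>R h) + H (m - s *\<^sub>R h)" for s :: real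
    have seg: "m + s *\<^sub>R h \<in> cball 0 R" "m - s *\<^sub>R h \<in> cball 0 R" if "s \<in> {0..1}" for s
    proof -
      have "m + s *\<^sub>R h = ((1+s)/2) *\<^sub>R p + ((1-s)/2) *\<^sub>R q"
        "m - s *\<^sub>R h = ((1-s)/2) *\<^sub>R p + ((1+s)/2) *\<^sub>R q"
        unfolding m_def h_def by (simp_all add: algebra_simps add_divide_distrib diff_divide_distrib)
      then show "m + s *\<^sub>R h \<in> cball 0 R" "m - s *\<^sub>R h \<in> cball 0 R"
        using convexD[OF convex_cball pq, of "(1+s)/2" "(1-s)/2"] convexD[OF convex_cball pq, of "(1-s)/2" "(1+s)/2"] that
        by (simp_all add: field_simps)
    qed
    have "norm (k 1 - k 0) \<le> (2 * L * (norm h)\<^sup>2) * norm ((1::real) - 0)"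
    proof (rule differentiable_bound[where S="{0..1}" and f'="\<lambda>s r. r *\<^sub>R (H' (m + s *\<^sub>R h) h - H' (m - s *\<^sub>R h) h)"])
      fix s :: real assume s: "s \<in> {0..1}"
      have 1: "((\<lambda>s. H (m + s *\<^sub>R h)) has_derivative (\<lambda>r. H' (m + s *\<^sub>R h) (r *\<^sub>R h))) (at s within {0..1})"
        by (rule has_derivative_compose[OF _ H', of "\<lambda>s. m + s *\<^sub>R h"]) (auto intro!: derivative_eq_intros)
      have 2: "((\<lambda>s. H (m - s *\<^sub>R h)) has_derivative (\<lambda>r. H' (m - s *\<^sub>R h) (- (r *\<^sub>R h)))) (at s within {0..1})"
        by (rule has_derivative_compose[OF _ H', of "\<lambda>s. m - s *\<^sub>R h"]) (auto intro!: derivative_eq_intros)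
      show "(k has_derivative (\<lambda>r. r *\<^sub>R (H' (m + s *\<^sub>R h) h - H' (m - s *\<^sub>R h) h))) (at s within {0..1})"
        unfolding k_def
        by (rule has_derivative_add[OF 1 2, THEN has_derivative_eq_rhs])
           (auto simp: fun_eq_iff blinfun.scaleR_right blinfun.minus_right algebra_simps)
      have "norm (H' (m + s *\<^sub>R h) h - H' (m - s *\<^sub>R h) h) = norm ((H' (m + s *\<^sub>R h) - H' (m - s *\<^sub>R h)) h)"
        by (simp add: blinfun.diff_left)
      also have "\<dots> \<le> norm (H' (m + s *\<^sub>R h) - H' (m - s *\<^sub>R h)) * norm h" by (rule norm_blinfun)
      also have "\<dots> \<le> (L * dist (m + s *\<^sub>R h) (m - s *\<^sub>R h)) * norm h"
        using lipschitz_onD[OF L seg[OF s]] by (intro mult_right_mono) (auto simp: dist_norm)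
      also have "dist (m + s *\<^sub>R h) (m - s *\<^sub>R h) = norm ((2 * s) *\<^sub>R h)"
        unfolding dist_norm by (rule arg_cong[where f=norm]) (simp add: algebra_simps flip: scaleR_add_left)
      also have "L * norm ((2 * s) *\<^sub>R h) * norm h \<le> L * (2 * norm h) * norm h"
        using s L0 by (intro mult_right_mono mult_left_mono) (auto simp: mult_left_le_one_le)
      finally have "norm (H' (m + s *\<^sub>R h) h - H' (m - s *\<^sub>R h) h) \<le> 2 * L * (norm h)\<^sup>2"
        by (simp add: power2_eq_square mult_ac)
      then show "onorm (\<lambda>r::real. r *\<^sub>R (H' (m + s *\<^sub>R h) h - H' (m - s *\<^sub>R h) h)) \<le> 2 * L * (norm h)\<^sup>2"
        by (intro onorm_le) (auto simp: mult.commute intro!: mult_left_mono)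
    qed auto
    moreover have "k 1 = H p + H q"
    proof -
      have "m + h = p" "m - h = q" unfolding m_def h_def
        by (simp_all add: algebra_simps flip: scaleR_add_left)
      then show ?thesis by (simp add: k_def)
    qed
    moreover have "k 0 = 2 *\<^sub>R H m" by (simp add: k_def scaleR_2)
    moreover have "norm h = norm (p - q) / 2" by (simp add: h_def)
    ultimately have "norm (H p + H q - 2 *\<^sub>R H m) \<le> L / 2 * (norm (p - q))\<^sup>2"
      by (simp add: power2_eq_square)
    also have "\<dots> \<le> (L + 1) / 2 * (norm (p - q))\<^sup>2" by (intro mult_right_mono) auto
    finally show ?thesis by (simp add: m_def)
  qed
  then show ?thesis using that[of "L + 1"] L0 by auto
qed

subsection \<open>Doubling of variables\<close>

lemma C1_path_derivative:
  assumes "C1_path B"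
  obtains b where "continuous_on {0..} b" "continuous_on {0..} B"
    "\<And>t. t > 0 \<Longrightarrow> (B has_vector_derivative b t) (at t)"
    "\<And>t. t > 0 \<Longrightarrow> vector_derivative B (at t) = b t"
    "\<And>t. t \<ge> 0 \<Longrightarrow> (B has_vector_derivative b t) (at t within {0..})"
proof -
  obtain b where b: "continuous_on {0..} b" "\<And>t. t \<ge> 0 \<Longrightarrow> (B has_vector_derivative b t) (at t within {0..})"
    using assms unfolding C1_path_def by auto
  have "(B has_vector_derivative b t) (at t)" if "t > 0" for t
    using b(2)[of t] that at_within_interior[of t "{0..}"] by simp
  moreover have "continuous_on {0..} B"
    by (auto simp: continuous_on_eq_continuous_within intro!: has_vector_derivative_continuous b)
  ultimately show ?thesis using that b vector_derivative_at by blast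
qed

text \<open>The sign \<open>e\<close> lets the lemma cover both a subsolution (\<open>e = 1\<close>) and the negative of a
  supersolution (\<open>e = -1\<close>). The point of the test function is that \<open>\<Psi>(\<cdot>, B)\<close> is itself a
  classical solution of the equation, so that only the penalisation terms survive.\<close>

lemma subsolution_Psi_test:
  fixes H :: "real^'d \<Rightarrow> real^'m" and u :: "(real^'d) \<times> real \<Rightarrow> real"
  assumes R: "R \<ge> 0" and H: "continuous_on (cball 0 R) H"
    and mid: "\<And>p q. p \<in> cball 0 R \<Longrightarrow> q \<in> cball 0 R \<Longrightarrow>
      norm (H p + H q - 2 *\<^sub>R H ((1/2) *\<^sub>R (p + q))) \<le> L / 2 * (norm (p - q))\<^sup>2"
    and e: "e * e = 1"
    and sub: "viscosity_subsolution (\<lambda>t p. e * (H (e *\<^sub>R p) \<bullet> b t)) u"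
    and B: "\<And>t. t > 0 \<Longrightarrow> (B has_vector_derivative b t) (at t)"
    and b: "continuous_on {0..} b"
    and t0: "t0 > 0" and close: "L * norm (B t0 - \<xi>) < \<kappa>"
    and mx: "\<forall>\<^sub>F z in nhds (x0, t0).
       u z - (Psi H R \<kappa> (e *\<^sub>R (fst z - y), e *\<^sub>R (B (snd z) - \<xi>)) + N * (snd z - s)\<^sup>2
         + (\<gamma> * snd z + K * (max 0 (snd z - t1))\<^sup>2) + \<alpha> * (fst z \<bullet> fst z))
     \<le> u (x0, t0) - (Psi H R \<kappa> (e *\<^sub>R (x0 - y), e *\<^sub>R (B t0 - \<xi>)) + N * (t0 - s)\<^sup>2
         + (\<gamma> * t0 + K * (max 0 (t0 - t1))\<^sup>2) + \<alpha> * (x0 \<bullet> x0))"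
    and K: "K \<ge> 0"
  defines "p \<equiv> maximizer H R \<kappa> (e *\<^sub>R (x0 - y), e *\<^sub>R (B t0 - \<xi>))"
  shows "2 * N * (t0 - s) + \<gamma> \<le> e * ((H (p + (2 * \<alpha> * e) *\<^sub>R x0) - H p) \<bullet> b t0)"
proof -
  have ne: "\<bar>e\<bar> = 1" using e by (auto simp: square_eq_1_iff)
  have pos: "\<And>t. t > 0 \<Longrightarrow> isCont B t"
    using B has_vector_derivative_continuous by blast
  define g where "g z = (e *\<^sub>R (fst z - y), e *\<^sub>R (B (snd z) - \<xi>))" for z
  \<comment> \<open>The open set of space-time points at which the path increment is small enough
    for Psi to be C^1.\<close>
  define W where "W = (UNIV \<times> {0<..}) \<inter> (\<lambda>z. L * norm (snd (g z))) -` {..<\<kappa>}"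
  have cB: "continuous_on (UNIV \<times> {0<..}) (\<lambda>z :: (real^'d) \<times> real. B (snd z))"
    by (rule continuous_on_compose2[of "{0<..}"])
       (auto intro!: continuous_at_imp_continuous_on pos continuous_intros)
  have cg: "continuous_on (UNIV \<times> {0<..}) g"
    unfolding g_def by (intro continuous_intros cB)
  have "open W" unfolding W_def
    by (intro continuous_open_preimage continuous_intros cg) (auto intro!: open_Times)
  have inW: "(x0, t0) \<in> W" using close t0 ne by (simp add: W_def g_def abs_mult)
  define q where "q z = maximizer H R \<kappa> (g z)" for z
  have cq: "continuous_on W q"
    unfolding q_def
    by (rule continuous_on_compose2[OF continuous_on_maximizer[OF R H mid]])
       (auto simp: W_def intro!: continuous_on_subset[OF cg])
  have cH: "continuous_on W (\<lambda>z. H (q z))"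
    by (rule continuous_on_compose2[OF H cq]) (use maximizer(1)[OF R H] in \<open>unfold q_def, blast\<close>)
  have cb: "continuous_on W (\<lambda>z. b (snd z))"
    by (rule continuous_on_compose2[OF b]) (auto simp: W_def intro!: continuous_intros)
  define G where "G z = (e *\<^sub>R q z + (2 * \<alpha>) *\<^sub>R fst z,
     e * (H (q z) \<bullet> b (snd z)) + 2 * N * (snd z - s) + (\<gamma> + K * (2 * max 0 (snd z - t1))))" for z
  have cG: "continuous_on W G"
    unfolding G_def by (intro continuous_intros cq cH cb)
  define \<phi> where "\<phi> z = Psi H R \<kappa> (g z) + N * (snd z - s)\<^sup>2
         + (\<gamma> * snd z + K * (max 0 (snd z - t1))\<^sup>2) + \<alpha> * (fst z \<bullet> fst z)" for z
  have "(\<phi> has_derivative (\<lambda>h. G z \<bullet> h)) (at z)" if z: "z \<in> W" for z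
  proof -
    have "snd z > 0" and l: "L * norm (snd (g z)) < \<kappa>" using z by (auto simp: W_def)
    have dB: "((\<lambda>z. B (snd z)) has_derivative (\<lambda>h. snd h *\<^sub>R b (snd z))) (at z)"
      by (rule has_derivative_compose[OF has_derivative_snd[OF has_derivative_ident] B[OF \<open>snd z > 0\<close>, unfolded has_vector_derivative_def]])
    have dg: "(g has_derivative (\<lambda>h. (e *\<^sub>R fst h, e *\<^sub>R (snd h *\<^sub>R b (snd z))))) (at z)"
      unfolding g_def by (auto intro!: derivative_eq_intros dB)
    have dP: "((\<lambda>z. Psi H R \<kappa> (g z)) has_derivative
        (\<lambda>h. (q z, H (q z)) \<bullet> (e *\<^sub>R fst h, e *\<^sub>R (snd h *\<^sub>R b (snd z))))) (at z)"
      unfolding q_def by (rule has_derivative_compose[OF dg Psi_has_derivative[OF R H mid l]])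
    have dm: "((\<lambda>z. (max 0 (snd z - t1))\<^sup>2) has_derivative (\<lambda>h. 2 * max 0 (snd z - t1) * snd h)) (at z)"
      by (rule has_derivative_compose[OF _ has_derivative_pos_part_sq, of "\<lambda>z. snd z - t1"])
         (auto intro!: derivative_eq_intros)
    show ?thesis unfolding \<phi>_def
      by (rule derivative_eq_intros dP dm refl)+
         (auto simp: fun_eq_iff G_def inner_prod_def inner_add_left inner_add_right inner_commute algebra_simps)
  qed
  from subsolution_local_test[OF sub \<open>open W\<close> inW t0 this cG]
  have "snd (G (x0, t0)) \<le> e * (H (e *\<^sub>R fst (G (x0, t0))) \<bullet> b t0)"
    using mx by (simp add: \<phi>_def g_def)
  moreover have "q (x0, t0) = p" by (simp add: q_def p_def g_def)
  \<comment> \<open>Because e^2 = 1, the Hamiltonian is evaluated at p displaced only by the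
    gradient of the \<alpha>-term. Its main part at p cancels the time derivative of the
    coupling.\<close>
  moreover have "e *\<^sub>R (e *\<^sub>R p + (2 * \<alpha>) *\<^sub>R x0) = p + (2 * \<alpha> * e) *\<^sub>R x0"
    using e by (simp add: scaleR_add_right mult.commute)
  moreover have "0 \<le> K * (2 * max 0 (t0 - t1))" using K by auto
  ultimately show ?thesis by (simp add: G_def inner_diff_left right_diff_distrib)
qed


section \<open>Bounds and moduli of continuity on finite time intervals\<close>

lemma bounded_image_norm_le:
  assumes "bounded (f ` S)"
  obtains C where "C \<ge> 0" "\<And>x. x \<in> S \<Longrightarrow> norm (f x) \<le> C"
proof -
  obtain C where "C > 0" "\<forall>y\<in>f ` S. norm y \<le> C" using assms bounded_pos by blast
  then show ?thesis using that[of C] by auto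
qed

lemma uniformly_continuous_on_path:
  fixes B :: "real \<Rightarrow> 'a::metric_space"
  assumes "continuous_on {0..} B" "e > 0"
  obtains r where "r > 0" "\<And>s t. s \<in> {0..T} \<Longrightarrow> t \<in> {0..T} \<Longrightarrow> \<bar>s - t\<bar> < r \<Longrightarrow> dist (B s) (B t) < e"
proof -
  have "continuous_on {0..T} B" by (rule continuous_on_subset[OF assms(1)]) auto
  then have "uniformly_continuous_on {0..T} B" by (rule compact_uniformly_continuous) simp
  then obtain r where "r > 0" "\<forall>s\<in>{0..T}. \<forall>t\<in>{0..T}. dist t s < r \<longrightarrow> dist (B t) (B s) < e"
    using assms(2) unfolding uniformly_continuous_on_def by metis
  then show ?thesis using that[of r] by (simp add: dist_norm)
qed

lemma bounded_path:
  fixes b :: "real \<Rightarrow> 'a::real_normed_vector"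
  assumes "continuous_on {0..} b"
  obtains C where "C \<ge> 0" "\<And>t. t \<in> {0..T} \<Longrightarrow> norm (b t) \<le> C"
proof -
  have "continuous_on {0..T} b" by (rule continuous_on_subset[OF assms(1)]) auto
  then have "bounded (b ` {0..T})" by (intro compact_imp_bounded compact_continuous_image) auto
  then show ?thesis by (rule bounded_image_norm_le) (use that in blast)
qed

lemma BUC_time_bounded:
  assumes "u \<in> BUC_time" "T \<ge> 0"
  obtains C where "C \<ge> 0" "\<And>x t. t \<in> {0..T} \<Longrightarrow> \<bar>u (x, t)\<bar> \<le> C"
proof -
  have "bounded (u ` (UNIV \<times> {0..T}))" using assms by (auto simp: BUC_time_def BUC_def)
  then show ?thesis by (rule bounded_image_norm_le) (use that in auto)
qed

lemma BUC_time_uniform: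
  assumes "u \<in> BUC_time" "e > 0"
  obtains r where "r > 0" "\<And>x s t. s \<in> {0..T} \<Longrightarrow> t \<in> {0..T} \<Longrightarrow> \<bar>s - t\<bar> < r \<Longrightarrow> \<bar>u (x, s) - u (x, t)\<bar> < e"
proof (cases "T \<ge> 0")
  case True
  then have "uniformly_continuous_on (UNIV \<times> {0..T}) u" using assms by (auto simp: BUC_time_def BUC_def)
  then obtain r where "r > 0" "\<forall>z\<in>UNIV \<times> {0..T}. \<forall>w\<in>UNIV \<times> {0..T}. dist w z < r \<longrightarrow> dist (u w) (u z) < e"
    using assms(2) unfolding uniformly_continuous_on_def by metis
  then show ?thesis using that[of r] by (auto simp: dist_Pair_Pair dist_real_def abs_minus_commute)
qed (use that[of 1] in auto)

lemma BUC_time_continuous: "u \<in> BUC_time \<Longrightarrow> continuous_on (UNIV \<times> {0..T}) u"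
  by (cases "T \<ge> 0") (auto simp: BUC_time_def BUC_def intro: uniformly_continuous_imp_continuous)

text \<open>Space and time are doubled, with penalties N (t - s)^2, \<beta>(t) + \<beta>(s) and
  \<alpha> (|x|^2 + |y|^2) besides the coupling. At a maximum both one-sided tests see the same
  maximiser p, and in each the term H(p) . b cancels. There remains 2 \<gamma> on one side and, on
  the other, variations of H under shifts 2 \<alpha> x and 2 \<alpha> y, which are made smaller. The
  factor 1/2 in the closeness hypothesis leaves room for t \<noteq> s.\<close>

theorem doubling_comparison:
  fixes H :: "real^'d \<Rightarrow> real^'m" and u v :: "(real^'d) \<times> real \<Rightarrow> real"
  assumes R: "R \<ge> 0" and H: "continuous_on UNIV H"
    and mid: "\<And>p q. p \<in> cball 0 R \<Longrightarrow> q \<in> cball 0 R \<Longrightarrow>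
      norm (H p + H q - 2 *\<^sub>R H ((1/2) *\<^sub>R (p + q))) \<le> L / 2 * (norm (p - q))\<^sup>2"
    and L: "L > 0" and \<kappa>: "\<kappa> > 0"
    and u: "u \<in> BUC_time" and v: "v \<in> BUC_time"
    and sub: "viscosity_subsolution (\<lambda>t p. H p \<bullet> b1 t) u"
    and super: "viscosity_supersolution (\<lambda>t p. H p \<bullet> b2 t) v"
    and B1: "continuous_on {0..} B1" "\<And>t. t > 0 \<Longrightarrow> (B1 has_vector_derivative b1 t) (at t)" "B1 0 = 0"
    and B2: "continuous_on {0..} B2" "\<And>t. t > 0 \<Longrightarrow> (B2 has_vector_derivative b2 t) (at t)" "B2 0 = 0"
    and b1: "continuous_on {0..} b1" and b2: "continuous_on {0..} b2"
    and close: "\<And>t. t \<in> {0..T} \<Longrightarrow> L * norm (B1 t - B2 t) \<le> \<kappa> / 2"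
    and init: "\<And>x y. u (x, 0) - v (y, 0) \<le> Psi H R \<kappa> (x - y, 0) + M"
    and t1: "t1 \<in> {0..<T}"
  shows "u (x1, t1) - v (y1, t1) \<le> Psi H R \<kappa> (x1 - y1, B1 t1 - B2 t1) + M"
proof (rule ccontr)
  \<comment> \<open>A quarter of the assumed excess. The \<gamma>-term and the \<alpha>-term at the
    starting pair cost one \<sigma> each. The other two are spent, when t = 0 or s = 0 is excluded,
    on the time modulus of v or u and on the change of Psi in \<xi>.\<close>
  define \<sigma> where "\<sigma> = (u (x1, t1) - v (y1, t1) - Psi H R \<kappa> (x1 - y1, B1 t1 - B2 t1) - M) / 4"
  assume "\<not> ?thesis"
  then have \<sigma>: "\<sigma> > 0" by (simp add: \<sigma>_def)
  have HR: "continuous_on (cball 0 R) H" using H continuous_on_subset by blast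
  have T: "T > 0" using t1 by auto
  let ?\<Psi> = "Psi H R \<kappa>"
  obtain CH where CH: "CH \<ge> 0" "\<And>p. p \<in> cball 0 R \<Longrightarrow> norm (H p) \<le> CH"
  proof -
    have "bounded (H ` cball 0 R)" by (intro compact_imp_bounded compact_continuous_image HR) auto
    then show ?thesis by (rule bounded_image_norm_le) (use that in blast)
  qed
  obtain Cu where Cu: "Cu \<ge> 0" "\<And>x t. t \<in> {0..T} \<Longrightarrow> \<bar>u (x, t)\<bar> \<le> Cu"
    by (rule BUC_time_bounded[OF u, of T]) (use T in auto)
  obtain Cv where Cv: "Cv \<ge> 0" "\<And>x t. t \<in> {0..T} \<Longrightarrow> \<bar>v (x, t)\<bar> \<le> Cv"
    by (rule BUC_time_bounded[OF v, of T]) (use T in auto)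
  obtain C1 where C1: "C1 \<ge> 0" "\<And>t. t \<in> {0..T} \<Longrightarrow> norm (B1 t) \<le> C1"
    by (rule bounded_path[OF B1(1), of T]) auto
  obtain C2 where C2: "C2 \<ge> 0" "\<And>t. t \<in> {0..T} \<Longrightarrow> norm (B2 t) \<le> C2"
    by (rule bounded_path[OF B2(1), of T]) auto
  obtain c1 where c1: "c1 \<ge> 0" "\<And>t. t \<in> {0..T} \<Longrightarrow> norm (b1 t) \<le> c1"
    by (rule bounded_path[OF b1(1), of T]) auto
  obtain c2 where c2: "c2 \<ge> 0" "\<And>t. t \<in> {0..T} \<Longrightarrow> norm (b2 t) \<le> c2"
    by (rule bounded_path[OF b2(1), of T]) auto
  define C0 where "C0 = Cu + Cv + CH * (C1 + C2)"
  have C0: "u (x, t) - v (y, s) - ?\<Psi> (x - y, B1 t - B2 s) \<le> C0"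
    if "t \<in> {0..T}" "s \<in> {0..T}" for x y t s
  proof -
    have "H 0 \<bullet> (B1 t - B2 s) \<le> ?\<Psi> (x - y, B1 t - B2 s)"
      using maximizer(2)[OF R HR, of 0 \<kappa> "(x - y, B1 t - B2 s)"] R by (simp add: penal_def)
    moreover have "\<bar>H 0 \<bullet> (B1 t - B2 s)\<bar> \<le> norm (H 0) * norm (B1 t - B2 s)"
      by (rule Cauchy_Schwarz_ineq2)
    moreover have "norm (H 0) * norm (B1 t - B2 s) \<le> CH * (C1 + C2)"
      using C1(2)[OF that(1)] C2(2)[OF that(2)] CH R
      by (intro mult_mono order_trans[OF norm_triangle_ineq4]) auto
    ultimately show ?thesis using Cu(2)[OF that(1), of x] Cv(2)[OF that(2), of y] by (simp add: C0_def)
  qed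
  \<comment> \<open>At any pair where \<Phi> is at least M + 2 \<sigma> the penalties add up to less
    than D. All later constants are calibrated against this budget.\<close>
  define D where "D = C0 - M"
  have D: "D > 0" using C0[of t1 t1 x1 y1] t1 \<sigma> by (simp add: D_def \<sigma>_def)
  define \<gamma> where "\<gamma> = \<sigma> / (2 * (t1 + 1))"
  have \<gamma>: "\<gamma> > 0" "2 * \<gamma> * t1 \<le> \<sigma>" using \<sigma> t1 by (auto simp: \<gamma>_def field_simps)
  \<comment> \<open>The quadratic barrier vanishes up to t1 and costs the whole budget at T, so
    maxima stay strictly before T and nothing is lost at t1.\<close>
  define K where "K = D / (T - t1)\<^sup>2"
  have K: "K \<ge> 0" using D by (simp add: K_def)
  define \<beta> where "\<beta> t = \<gamma> * t + K * (max 0 (t - t1))\<^sup>2" for t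
  have \<beta>: "\<beta> t \<ge> 0" if "t \<ge> 0" for t using that \<gamma> K by (simp add: \<beta>_def)
  have \<beta>T: "\<beta> T > D" using t1 \<gamma> D T by (simp add: \<beta>_def K_def)
  have "\<exists>\<omega>>0. \<forall>p\<in>cball 0 R. \<forall>q. dist q p < \<omega> \<longrightarrow> (dist (H q) (H p)) * (c1 + c2 + 1) < \<gamma>"
  proof -
    \<comment> \<open>The radius is enlarged by 1 because the displaced argument of H may leave the
      ball of radius R.\<close>
    have "uniformly_continuous_on (cball 0 (R+1)) H"
      by (rule compact_uniformly_continuous[OF continuous_on_subset[OF H]]) simp_all
    moreover have "\<gamma> / (c1 + c2 + 1) > 0" using \<gamma>(1) c1(1) c2(1) by simp
    ultimately obtain d where d: "d > 0" "\<forall>p\<in>cball 0 (R+1). \<forall>q\<in>cball 0 (R+1). dist q p < d \<longrightarrow> dist (H q) (H p) < \<gamma> / (c1 + c2 + 1)"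
      unfolding uniformly_continuous_on_def by blast
    show ?thesis
    proof (intro exI[of _ "min d 1"] conjI ballI allI impI)
      fix p q :: "real^'d" assume "p \<in> cball 0 R" "dist q p < min d 1"
      moreover have "norm q \<le> norm p + dist q p" by (metis dist_norm norm_triangle_sub)
      ultimately have "dist (H q) (H p) < \<gamma> / (c1 + c2 + 1)" by (intro d(2)[rule_format]) auto
      then show "dist (H q) (H p) * (c1 + c2 + 1) < \<gamma>" using c1(1) c2(1) by (simp add: pos_less_divide_eq)
    qed (use d in auto)
  qed
  then obtain \<omega> where \<omega>: "\<omega> > 0"
    "\<And>p q. p \<in> cball 0 R \<Longrightarrow> dist q p < \<omega> \<Longrightarrow> dist (H q) (H p) * (c1 + c2 + 1) < \<gamma>" by blast
  \<comment> \<open>The first bound keeps the cost at (x1, y1) below \<sigma>. The second gives |2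
    \<alpha> x|^2 \<le> 4 \<alpha> D < \<omega>^2 whenever \<alpha> |x|^2 \<le> D.\<close>
  define \<alpha> where "\<alpha> = min (\<sigma> / (1 + x1 \<bullet> x1 + y1 \<bullet> y1)) (\<omega>\<^sup>2 / (8 * D))"
  have den: "1 + x1 \<bullet> x1 + y1 \<bullet> y1 > 0" by (simp add: add_pos_nonneg)
  have \<alpha>: "\<alpha> > 0" using den \<sigma> \<omega> D by (simp add: \<alpha>_def)
  have "\<alpha> * (1 + x1 \<bullet> x1 + y1 \<bullet> y1) \<le> \<sigma>"
    by (subst pos_le_divide_eq[OF den, symmetric]) (simp add: \<alpha>_def)
  then have \<alpha>1: "\<alpha> * (x1 \<bullet> x1) + \<alpha> * (y1 \<bullet> y1) \<le> \<sigma>" using \<alpha> by (simp add: algebra_simps)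
  have \<alpha>2: "norm ((2 * \<alpha> * e) *\<^sub>R x) < \<omega>" if "\<alpha> * (x \<bullet> x) \<le> D" "\<bar>e\<bar> = 1" for x :: "real^'d" and e
  proof (rule power2_less_imp_less)
    have "(norm ((2 * \<alpha> * e) *\<^sub>R x))\<^sup>2 = 4 * \<alpha> * (\<alpha> * (x \<bullet> x))"
      using that(2) \<alpha> by (simp add: abs_mult power_mult_distrib power2_norm_eq_inner) (simp add: power2_eq_square)
    also have "\<dots> \<le> 4 * \<alpha> * D" using that(1) \<alpha> by (intro mult_left_mono) auto
    also have "\<dots> \<le> 4 * (\<omega>\<^sup>2 / (8 * D)) * D" using D by (intro mult_right_mono mult_left_mono) (auto simp: \<alpha>_def)
    also have "\<dots> < \<omega>\<^sup>2" using D \<omega> by simp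
    finally show "(norm ((2 * \<alpha> * e) *\<^sub>R x))\<^sup>2 < \<omega>\<^sup>2" .
  qed (use \<omega> in auto)
  define \<epsilon> where "\<epsilon> = min (\<sigma> / (CH + 1)) (\<kappa> / (2 * L))"
  have \<epsilon>: "\<epsilon> > 0" using \<sigma> CH \<kappa> L by (simp add: \<epsilon>_def)
  have \<epsilon>1: "CH * \<epsilon> < \<sigma>"
  proof -
    have "CH * \<epsilon> \<le> CH * (\<sigma> / (CH + 1))" using CH by (intro mult_left_mono) (auto simp: \<epsilon>_def)
    also have "\<dots> < \<sigma>" using CH \<sigma> by (simp add: field_simps)
    finally show ?thesis .
  qed
  have \<epsilon>2: "L * \<epsilon> \<le> \<kappa> / 2"
  proof -
    have "L * \<epsilon> \<le> L * (\<kappa> / (2 * L))" using L by (intro mult_left_mono) (auto simp: \<epsilon>_def)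
    then show ?thesis using L by simp
  qed
  obtain r1 where r1: "r1 > 0" "\<And>s t. s \<in> {0..T} \<Longrightarrow> t \<in> {0..T} \<Longrightarrow> \<bar>s - t\<bar> < r1 \<Longrightarrow> dist (B1 s) (B1 t) < \<epsilon>"
    by (rule uniformly_continuous_on_path[OF B1(1) \<epsilon>, of T]) auto
  obtain r2 where r2: "r2 > 0" "\<And>s t. s \<in> {0..T} \<Longrightarrow> t \<in> {0..T} \<Longrightarrow> \<bar>s - t\<bar> < r2 \<Longrightarrow> dist (B2 s) (B2 t) < \<epsilon>"
    by (rule uniformly_continuous_on_path[OF B2(1) \<epsilon>, of T]) auto
  obtain r3 where r3: "r3 > 0" "\<And>x s t. s \<in> {0..T} \<Longrightarrow> t \<in> {0..T} \<Longrightarrow> \<bar>s - t\<bar> < r3 \<Longrightarrow> \<bar>u (x, s) - u (x, t)\<bar> < \<sigma>"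
    by (rule BUC_time_uniform[OF u \<sigma>, of T]) auto
  obtain r4 where r4: "r4 > 0" "\<And>x s t. s \<in> {0..T} \<Longrightarrow> t \<in> {0..T} \<Longrightarrow> \<bar>s - t\<bar> < r4 \<Longrightarrow> \<bar>v (x, s) - v (x, t)\<bar> < \<sigma>"
    by (rule BUC_time_uniform[OF v \<sigma>, of T]) auto
  define r where "r = min (min r1 r2) (min r3 r4)"
  have r: "r > 0" "r \<le> r1" "r \<le> r2" "r \<le> r3" "r \<le> r4" using r1 r2 r3 r4 by (auto simp: r_def)
  \<comment> \<open>A time gap of r would use up the budget D, so |t - s| < r at the maximum, within
    all four moduli.\<close>
  define N where "N = D / r\<^sup>2"
  have N: "N \<ge> 0" using D by (simp add: N_def)
  define \<Phi> where "\<Phi> z w = u z - v w - ?\<Psi> (fst z - fst w, B1 (snd z) - B2 (snd w))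
     - N * (snd z - snd w)\<^sup>2 - \<beta> (snd z) - \<beta> (snd w) - \<alpha> * (fst z \<bullet> fst z) - \<alpha> * (fst w \<bullet> fst w)" for z w
  let ?S = "UNIV \<times> {0..T} :: ((real^'d) \<times> real) set"
  have start: "\<Phi> (x1, t1) (y1, t1) \<ge> M + 2 * \<sigma>"
  proof -
    have "4 * \<sigma> = u (x1, t1) - v (y1, t1) - ?\<Psi> (x1 - y1, B1 t1 - B2 t1) - M" by (simp add: \<sigma>_def)
    then show ?thesis using \<alpha>1 \<gamma>(2) by (simp add: \<Phi>_def \<beta>_def)
  qed
  have good: "N * (t - s)\<^sup>2 < D" "\<beta> t < D" "\<beta> s < D" "\<alpha> * (x \<bullet> x) < D" "\<alpha> * (y \<bullet> y) < D"
    if "\<Phi> (x, t) (y, s) \<ge> M + 2 * \<sigma>" "t \<in> {0..T}" "s \<in> {0..T}" for x t y s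
  proof -
    have "N * (t - s)\<^sup>2 + \<beta> t + \<beta> s + \<alpha> * (x \<bullet> x) + \<alpha> * (y \<bullet> y) < D"
      using that C0[OF that(2,3), of x y] \<sigma> by (simp add: \<Phi>_def D_def)
    moreover have "N * (t - s)\<^sup>2 \<ge> 0" "\<alpha> * (x \<bullet> x) \<ge> 0" "\<alpha> * (y \<bullet> y) \<ge> 0" using N \<alpha> by auto
    ultimately show "N * (t - s)\<^sup>2 < D" "\<beta> t < D" "\<beta> s < D" "\<alpha> * (x \<bullet> x) < D" "\<alpha> * (y \<bullet> y) < D"
      using \<beta>[of t] \<beta>[of s] that by auto
  qed
  define A where "A = sqrt (D / \<alpha>)"
  have inA: "x \<in> cball 0 A" if "\<alpha> * (x \<bullet> x) < D" for x :: "real^'d"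
  proof -
    have "(norm x)\<^sup>2 \<le> D / \<alpha>" using that \<alpha> by (simp add: power2_norm_eq_inner field_simps)
    then show ?thesis by (simp add: A_def real_le_rsqrt)
  qed
  define Q where "Q = (cball 0 A \<times> {0..T} :: ((real^'d) \<times> real) set)"
  have Q1: "((x1, t1), (y1, t1)) \<in> Q \<times> Q"
    using good[OF start] t1 inA[of x1] inA[of y1] by (auto simp: Q_def)
  have cQ: "compact (Q \<times> Q)" unfolding Q_def by (intro compact_Times) auto
  have "continuous_on (Q \<times> Q) (\<lambda>zw. \<Phi> (fst zw) (snd zw))"
  proof -
    have 1: "continuous_on (Q \<times> Q) (\<lambda>zw. u (fst zw))"
      by (rule continuous_on_compose2[OF BUC_time_continuous[OF u, of T]]) (auto simp: Q_def intro!: continuous_intros)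
    have 2: "continuous_on (Q \<times> Q) (\<lambda>zw. v (snd zw))"
      by (rule continuous_on_compose2[OF BUC_time_continuous[OF v, of T]]) (auto simp: Q_def intro!: continuous_intros)
    have 3: "continuous_on (Q \<times> Q) (\<lambda>zw. B1 (snd (fst zw)))"
      by (rule continuous_on_compose2[OF B1(1)]) (auto simp: Q_def intro!: continuous_intros)
    have 4: "continuous_on (Q \<times> Q) (\<lambda>zw. B2 (snd (snd zw)))"
      by (rule continuous_on_compose2[OF B2(1)]) (auto simp: Q_def intro!: continuous_intros)
    have 5: "continuous_on (Q \<times> Q) (\<lambda>zw. ?\<Psi> (fst (fst zw) - fst (snd zw), B1 (snd (fst zw)) - B2 (snd (snd zw))))"
      by (rule continuous_on_compose2[OF continuous_on_Psi[OF R HR]]) (auto intro!: continuous_intros 3 4)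
    show ?thesis unfolding \<Phi>_def \<beta>_def by (intro continuous_intros 1 2 5)
  qed
  from continuous_attains_sup[OF cQ _ this] Q1
  obtain zw where zw: "zw \<in> Q \<times> Q" "\<And>zw'. zw' \<in> Q \<times> Q \<Longrightarrow> \<Phi> (fst zw') (snd zw') \<le> \<Phi> (fst zw) (snd zw)"
    by blast
  obtain x t y s where zw_eq: "zw = ((x, t), (y, s))" by (metis surj_pair)
  have t: "t \<in> {0..T}" and s: "s \<in> {0..T}" using zw(1) by (auto simp: zw_eq Q_def)
  have mx: "\<Phi> z w \<le> \<Phi> (x, t) (y, s)" if "(z, w) \<in> Q \<times> Q" for z w
    using zw(2)[OF that] by (simp add: zw_eq)
  have big: "\<Phi> (x, t) (y, s) \<ge> M + 2 * \<sigma>" using mx[OF Q1] start by linarith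
  \<comment> \<open>The maximum over the compact set is global on the strip: any pair with value at
    least M + 2 \<sigma> already lies in Q \<times> Q, by the budget.\<close>
  have mx: "\<Phi> z w \<le> \<Phi> (x, t) (y, s)" if z: "z \<in> ?S" and w: "w \<in> ?S" for z w
  proof (cases "\<Phi> z w \<ge> M + 2 * \<sigma>")
    case True
    then have "(z, w) \<in> Q \<times> Q"
      using good[of "fst z" "snd z" "fst w" "snd w"] z w inA[of "fst z"] inA[of "fst w"]
      by (auto simp: Q_def)
    then show ?thesis by (rule mx)
  qed (use big in auto)
  note G = good[OF big t s]
  have tT: "t < T" and sT: "s < T" using G(2,3) \<beta>T t s by (auto simp: less_le)
  have ts: "\<bar>t - s\<bar> < r"
  proof (rule ccontr)
    assume "\<not> ?thesis"
    then have "r\<^sup>2 \<le> \<bar>t - s\<bar>\<^sup>2" using r(1) by (intro power_mono) auto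
    then have "N * r\<^sup>2 \<le> N * (t - s)\<^sup>2" using N by (intro mult_left_mono) auto
    then show False using G(1) r(1) by (simp add: N_def)
  qed
  have up: "u (x, t) - v (y, s) - ?\<Psi> (x - y, B1 t - B2 s) \<ge> M + 2 * \<sigma>"
  proof -
    have "N * (t - s)\<^sup>2 \<ge> 0" "\<alpha> * (x \<bullet> x) \<ge> 0" "\<alpha> * (y \<bullet> y) \<ge> 0" using N \<alpha> by auto
    then show ?thesis using big \<beta>[of t] \<beta>[of s] t s by (simp add: \<Phi>_def)
  qed
  have \<Psi>0: "?\<Psi> (x - y, 0) < ?\<Psi> (x - y, \<xi>) + \<sigma>" if "norm \<xi> < \<epsilon>" for \<xi>
  proof -
    have "?\<Psi> (x - y, 0) \<le> ?\<Psi> (x - y, \<xi>) + CH * norm (0 - \<xi>)"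
      by (rule Psi_lipschitz_snd[OF R HR CH(2)])
    moreover have "CH * norm (0 - \<xi>) \<le> CH * \<epsilon>" using that CH by (intro mult_left_mono) auto
    ultimately show ?thesis using \<epsilon>1 by linarith
  qed
  have t0: "t > 0"
  proof (rule ccontr)
    assume "\<not> t > 0"
    then have "t = 0" using t by auto
    moreover have "\<bar>v (y, s) - v (y, 0)\<bar> < \<sigma>" using r4(2)[of s 0 y] s T ts r \<open>t = 0\<close> by auto
    moreover have "norm (- B2 s) < \<epsilon>" using r2(2)[of s 0] s T ts r \<open>t = 0\<close> B2(3) by auto
    ultimately show False using up \<Psi>0[of "- B2 s"] init[of x y] B1(3) by simp
  qed
  have s0: "s > 0"
  proof (rule ccontr)
    assume "\<not> s > 0"
    then have "s = 0" using s by auto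
    moreover have "\<bar>u (x, t) - u (x, 0)\<bar> < \<sigma>" using r3(2)[of t 0 x] t T ts r \<open>s = 0\<close> by auto
    moreover have "norm (B1 t) < \<epsilon>" using r1(2)[of t 0] t T ts r \<open>s = 0\<close> B1(3) by auto
    ultimately show False using up \<Psi>0[of "B1 t"] init[of x y] B2(3) by simp
  qed
  have cl: "L * norm (B1 t - B2 s) < \<kappa>"
  proof -
    have "norm (B1 t - B2 s) \<le> norm (B1 t - B2 t) + norm (B2 t - B2 s)"
      using norm_triangle_ineq[of "B1 t - B2 t" "B2 t - B2 s"] by simp
    then have "L * norm (B1 t - B2 s) \<le> L * norm (B1 t - B2 t) + L * norm (B2 t - B2 s)"
      using L by (simp flip: distrib_left)
    moreover have "L * norm (B2 t - B2 s) < L * \<epsilon>"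
      using r2(2)[OF t s] ts r L by (auto simp: dist_norm)
    ultimately show ?thesis using close[OF t] \<epsilon>2 by linarith
  qed
  define p where "p = maximizer H R \<kappa> (x - y, B1 t - B2 s)"
  have near: "\<forall>\<^sub>F z in nhds (x, t). z \<in> ?S" if "0 < t" "t < T" for x t
  proof -
    have "\<forall>\<^sub>F z in nhds (x, t). z \<in> UNIV \<times> {0<..<T}"
      using that by (intro eventually_nhds_in_open open_Times) auto
    then show ?thesis by eventually_elim auto
  qed
  have "2 * N * (t - s) + \<gamma> \<le> 1 * ((H (maximizer H R \<kappa> (1 *\<^sub>R (x - y), 1 *\<^sub>R (B1 t - B2 s)) + (2 * \<alpha> * 1) *\<^sub>R x) - H (maximizer H R \<kappa> (1 *\<^sub>R (x - y), 1 *\<^sub>R (B1 t - B2 s)))) \<bullet> b1 t)"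
  proof (rule subsolution_Psi_test[OF R HR mid _ _ B1(2) b1 t0 cl, where u=u and K=K and ?t1.0=t1])
    show "\<forall>\<^sub>F z in nhds (x, t). u z - (Psi H R \<kappa> (1 *\<^sub>R (fst z - y), 1 *\<^sub>R (B1 (snd z) - B2 s)) + N * (snd z - s)\<^sup>2
         + (\<gamma> * snd z + K * (max 0 (snd z - t1))\<^sup>2) + \<alpha> * (fst z \<bullet> fst z))
     \<le> u (x, t) - (Psi H R \<kappa> (1 *\<^sub>R (x - y), 1 *\<^sub>R (B1 t - B2 s)) + N * (t - s)\<^sup>2
         + (\<gamma> * t + K * (max 0 (t - t1))\<^sup>2) + \<alpha> * (x \<bullet> x))"
      using near[OF t0 tT]
    proof eventually_elim
      case (elim z)
      show ?case using mx[OF elim, of "(y, s)"] s by (simp add: \<Phi>_def \<beta>_def)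
    qed
    show "viscosity_subsolution (\<lambda>t p. 1 * (H (1 *\<^sub>R p) \<bullet> b1 t)) u" using sub by simp
  qed (use K in auto)
  \<comment> \<open>The case e = -1, applied to - v. The signs turn (y - x, B2 s - B1 t) back into
    (x - y, B1 t - B2 s), so the maximiser is the same p.\<close>
  moreover have "2 * N * (s - t) + \<gamma> \<le> -1 * ((H (maximizer H R \<kappa> (-1 *\<^sub>R (y - x), -1 *\<^sub>R (B2 s - B1 t)) + (2 * \<alpha> * -1) *\<^sub>R y) - H (maximizer H R \<kappa> (-1 *\<^sub>R (y - x), -1 *\<^sub>R (B2 s - B1 t)))) \<bullet> b2 s)"
  proof (rule subsolution_Psi_test[OF R HR mid _ _ B2(2) b2 s0, where u="\<lambda>z. - v z" and K=K and ?t1.0=t1])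
    show "\<forall>\<^sub>F z in nhds (y, s). - v z - (Psi H R \<kappa> (-1 *\<^sub>R (fst z - x), -1 *\<^sub>R (B2 (snd z) - B1 t)) + N * (snd z - t)\<^sup>2
         + (\<gamma> * snd z + K * (max 0 (snd z - t1))\<^sup>2) + \<alpha> * (fst z \<bullet> fst z))
     \<le> - v (y, s) - (Psi H R \<kappa> (-1 *\<^sub>R (y - x), -1 *\<^sub>R (B2 s - B1 t)) + N * (s - t)\<^sup>2
         + (\<gamma> * s + K * (max 0 (s - t1))\<^sup>2) + \<alpha> * (y \<bullet> y))"
      using near[OF s0 sT]
    proof eventually_elim
      case (elim z)
      show ?case using mx[OF _ elim, of "(x, t)"] t
        by (simp add: \<Phi>_def \<beta>_def power2_commute[of t])
    qed
    show "viscosity_subsolution (\<lambda>t p. -1 * (H (-1 *\<^sub>R p) \<bullet> b2 t)) (\<lambda>z. - v z)"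
      using super by (simp add: subsolution_minus_iff[symmetric])
    show "L * norm (B2 s - B1 t) < \<kappa>" using cl by (simp add: norm_minus_commute)
  qed (use K in auto)
  \<comment> \<open>Adding the two inequalities cancels the terms 2 N (t - s) and 2 N (s - t); the
    size of N is therefore harmless.\<close>
  ultimately have fin: "2 * \<gamma> \<le> (H (p + (2 * \<alpha> * 1) *\<^sub>R x) - H p) \<bullet> b1 t - (H (p + (2 * \<alpha> * -1) *\<^sub>R y) - H p) \<bullet> b2 s"
    by (simp add: p_def algebra_simps)
  have small: "\<bar>(H (p + (2 * \<alpha> * e) *\<^sub>R x) - H p) \<bullet> b\<bar> < \<gamma>"
    if "\<alpha> * (x \<bullet> x) < D" "\<bar>e\<bar> = 1" "norm b \<le> c1 + c2" for x e b
  proof -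
    have "dist (H (p + (2 * \<alpha> * e) *\<^sub>R x)) (H p) * (c1 + c2 + 1) < \<gamma>"
      using \<alpha>2[of x e] that maximizer(1)[OF R HR] by (intro \<omega>(2)) (auto simp: p_def dist_norm)
    moreover have "\<bar>(H (p + (2 * \<alpha> * e) *\<^sub>R x) - H p) \<bullet> b\<bar> \<le> dist (H (p + (2 * \<alpha> * e) *\<^sub>R x)) (H p) * norm b"
      unfolding dist_norm by (rule Cauchy_Schwarz_ineq2)
    moreover have "dist (H (p + (2 * \<alpha> * e) *\<^sub>R x)) (H p) * norm b \<le> dist (H (p + (2 * \<alpha> * e) *\<^sub>R x)) (H p) * (c1 + c2 + 1)"
      using that by (intro mult_left_mono) auto
    ultimately show ?thesis by linarith
  qed
  have "norm (b1 t) \<le> c1 + c2" "norm (b2 s) \<le> c1 + c2" using c1 c2 t s by (auto intro: add_increasing add_increasing2)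
  then show False using fin small[OF G(4), of 1 "b1 t"] small[OF G(5), of "-1" "b2 s"] by linarith
qed

subsection \<open>Stability in the path and the initial datum\<close>

abbreviation driven :: "(real^'d \<Rightarrow> real^'m) \<Rightarrow> (real \<Rightarrow> real^'m) \<Rightarrow> real \<Rightarrow> real^'d \<Rightarrow> real" where
  "driven H B \<equiv> (\<lambda>t p. \<Sum>i\<in>UNIV. H p $ i * vector_derivative B (at t) $ i)"

lemma driven_inner: "driven H B t p = H p \<bullet> vector_derivative B (at t)"
  by (simp add: inner_vec_def)

lemma viscosity_subsolution_cong:
  assumes "\<And>t p. t > 0 \<Longrightarrow> F t p = G t p"
  shows "viscosity_subsolution F u \<longleftrightarrow> viscosity_subsolution G u"
  using assms by (simp add: viscosity_subsolution_def)

lemma viscosity_supersolution_cong: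
  assumes "\<And>t p. t > 0 \<Longrightarrow> F t p = G t p"
  shows "viscosity_supersolution F u \<longleftrightarrow> viscosity_supersolution G u"
  using assms by (simp add: viscosity_supersolution_def)

lemma C11_loc_continuous: "C11_loc H \<Longrightarrow> continuous_on UNIV H"
  unfolding C11_loc_def by (meson continuous_at_imp_continuous_on has_derivative_continuous)

text \<open>The constants R, \<kappa> and d are chosen from u0, H and e alone. Since d does not
  depend on T, the same estimate serves finite intervals and the whole half-line.\<close>

lemma stability:
  fixes H :: "real^'d \<Rightarrow> real^'m" and u0 :: "real^'d \<Rightarrow> real"
  assumes C11: "C11_loc H" and u0: "u0 \<in> BUC UNIV" and e: "e > 0"
  obtains d where "d > 0"
    and "\<And>B1 B2 u v T x t.
      \<lbrakk>C1_path B1; C1_path B2; B1 0 = 0; B2 0 = 0; u \<in> BUC_time; v \<in> BUC_time;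
       viscosity_subsolution (driven H B1) u; viscosity_supersolution (driven H B2) v;
       \<And>x. u (x, 0) \<le> u0 x + d; \<And>x. u0 x - d \<le> v (x, 0);
       \<And>t. t \<in> {0..T} \<Longrightarrow> norm (B1 t - B2 t) \<le> d; t \<in> {0..T}\<rbrakk> \<Longrightarrow> u (x, t) - v (x, t) \<le> e"
proof -
  \<comment> \<open>Five losses: one for the modulus of u0, two for the initial errors, one for the
    path distance, one for passing to the final time.\<close>
  define e' where "e' = e / 5"
  have e': "e' > 0" using e by (simp add: e'_def)
  have H: "continuous_on UNIV H" using C11 by (rule C11_loc_continuous)
  have "bounded (u0 ` UNIV)" using u0 by (simp add: BUC_def)
  then obtain C where C: "C \<ge> 0" "\<And>x. \<bar>u0 x\<bar> \<le> C" by (rule bounded_image_norm_le) auto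
  have "uniformly_continuous_on UNIV u0" using u0 by (simp add: BUC_def)
  then obtain r where r: "r > 0" "\<forall>x. \<forall>y. dist y x < r \<longrightarrow> dist (u0 y) (u0 x) < e'"
    using e' unfolding uniformly_continuous_on_def by blast
  \<comment> \<open>With \<kappa> R^2 = 1 this gives R |z| - \<kappa> R^2 \<ge> R r - 1 = 2 C for
    |z| \<ge> r. Beyond distance r the coupling thus exceeds the oscillation of u0; within r, the
    modulus of continuity and Psi \<ge> 0 suffice.\<close>
  define R where "R = (2 * C + 1) / r"
  define \<kappa> where "\<kappa> = 1 / R\<^sup>2"
  have R: "R > 0" using r C by (simp add: R_def)
  have \<kappa>: "\<kappa> > 0" using R by (simp add: \<kappa>_def)
  have HR: "continuous_on (cball 0 R) H" using H continuous_on_subset by blast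
  obtain L where L: "L > 0" and mid: "\<And>p q. p \<in> cball 0 R \<Longrightarrow> q \<in> cball 0 R \<Longrightarrow>
    norm (H p + H q - 2 *\<^sub>R H ((1/2) *\<^sub>R (p + q))) \<le> L / 2 * (norm (p - q))\<^sup>2"
    by (rule C11_loc_midpoint[OF C11, of R]) blast
  have "bounded (H ` cball 0 R)" by (intro compact_imp_bounded compact_continuous_image HR) auto
  then obtain CH where CH: "CH \<ge> 0" "\<And>p. p \<in> cball 0 R \<Longrightarrow> norm (H p) \<le> CH"
    by (rule bounded_image_norm_le) blast
  define d where "d = Min {e', \<kappa> / (2 * L), e' / (CH + 1)}"
  have d: "d > 0" "d \<le> e'" "L * d \<le> \<kappa> / 2" "CH * d \<le> e'"
  proof -
    show "d > 0" "d \<le> e'" using e' \<kappa> L CH by (auto simp: d_def)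
    have "d \<le> \<kappa> / (2 * L)" "d \<le> e' / (CH + 1)" by (auto simp: d_def)
    then show "L * d \<le> \<kappa> / 2" using L by (simp add: field_simps)
    have "(CH + 1) * d \<le> e'" using \<open>d \<le> e' / (CH + 1)\<close> CH by (simp add: field_simps)
    then show "CH * d \<le> e'" using \<open>d > 0\<close> by (simp add: algebra_simps)
  qed
  have Psi0: "u0 x - u0 y \<le> Psi H R \<kappa> (x - y, 0) + e'" for x y
  proof (cases "dist x y < r")
    case True
    then have "\<bar>u0 x - u0 y\<bar> < e'" using r(2) by (auto simp: dist_real_def)
    moreover have "0 \<le> Psi H R \<kappa> (x - y, 0)"
      using maximizer(2)[OF _ HR, of 0 \<kappa> "(x - y, 0)"] R by (simp add: penal_def)
    ultimately show ?thesis by linarith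
  next
    case False
    define z where "z = x - y"
    have z: "norm z \<ge> r" "norm z > 0" using False r(1) by (auto simp: z_def dist_norm)
    define p where "p = (R / norm z) *\<^sub>R z"
    have p: "p \<bullet> z = R * norm z" "p \<bullet> p = R\<^sup>2" "p \<in> cball 0 R"
      using z R by (auto simp: p_def power2_norm_eq_inner[symmetric] power2_eq_square)
    have "R * norm z - \<kappa> * R\<^sup>2 \<le> Psi H R \<kappa> (z, 0)"
      using maximizer(2)[OF _ HR p(3), of \<kappa> "(z, 0)"] R p by (simp add: penal_def)
    moreover have "\<kappa> * R\<^sup>2 = 1" using R by (simp add: \<kappa>_def)
    moreover have "R * norm z \<ge> R * r" using z R by simp
    moreover have "R * r = 2 * C + 1" using r by (simp add: R_def)
    ultimately show ?thesis using C(2)[of x] C(2)[of y] e' by (simp add: z_def)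
  qed
  show ?thesis
  proof (rule that[OF d(1)])
    fix B1 B2 :: "real \<Rightarrow> real^'m" and u v T x and t :: real
    assume paths: "C1_path B1" "C1_path B2" "B1 0 = 0" "B2 0 = 0" and uv: "u \<in> BUC_time" "v \<in> BUC_time"
      and sub: "viscosity_subsolution (driven H B1) u" and super: "viscosity_supersolution (driven H B2) v"
      and init: "\<And>x. u (x, 0) \<le> u0 x + d" "\<And>x. u0 x - d \<le> v (x, 0)"
      and close: "\<And>t. t \<in> {0..T} \<Longrightarrow> norm (B1 t - B2 t) \<le> d" and t: "t \<in> {0..T}"
    obtain b1 where b1: "continuous_on {0..} b1" "continuous_on {0..} B1"
      "\<And>t. t > 0 \<Longrightarrow> (B1 has_vector_derivative b1 t) (at t)"
      "\<And>t. t > 0 \<Longrightarrow> vector_derivative B1 (at t) = b1 t"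
      by (rule C1_path_derivative[OF paths(1)]) blast
    obtain b2 where b2: "continuous_on {0..} b2" "continuous_on {0..} B2"
      "\<And>t. t > 0 \<Longrightarrow> (B2 has_vector_derivative b2 t) (at t)"
      "\<And>t. t > 0 \<Longrightarrow> vector_derivative B2 (at t) = b2 t"
      by (rule C1_path_derivative[OF paths(2)]) blast
    have sub': "viscosity_subsolution (\<lambda>t p. H p \<bullet> b1 t) u"
      by (rule viscosity_subsolution_cong[THEN iffD1, OF _ sub]) (subst driven_inner, simp add: b1(4))
    have super': "viscosity_supersolution (\<lambda>t p. H p \<bullet> b2 t) v"
      by (rule viscosity_supersolution_cong[THEN iffD1, OF _ super]) (subst driven_inner, simp add: b2(4))
    have L_close: "L * norm (B1 t - B2 t) \<le> \<kappa> / 2" if "t \<in> {0..T}" for t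
    proof -
      have "L * norm (B1 t - B2 t) \<le> L * d" using close[OF that] L by simp
      then show ?thesis using d(3) by linarith
    qed
    have start: "u (x, 0) - v (y, 0) \<le> Psi H R \<kappa> (x - y, 0) + (3 * e')" for x y
      using Psi0[of x y] init(1)[of x] init(2)[of y] d(2) by linarith
    \<comment> \<open>The barrier needs room after the time considered, and the paths are known to
      be close only up to T. The time T itself is reached by continuity of u and v, or by the
      initial data if T = 0.\<close>
    have before: "u (x, s) - v (x, s) \<le> 4 * e'" if s: "s \<in> {0..<T}" for s
    proof -
      have "u (x, s) - v (x, s) \<le> Psi H R \<kappa> (x - x, B1 s - B2 s) + (3 * e')"
        by (rule doubling_comparison[OF less_imp_le[OF R] H mid L \<kappa> uv sub' super' b1(2,3) paths(3)
            b2(2,3) paths(4) b1(1) b2(1) L_close start s])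
      moreover have "Psi H R \<kappa> (0, B1 s - B2 s) \<le> Psi H R \<kappa> (0, 0) + CH * norm (B1 s - B2 s - 0)"
        using Psi_lipschitz_snd[OF less_imp_le[OF R] HR CH(2), of \<kappa> 0 "B1 s - B2 s" 0] by simp
      moreover have "Psi H R \<kappa> (0, 0) \<le> 0" by (rule Psi_zero_le[OF less_imp_le[OF R] HR]) (use \<kappa> in simp)
      moreover have "CH * norm (B1 s - B2 s - 0) \<le> CH * d"
        using close[of s] s CH by (intro mult_left_mono) auto
      ultimately show ?thesis using d(4) by simp
    qed
    show "u (x, t) - v (x, t) \<le> e"
    proof (cases "t < T")
      case True
      then show ?thesis using before[of t] t e' by (simp add: e'_def)
    next
      case False
      then have tT: "t = T" "T \<ge> 0" using t by auto
      show ?thesis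
      proof (cases "T = 0")
        case True
        then show ?thesis using init(1)[of x] init(2)[of x] d(2) e' tT by (simp add: e'_def)
      next
        case False
        have e2: "e' / 2 > 0" using e' by simp
        obtain ru where ru: "ru > 0" "\<And>x s t. s \<in> {0..T} \<Longrightarrow> t \<in> {0..T} \<Longrightarrow> \<bar>s - t\<bar> < ru \<Longrightarrow> \<bar>u (x, s) - u (x, t)\<bar> < e' / 2"
          by (rule BUC_time_uniform[OF uv(1) e2, of T]) auto
        obtain rv where rv: "rv > 0" "\<And>x s t. s \<in> {0..T} \<Longrightarrow> t \<in> {0..T} \<Longrightarrow> \<bar>s - t\<bar> < rv \<Longrightarrow> \<bar>v (x, s) - v (x, t)\<bar> < e' / 2"
          by (rule BUC_time_uniform[OF uv(2) e2, of T]) auto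
        define s where "s = T - Min {T, ru / 2, rv / 2}"
        have s: "s \<in> {0..<T}" "\<bar>T - s\<bar> < ru" "\<bar>T - s\<bar> < rv"
          using False tT ru(1) rv(1) by (auto simp: s_def min_def)
        have sT: "s \<in> {0..T}" "T \<in> {0..T}" using s(1) tT by auto
        have "u (x, T) - u (x, s) < e' / 2" using ru(2)[OF sT(2,1) s(2), of x] by linarith
        moreover have "v (x, s) - v (x, T) < e' / 2" using rv(2)[OF sT(2,1) s(3), of x] by linarith
        moreover have "5 * e' = e" by (simp add: e'_def)
        ultimately show ?thesis using before[OF s(1)] unfolding tT(1) by linarith
      qed
    qed
  qed
qed

corollary comparison:
  fixes H :: "real^'d \<Rightarrow> real^'m" and u0 :: "real^'d \<Rightarrow> real"
  assumes "C11_loc H" "u0 \<in> BUC UNIV" "C1_path B" "B 0 = 0" "u \<in> BUC_time" "v \<in> BUC_time"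
    "viscosity_subsolution (driven H B) u" "viscosity_supersolution (driven H B) v"
    "\<And>x. u (x, 0) = u0 x" "\<And>x. v (x, 0) = u0 x" "t \<ge> 0"
  shows "u (x, t) \<le> v (x, t)"
proof (rule field_le_epsilon)
  fix e :: real assume e: "e > 0"
  obtain d where d: "d > 0" "\<And>B1 B2 u v T x t.
      \<lbrakk>C1_path B1; C1_path B2; B1 0 = 0; B2 0 = 0; u \<in> BUC_time; v \<in> BUC_time;
       viscosity_subsolution (driven H B1) u; viscosity_supersolution (driven H B2) v;
       \<And>x. u (x, 0) \<le> u0 x + d; \<And>x. u0 x - d \<le> v (x, 0);
       \<And>t. t \<in> {0..T} \<Longrightarrow> norm (B1 t - B2 t) \<le> d; t \<in> {0..T}\<rbrakk> \<Longrightarrow> u (x, t) - v (x, t) \<le> e"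
    by (rule stability[OF assms(1,2) e]) blast
  have "u (x, t) - v (x, t) \<le> e"
    by (rule d(2)[OF assms(3,3,4,4,5,6,7,8), of t]) (use d(1) assms(9-11) in auto)
  then show "u (x, t) \<le> v (x, t) + e" by simp
qed

corollary HJ_solutions_close:
  fixes H :: "real^'d \<Rightarrow> real^'m" and u0 :: "real^'d \<Rightarrow> real"
  assumes "C11_loc H" "u0 \<in> BUC UNIV" "e > 0"
  obtains d where "d > 0"
    and "\<And>B1 B2 u1 u2 v1 v2 T x t.
      \<lbrakk>C1_path B1; C1_path B2; B1 0 = 0; B2 0 = 0; u1 \<in> BUC_time; u2 \<in> BUC_time;
       HJ_solution H B1 v1 u1; HJ_solution H B2 v2 u2;
       \<And>x. \<bar>v1 x - u0 x\<bar> \<le> d; \<And>x. \<bar>v2 x - u0 x\<bar> \<le> d;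
       \<And>t. t \<in> {0..T} \<Longrightarrow> norm (B1 t - B2 t) \<le> d; t \<in> {0..T}\<rbrakk> \<Longrightarrow> \<bar>u1 (x, t) - u2 (x, t)\<bar> \<le> e"
proof -
  obtain d where d: "d > 0" "\<And>B1 B2 u v T x t.
      \<lbrakk>C1_path B1; C1_path B2; B1 0 = 0; B2 0 = 0; u \<in> BUC_time; v \<in> BUC_time;
       viscosity_subsolution (driven H B1) u; viscosity_supersolution (driven H B2) v;
       \<And>x. u (x, 0) \<le> u0 x + d; \<And>x. u0 x - d \<le> v (x, 0);
       \<And>t. t \<in> {0..T} \<Longrightarrow> norm (B1 t - B2 t) \<le> d; t \<in> {0..T}\<rbrakk> \<Longrightarrow> u (x, t) - v (x, t) \<le> e"
    by (rule stability[OF assms]) blast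
  show ?thesis
  proof (rule that[OF d(1)])
    fix B1 B2 :: "real \<Rightarrow> real^'m" and u1 u2 v1 v2 T x and t :: real
    assume A: "C1_path B1" "C1_path B2" "B1 0 = 0" "B2 0 = 0" "u1 \<in> BUC_time" "u2 \<in> BUC_time"
       and S: "HJ_solution H B1 v1 u1" "HJ_solution H B2 v2 u2"
       and I: "\<And>x. \<bar>v1 x - u0 x\<bar> \<le> d" "\<And>x. \<bar>v2 x - u0 x\<bar> \<le> d"
       and D: "\<And>t. t \<in> {0..T} \<Longrightarrow> norm (B1 t - B2 t) \<le> d" and t: "t \<in> {0..T}"
    have S1: "viscosity_subsolution (driven H B1) u1" "viscosity_supersolution (driven H B1) u1" "\<And>x. u1 (x, 0) = v1 x"
      and S2: "viscosity_subsolution (driven H B2) u2" "viscosity_supersolution (driven H B2) u2" "\<And>x. u2 (x, 0) = v2 x"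
      using S by (simp_all add: HJ_solution_def viscosity_solution_def)
    have b: "u1 (x, 0) \<le> u0 x + d" "u0 x - d \<le> u1 (x, 0)" "u2 (x, 0) \<le> u0 x + d" "u0 x - d \<le> u2 (x, 0)" for x
      using I(1)[of x] I(2)[of x] S1(3)[of x] S2(3)[of x] by linarith+
    have D': "norm (B2 t - B1 t) \<le> d" if "t \<in> {0..T}" for t
      using D[OF that] by (simp add: norm_minus_commute)
    have "u1 (x, t) - u2 (x, t) \<le> e" by (rule d(2)[OF A S1(1) S2(2) b(1,4) D t])
    moreover have "u2 (x, t) - u1 (x, t) \<le> e"
      by (rule d(2)[OF A(2,1,4,3,6,5) S2(1) S1(2) b(3,2) D' t])
    ultimately show "\<bar>u1 (x, t) - u2 (x, t)\<bar> \<le> e" by linarith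
  qed
qed

subsection \<open>Lax--Friedrichs steps and half-relaxed limits\<close>

text \<open>One Lax--Friedrichs step. The mesh width \<open>c |\<xi>|\<close> is proportional to the increment of the
  path; for \<open>\<xi> = 0\<close> the division by zero is harmless, and the step is the identity.\<close>

definition lax :: "(real^'d \<Rightarrow> real^'m) \<Rightarrow> real \<Rightarrow> real^'m \<Rightarrow> (real^'d \<Rightarrow> real) \<Rightarrow> real^'d \<Rightarrow> real" where
  "lax H c \<xi> f x = (\<Sum>i\<in>UNIV. f (x + axis i (c * norm \<xi>)) + f (x - axis i (c * norm \<xi>))) / (2 * real CARD('d))
     + \<xi> \<bullet> H (\<chi> i. (f (x + axis i (c * norm \<xi>)) - f (x - axis i (c * norm \<xi>))) / (2 * (c * norm \<xi>)))"

lemma norm_axis_real: "norm (axis i h :: real^'d) = \<bar>h\<bar>"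
  by (simp add: norm_eq_sqrt_inner inner_axis_axis)

lemma lax_zero: "lax H c 0 f x = f x" for f :: "real^'d \<Rightarrow> real"
  by (simp add: lax_def axis_eq_0_iff[THEN iffD2])

lemma lax_add_const: "lax H c \<xi> (\<lambda>y. f y + a) x = lax H c \<xi> f x + a" for f :: "real^'d \<Rightarrow> real"
  by (simp add: lax_def sum.distrib add_divide_distrib)

lemma lax_shift: "lax H c \<xi> (\<lambda>y. f (y + k)) x = lax H c \<xi> f (x + k)"
  by (simp add: lax_def algebra_simps)

lemma lax_minus: "lax (\<lambda>p. - H (- p)) c \<xi> (\<lambda>y. - f y) x = - lax H c \<xi> f x"
proof -
  have "(\<chi> i. (- f (x + axis i h) - - f (x - axis i h)) / k) = - (\<chi> i. (f (x + axis i h) - f (x - axis i h)) / k)" for h k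
    by (simp add: vec_eq_iff minus_divide_left)
  moreover have "(\<Sum>i\<in>UNIV. - f (x + axis i h) + - f (x - axis i h)) = - (\<Sum>i\<in>UNIV. f (x + axis i h) + f (x - axis i h))" for h
    by (simp add: sum_negf[symmetric])
  ultimately show ?thesis unfolding lax_def by simp
qed

context
  fixes H :: "real^'d \<Rightarrow> real^'m" and l c :: real
  assumes lip: "\<And>p q. norm (H p - H q) \<le> l * norm (p - q)"
    and c: "c > 0" and cfl: "real CARD('d) * l \<le> c"
begin

lemma lipschitz_const_nonneg: "l \<ge> 0"
  using lip[of "axis undefined 1" 0] norm_ge_zero[of "H (axis undefined 1) - H 0"]
  by (simp add: norm_axis_real del: norm_ge_zero)

text \<open>Raising the node values by a total of S lifts the average by S / (2 n). The discrete
  gradient moves by at most S / (2 h), so with h = c |\<xi>| the Hamiltonian term moves by at most S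
  l / (2 c). The CFL condition n l \<le> c says exactly that the gain covers this loss.\<close>

lemma lax_mono:
  assumes le: "\<And>y. y \<in> cball x (c * norm \<xi>) \<Longrightarrow> f y \<le> g y"
  shows "lax H c \<xi> f x \<le> lax H c \<xi> g x"
proof (cases "\<xi> = 0")
  case True
  then show ?thesis using le[of x] by (simp add: lax_zero)
next
  case False
  define h where "h = c * norm \<xi>"
  have h: "h > 0" using False c by (simp add: h_def)
  define n where "n = real CARD('d)"
  have n: "n > 0" by (simp add: n_def)
  define a b where "a i = g (x + axis i h) - f (x + axis i h)" and "b i = g (x - axis i h) - f (x - axis i h)" for i
  have ab: "a i \<ge> 0" "b i \<ge> 0" for i
    using le[of "x + axis i h"] le[of "x - axis i h"] h
    by (auto simp: a_def b_def h_def[symmetric] dist_norm norm_axis_real)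
  define P where "P f = (\<chi> i. (f (x + axis i h) - f (x - axis i h)) / (2 * h))" for f :: "real^'d \<Rightarrow> real"
  define S where "S = (\<Sum>i\<in>UNIV. a i + b i)"
  have S: "S \<ge> 0" unfolding S_def using ab by (intro sum_nonneg) (simp add: add_nonneg_nonneg)
  have "norm (P f - P g) \<le> (\<Sum>i\<in>UNIV. \<bar>(P f - P g) $ i\<bar>)" by (rule norm_le_l1_cart)
  also have "\<dots> \<le> (\<Sum>i\<in>UNIV. (a i + b i) / (2 * h))"
  proof (rule sum_mono)
    fix i
    have "(P f - P g) $ i = (b i - a i) / (2 * h)"
      by (simp add: P_def a_def b_def diff_divide_distrib)
    moreover have "\<bar>(b i - a i) / (2 * h)\<bar> \<le> (a i + b i) / (2 * h)"
      unfolding abs_divide using ab[of i] h by (intro divide_mono) auto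
    ultimately show "\<bar>(P f - P g) $ i\<bar> \<le> (a i + b i) / (2 * h)" by simp
  qed
  also have "\<dots> = S / (2 * h)" by (simp add: S_def sum_divide_distrib)
  finally have P: "norm (P f - P g) \<le> S / (2 * h)" .
  have "\<xi> \<bullet> (H (P f) - H (P g)) \<le> norm \<xi> * norm (H (P f) - H (P g))" by (rule norm_cauchy_schwarz)
  also have "\<dots> \<le> norm \<xi> * (l * norm (P f - P g))" by (intro mult_left_mono lip) auto
  also have "\<dots> \<le> norm \<xi> * (l * (S / (2 * h)))"
    by (intro mult_left_mono P lipschitz_const_nonneg) auto
  also have "\<dots> = S * (l / (2 * c))" using False c by (simp add: h_def field_simps)
  also have "\<dots> \<le> S * (1 / (2 * n))"
    using cfl c n S by (intro mult_left_mono) (auto simp: field_simps n_def)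
  finally have "\<xi> \<bullet> H (P f) \<le> \<xi> \<bullet> H (P g) + S / (2 * n)" by (simp add: inner_diff_right)
  moreover have "lax H c \<xi> f x = (\<Sum>i\<in>UNIV. f (x + axis i h) + f (x - axis i h)) / (2 * n) + \<xi> \<bullet> H (P f)" for f
    by (simp add: lax_def h_def n_def P_def)
  moreover have "(\<Sum>i\<in>UNIV. g (x + axis i h) + g (x - axis i h)) / (2 * n)
      = (\<Sum>i\<in>UNIV. f (x + axis i h) + f (x - axis i h)) / (2 * n) + S / (2 * n)"
    unfolding S_def a_def b_def by (simp add: sum.distrib sum_subtractf flip: add_divide_distrib)
  ultimately show ?thesis by simp
qed

text \<open>A step is monotone and commutes with translations and with added constants; comparing f
  with its translate plus K |x - y| preserves the Lipschitz constant exactly.\<close>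

lemma lax_lipschitz:
  assumes "\<And>x y. f x \<le> f y + K * norm (x - y)"
  shows "lax H c \<xi> f x \<le> lax H c \<xi> f y + K * norm (x - y)"
proof -
  have "f z \<le> f (z + (y - x)) + K * norm (x - y)" for z
    using assms[of z "z + (y - x)"] by simp
  then have "lax H c \<xi> f x \<le> lax H c \<xi> (\<lambda>z. f (z + (y - x)) + K * norm (x - y)) x"
    by (intro lax_mono)
  also have "\<dots> = lax H c \<xi> f y + K * norm (x - y)"
    by (simp add: lax_add_const lax_shift)
  finally show ?thesis .
qed

text \<open>Only a first-order expansion with relative error \<eta> is assumed. Averaging over the
  nodes costs \<eta> h, which is of order \<eta> |\<xi>| because the mesh is proportional to
  |\<xi>|; no second derivatives are involved.\<close>

lemma lax_consistent:
  assumes dev: "\<And>y. y \<in> cball x (c * norm \<xi>) \<Longrightarrow> \<bar>f y - f x - p \<bullet> (y - x)\<bar> \<le> \<eta> * norm (y - x)"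
    and \<eta>: "\<eta> \<ge> 0"
  shows "\<bar>lax H c \<xi> f x - f x - \<xi> \<bullet> H p\<bar> \<le> (c + real CARD('d) * l) * \<eta> * norm \<xi>"
proof (cases "\<xi> = 0")
  case True
  then show ?thesis by (simp add: lax_zero)
next
  case False
  define h where "h = c * norm \<xi>"
  have h: "h > 0" using False c by (simp add: h_def)
  define n where "n = real CARD('d)"
  have n: "n > 0" by (simp add: n_def)
  define a b where "a i = f (x + axis i h) - f x" and "b i = f (x - axis i h) - f x" for i
  have a: "\<bar>a i - h * p $ i\<bar> \<le> \<eta> * h" and b: "\<bar>b i + h * p $ i\<bar> \<le> \<eta> * h" for i
    using dev[of "x + axis i h"] dev[of "x - axis i h"] h
    by (auto simp: a_def b_def h_def[symmetric] dist_norm norm_axis_real inner_axis mult.commute)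
  define P where "P = (\<chi> i. (f (x + axis i h) - f (x - axis i h)) / (2 * h))"
  have "norm (P - p) \<le> (\<Sum>i\<in>UNIV. \<bar>(P - p) $ i\<bar>)" by (rule norm_le_l1_cart)
  also have "\<dots> \<le> (\<Sum>i\<in>(UNIV :: 'd set). \<eta>)"
  proof (rule sum_mono)
    fix i
    have "(P - p) $ i = ((a i - h * p $ i) - (b i + h * p $ i)) / (2 * h)"
      using h by (simp add: P_def a_def b_def field_simps)
    moreover have "\<bar>(a i - h * p $ i) - (b i + h * p $ i)\<bar> \<le> \<eta> * (2 * h)" using a[of i] b[of i] by linarith
    ultimately show "\<bar>(P - p) $ i\<bar> \<le> \<eta>" using h by (simp add: pos_divide_le_eq)
  qed
  also have "\<dots> = n * \<eta>" by (simp add: n_def)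
  finally have P: "norm (P - p) \<le> n * \<eta>" .
  have "\<bar>\<xi> \<bullet> (H P - H p)\<bar> \<le> norm \<xi> * norm (H P - H p)" by (rule Cauchy_Schwarz_ineq2)
  also have "\<dots> \<le> norm \<xi> * (l * (n * \<eta>))"
    by (intro mult_left_mono order_trans[OF lip] P lipschitz_const_nonneg) auto
  finally have 1: "\<bar>\<xi> \<bullet> H P - \<xi> \<bullet> H p\<bar> \<le> n * l * \<eta> * norm \<xi>" by (simp add: inner_diff_right mult_ac)
  have "\<bar>\<Sum>i\<in>UNIV. a i + b i\<bar> \<le> (\<Sum>i\<in>(UNIV :: 'd set). \<eta> * (2 * h))"
  proof (rule order_trans[OF sum_abs sum_mono])
    fix i show "\<bar>a i + b i\<bar> \<le> \<eta> * (2 * h)" using a[of i] b[of i] by linarith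
  qed
  also have "\<dots> = (2 * n) * (\<eta> * h)" by (simp add: n_def)
  finally have 2: "\<bar>(\<Sum>i\<in>UNIV. a i + b i) / (2 * n)\<bar> \<le> \<eta> * h"
    unfolding abs_divide using n by (subst pos_divide_le_eq) (auto simp: mult.commute)
  have "(\<Sum>i\<in>UNIV. a i + b i) / (2 * n) = (\<Sum>i\<in>UNIV. f (x + axis i h) + f (x - axis i h)) / (2 * n) - f x"
    using n by (simp add: a_def b_def sum.distrib sum_subtractf diff_divide_distrib add_divide_distrib n_def)
  then have "lax H c \<xi> f x - f x - \<xi> \<bullet> H p = (\<Sum>i\<in>UNIV. a i + b i) / (2 * n) + (\<xi> \<bullet> H P - \<xi> \<bullet> H p)"
    by (simp add: lax_def h_def n_def P_def)
  then have "\<bar>lax H c \<xi> f x - f x - \<xi> \<bullet> H p\<bar> \<le> \<eta> * h + n * l * \<eta> * norm \<xi>" using 1 2 by linarith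
  then show ?thesis by (simp add: h_def n_def algebra_simps)
qed

text \<open>Consistency with p = 0 and \<eta> = K. Summed over steps it bounds the variation in time
  by the increments of the path.\<close>

lemma lax_bound:
  assumes f: "\<And>x y. f x \<le> f y + K * norm (x - y)" and K: "K \<ge> 0"
  shows "\<bar>lax H c \<xi> f x - f x\<bar> \<le> (2 * c * K + norm (H 0)) * norm \<xi>"
proof -
  have "\<bar>f y - f x - 0 \<bullet> (y - x)\<bar> \<le> K * norm (y - x)" for y
    using f[of x y] f[of y x] by (simp add: norm_minus_commute abs_le_iff)
  then have "\<bar>lax H c \<xi> f x - f x - \<xi> \<bullet> H 0\<bar> \<le> (c + real CARD('d) * l) * K * norm \<xi>"
    using K by (intro lax_consistent)
  also have "\<dots> \<le> (c + c) * K * norm \<xi>" using cfl K by (intro mult_right_mono) auto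
  finally have "\<bar>lax H c \<xi> f x - f x - \<xi> \<bullet> H 0\<bar> \<le> 2 * c * K * norm \<xi>" by simp
  moreover have "\<bar>\<xi> \<bullet> H 0\<bar> \<le> norm \<xi> * norm (H 0)" by (rule Cauchy_Schwarz_ineq2)
  ultimately show ?thesis by (simp add: algebra_simps)
qed

end

text \<open>The pointwise limsup, given by its two characteristic properties. For functions that are
  equicontinuous up to O(1/n), as the scheme is, this is already the half-relaxed upper
  limit.\<close>

lemma upper_limit_exists:
  fixes f :: "nat \<Rightarrow> 'a \<Rightarrow> real"
  assumes "\<And>z. \<exists>C. \<forall>\<^sub>F n in sequentially. \<bar>f n z\<bar> \<le> C"
  obtains U where "\<And>z a. U z < a \<Longrightarrow> \<forall>\<^sub>F n in sequentially. f n z < a"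
    and "\<And>z a. a < U z \<Longrightarrow> \<exists>\<^sub>F n in sequentially. a < f n z"
proof -
  define S where "S z = {a. \<forall>\<^sub>F n in sequentially. f n z \<le> a}" for z
  have S: "S z \<noteq> {}" "bdd_below (S z)" for z
  proof -
    obtain C where C: "\<forall>\<^sub>F n in sequentially. \<bar>f n z\<bar> \<le> C" using assms by blast
    then have "C \<in> S z" unfolding S_def by (auto elim: eventually_mono)
    then show "S z \<noteq> {}" by blast
    have "- C \<le> a" if "a \<in> S z" for a
    proof -
      have "\<forall>\<^sub>F n in sequentially. f n z \<le> a" using that by (simp add: S_def)
      with C have "\<forall>\<^sub>F n in sequentially. - C \<le> a" by eventually_elim linarith
      then show ?thesis by simp
    qed
    then show "bdd_below (S z)" by (rule bdd_belowI)
  qed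
  show ?thesis
  proof (rule that[of "\<lambda>z. Inf (S z)"])
    fix z a
    show "\<forall>\<^sub>F n in sequentially. f n z < a" if less: "Inf (S z) < a"
    proof -
      obtain b where "b \<in> S z" "b < a" using less cInf_lessD[OF S(1)] by blast
      then show ?thesis unfolding S_def by (auto elim: eventually_mono)
    qed
    show "\<exists>\<^sub>F n in sequentially. a < f n z" if less: "a < Inf (S z)"
    proof (rule ccontr)
      assume "\<not> ?thesis"
      then have "a \<in> S z" by (simp add: S_def not_frequently not_less)
      then show False using cInf_lower[OF _ S(2)] less by fastforce
    qed
  qed
qed

text \<open>Continuity of the derivative at z0 controls increments between two points near z0 by the
  derivative at z0. The scheme compares consecutive grid times, neither of which need be that of
  z0.\<close>

lemma strict_derivative:
  fixes f :: "'a::euclidean_space \<Rightarrow> 'b::real_normed_vector"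
  assumes W: "open W" "z0 \<in> W"
    and f: "\<And>z. z \<in> W \<Longrightarrow> (f has_derivative f' z) (at z)"
    and lim: "\<And>e. e > 0 \<Longrightarrow> \<forall>\<^sub>F z in nhds z0. onorm (\<lambda>h. f' z h - f' z0 h) \<le> e"
    and e: "e > 0"
  shows "\<exists>r>0. cball z0 r \<subseteq> W \<and> (\<forall>z\<in>cball z0 r. \<forall>w\<in>cball z0 r.
    norm (f z - f w - f' z0 (z - w)) \<le> e * norm (z - w))"
proof -
  have "\<forall>\<^sub>F z in nhds z0. z \<in> W \<and> onorm (\<lambda>h. f' z h - f' z0 h) \<le> e"
    using eventually_nhds_in_open[OF W] lim[OF e] by (rule eventually_conj)
  then obtain r where r: "r > 0" "\<And>z. dist z z0 < r \<Longrightarrow> z \<in> W \<and> onorm (\<lambda>h. f' z h - f' z0 h) \<le> e"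
    unfolding eventually_nhds_metric by blast
  have sub: "z \<in> W" "onorm (\<lambda>h. f' z h - f' z0 h) \<le> e" if "z \<in> cball z0 (r / 2)" for z
    using that r by (auto simp: dist_commute)
  show ?thesis
  proof (intro exI[of _ "r / 2"] conjI ballI)
    fix z w assume z: "z \<in> cball z0 (r / 2)" and w: "w \<in> cball z0 (r / 2)"
    have "norm (f z - f w - f' z0 (z - w)) \<le> norm (z - w) * e"
    proof (rule differentiable_bound_linearization[where S="cball z0 (r / 2)"])
      fix t :: real assume "t \<in> {0..1}"
      then have "(1 - t) *\<^sub>R w + t *\<^sub>R z \<in> cball z0 (r / 2)"
        by (intro convexD[OF convex_cball w z]) auto
      then show "w + t *\<^sub>R (z - w) \<in> cball z0 (r / 2)" by (simp add: algebra_simps)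
    next
      fix x assume x: "x \<in> cball z0 (r / 2)"
      show "(f has_derivative f' x) (at x within cball z0 (r / 2))"
        using f[OF sub(1)[OF x]] by (rule has_derivative_at_withinI)
      show "onorm (f' x - f' z0) \<le> e" using sub(2)[OF x] by (simp add: fun_diff_def)
    qed (use r in auto)
    then show "norm (f z - f w - f' z0 (z - w)) \<le> e * norm (z - w)" by (simp add: mult.commute)
  qed (use r sub in auto)
qed

text \<open>The scheme need not be continuous in time, so its maximum is sought over finitely many
  compact time slices instead of a compact space-time set.\<close>

lemma finite_compact_attains_sup:
  fixes g :: "'i \<Rightarrow> 'a::topological_space \<Rightarrow> real"
  assumes "finite J" "\<And>j. j \<in> J \<Longrightarrow> compact (K j)" "\<And>j. j \<in> J \<Longrightarrow> continuous_on (K j) (g j)"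
    and "j0 \<in> J" "x0 \<in> K j0"
  obtains j x where "j \<in> J" "x \<in> K j" "\<And>i y. i \<in> J \<Longrightarrow> y \<in> K i \<Longrightarrow> g i y \<le> g j x"
proof -
  have "compact (\<Union>j\<in>J. g j ` K j)"
    using assms by (intro compact_UN compact_continuous_image) auto
  moreover have "(\<Union>j\<in>J. g j ` K j) \<noteq> {}" using assms by auto
  ultimately have "\<exists>s\<in>(\<Union>j\<in>J. g j ` K j). \<forall>t\<in>(\<Union>j\<in>J. g j ` K j). t \<le> s"
    by (rule compact_attains_sup)
  then show ?thesis using that by blast
qed

lemma norm_snd_le': "norm (snd w) \<le> norm w"
  using norm_snd_le[of "snd w" "fst w"] by simp

lemma isCont_eventually_dist_less:
  fixes f :: "'a::metric_space \<Rightarrow> 'b::metric_space"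
  shows "isCont f x \<Longrightarrow> e > 0 \<Longrightarrow> \<forall>\<^sub>F z in nhds x. dist (f z) (f x) < e"
  unfolding continuous_at_eps_delta eventually_nhds_metric by blast

text \<open>The half-relaxed limit argument, in a form that only needs maxima over the grid times.\<close>

lemma scheme_limit_subsolution:
  fixes H :: "real^'d \<Rightarrow> real^'m" and f :: "nat \<Rightarrow> (real^'d) \<times> real \<Rightarrow> real"
  assumes lip: "\<And>p q. norm (H p - H q) \<le> l * norm (p - q)"
    and c: "c > 0" and cfl: "real CARD('d) * l \<le> c"
    and B: "\<And>t. t > 0 \<Longrightarrow> (B has_vector_derivative b t) (at t)" and b: "continuous_on {0..} b"
    and lipx: "\<And>n x y t. \<bar>f n (x, t) - f n (y, t)\<bar> \<le> K0 * norm (x - y)"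
    and lipt: "\<And>T. \<exists>K\<ge>0. \<forall>n\<ge>1. \<forall>x. \<forall>s\<in>{0..T}. \<forall>t\<in>{0..T}. \<bar>f n (x, s) - f n (x, t)\<bar> \<le> K * (\<bar>s - t\<bar> + 1 / n)"
    and step: "\<And>n j x. n \<ge> 1 \<Longrightarrow> f n (x, (real j + 1) / n) =
       lax H c (B ((real j + 1) / n) - B (real j / n)) (\<lambda>y. f n (y, real j / n)) x"
    and U1: "\<And>z a. U z < a \<Longrightarrow> \<forall>\<^sub>F n in sequentially. f n z < a"
    and U2: "\<And>z a. a < U z \<Longrightarrow> \<exists>\<^sub>F n in sequentially. a < f n z"
  shows "viscosity_subsolution (\<lambda>t p. H p \<bullet> b t) U"
  unfolding viscosity_subsolution_def
proof (intro allI impI)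
  fix \<phi> D \<tau> and x0 :: "real^'d" and t0 :: real
  assume test: "C1_test \<phi> D \<tau>" and t0: "0 < t0"
    and mx: "\<forall>\<^sub>F z in nhds (x0, t0). U z - \<phi> z \<le> U (x0, t0) - \<phi> (x0, t0)"
  define z0 where "z0 = (x0, t0)"
  define p a where "p = D z0" and "a = \<tau> z0"
  define b0 where "b0 = b t0"
  have "a \<le> H p \<bullet> b0"
  proof (rule ccontr)
    \<comment> \<open>The factor of \<eta> in the final inequality: 1 from the time increment of
      \<psi>, |H p| from that of the path, the rest from the consistency error.\<close>
    define C where "C = 1 + norm (H p) + (c + real CARD('d) * l) * (norm b0 + 1)"
    have l0: "l \<ge> 0" by (rule lipschitz_const_nonneg[OF lip c cfl])
    have "0 \<le> (c + real CARD('d) * l) * (norm b0 + 1)" using c l0 by (intro mult_nonneg_nonneg add_nonneg_nonneg) auto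
    then have C: "C > 0" unfolding C_def using norm_ge_zero[of "H p"] by linarith
    assume "\<not> a \<le> H p \<bullet> b0"
    then have gap: "a - H p \<bullet> b0 > 0" by simp
    define \<eta> where "\<eta> = min 1 ((a - H p \<bullet> b0) / (2 * C))"
    have \<eta>: "\<eta> > 0" "\<eta> \<le> 1" "\<eta> * C < a - H p \<bullet> b0"
    proof -
      show "\<eta> > 0" "\<eta> \<le> 1" using gap C by (auto simp: \<eta>_def)
      have "\<eta> * C \<le> (a - H p \<bullet> b0) / (2 * C) * C" using C by (intro mult_right_mono) (auto simp: \<eta>_def)
      also have "\<dots> < a - H p \<bullet> b0" using gap C by simp
      finally show "\<eta> * C < a - H p \<bullet> b0" .
    qed
    let ?W = "UNIV \<times> {0<..} :: ((real^'d) \<times> real) set"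
    have W: "open ?W" "z0 \<in> ?W" using t0 by (auto simp: z0_def intro: open_Times)
    have d\<phi>: "(\<phi> has_derivative (\<lambda>h. (D z, \<tau> z) \<bullet> h)) (at z)" if "z \<in> ?W" for z
      using test that unfolding C1_test_def has_derivative_pair_inner by blast
    have cG: "continuous_on ?W (\<lambda>z. (D z, \<tau> z))"
      using test by (auto simp: C1_test_def intro!: continuous_intros)
    have "\<exists>r>0. cball z0 r \<subseteq> ?W \<and> (\<forall>z\<in>cball z0 r. \<forall>w\<in>cball z0 r.
        norm (\<phi> z - \<phi> w - (D z0, \<tau> z0) \<bullet> (z - w)) \<le> (\<eta> / 2) * norm (z - w))"
    proof (rule strict_derivative[OF W d\<phi>])
      fix e :: real assume e: "e > 0"
      have "isCont (\<lambda>z. (D z, \<tau> z)) z0"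
        using continuous_on_eq_continuous_at[OF W(1)] cG W(2) by blast
      then have "\<forall>\<^sub>F z in nhds z0. dist (D z, \<tau> z) (D z0, \<tau> z0) < e"
        using e by (rule isCont_eventually_dist_less)
      then show "\<forall>\<^sub>F z in nhds z0. onorm (\<lambda>h. (D z, \<tau> z) \<bullet> h - (D z0, \<tau> z0) \<bullet> h) \<le> e"
      proof eventually_elim
        case (elim z)
        have "norm ((D z, \<tau> z) \<bullet> h - (D z0, \<tau> z0) \<bullet> h) \<le> e * norm h" for h
        proof -
          have "norm (((D z, \<tau> z) - (D z0, \<tau> z0)) \<bullet> h) \<le> norm ((D z, \<tau> z) - (D z0, \<tau> z0)) * norm h"
            unfolding real_norm_def by (rule Cauchy_Schwarz_ineq2)
          also have "\<dots> \<le> e * norm h" using elim by (intro mult_right_mono) (auto simp: dist_norm)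
          finally show ?thesis by (simp only: inner_diff_left)
        qed
        then show ?case by (rule onorm_le)
      qed
    qed (use \<eta> in auto)
    then obtain r1 where r1: "r1 > 0" "cball z0 r1 \<subseteq> ?W"
      "\<And>z w. z \<in> cball z0 r1 \<Longrightarrow> w \<in> cball z0 r1 \<Longrightarrow> \<bar>\<phi> z - \<phi> w - (p, a) \<bullet> (z - w)\<bar> \<le> (\<eta> / 2) * norm (z - w)"
      unfolding p_def a_def real_norm_def by blast
    have "\<exists>r>0. cball t0 r \<subseteq> {0<..} \<and> (\<forall>s\<in>cball t0 r. \<forall>t\<in>cball t0 r.
        norm (B s - B t - (s - t) *\<^sub>R b t0) \<le> \<eta> * norm (s - t))"
    proof (rule strict_derivative[where f'="\<lambda>t h. h *\<^sub>R b t"])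
      fix e :: real assume e: "e > 0"
      have "isCont b t0"
        using continuous_on_interior[OF b, of t0] t0 by simp
      then have "\<forall>\<^sub>F t in nhds t0. dist (b t) (b t0) < e"
        using e by (rule isCont_eventually_dist_less)
      then show "\<forall>\<^sub>F t in nhds t0. onorm (\<lambda>h. h *\<^sub>R b t - h *\<^sub>R b t0) \<le> e"
      proof eventually_elim
        case (elim t)
        have "norm (h *\<^sub>R b t - h *\<^sub>R b t0) \<le> e * norm h" for h
          using elim mult_right_mono[of "norm (b t - b t0)" e "\<bar>h\<bar>"]
          by (simp add: dist_norm mult.commute flip: scaleR_diff_right)
        then show ?case by (rule onorm_le)
      qed
    qed (use t0 \<eta> B in \<open>auto simp: has_vector_derivative_def\<close>)
    then obtain r2 where r2: "r2 > 0"
      "\<And>s t. s \<in> cball t0 r2 \<Longrightarrow> t \<in> cball t0 r2 \<Longrightarrow> norm (B s - B t - (s - t) *\<^sub>R b0) \<le> \<eta> * \<bar>s - t\<bar>"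
      unfolding b0_def real_norm_def by blast
    obtain r3 where r3: "r3 > 0" "\<And>z. dist z z0 < r3 \<Longrightarrow> U z - \<phi> z \<le> U z0 - \<phi> z0"
      using mx unfolding eventually_nhds_metric z0_def by blast
    define r where "r = Min {r1, r2, r3 / 2, \<eta> / 4}"
    have r: "r > 0" "r \<le> r1" "r \<le> r2" "r < r3" "r \<le> \<eta> / 4" using r1(1) r2(1) r3(1) \<eta> by (auto simp: r_def)
    \<comment> \<open>The added square makes the maximum strict. Its increments within the ball are
      at most 2 r |z - w|, absorbed by \<eta> / 2 since r \<le> \<eta> / 4.\<close>
    define \<psi> where "\<psi> z = \<phi> z + (norm (z - z0))\<^sup>2" for z
    define M where "M = U z0 - \<phi> z0"
    let ?Q = "cball z0 r"
    have \<psi>: "\<bar>\<psi> z - \<psi> w - (p, a) \<bullet> (z - w)\<bar> \<le> \<eta> * norm (z - w)" if z: "z \<in> ?Q" and w: "w \<in> ?Q" for z w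
    proof -
      have nz: "norm (z - z0) \<le> r" "norm (w - z0) \<le> r" using z w by (auto simp: dist_norm norm_minus_commute)
      have "\<bar>norm (z - z0) - norm (w - z0)\<bar> \<le> norm (z - w)"
        using norm_triangle_ineq3[of "z - z0" "w - z0"] by simp
      moreover have "(norm (z - z0))\<^sup>2 - (norm (w - z0))\<^sup>2 = (norm (z - z0) + norm (w - z0)) * (norm (z - z0) - norm (w - z0))"
        by (simp add: power2_eq_square algebra_simps)
      ultimately have "\<bar>(norm (z - z0))\<^sup>2 - (norm (w - z0))\<^sup>2\<bar> \<le> (2 * r) * norm (z - w)"
        using nz r(1) by (simp only: abs_mult) (intro mult_mono, auto)
      also have "\<dots> \<le> (\<eta> / 2) * norm (z - w)" using r(5) by (intro mult_right_mono) auto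
      finally have 1: "\<bar>(norm (z - z0))\<^sup>2 - (norm (w - z0))\<^sup>2\<bar> \<le> (\<eta> / 2) * norm (z - w)" .
      have "\<bar>\<phi> z - \<phi> w - (p, a) \<bullet> (z - w)\<bar> \<le> (\<eta> / 2) * norm (z - w)"
        using z w r(2) by (intro r1(3)) auto
      then show ?thesis using 1 unfolding \<psi>_def by (simp only: abs_le_iff) (simp add: algebra_simps)
    qed
    define L where "L = norm (p, a) + \<eta>"
    have L: "L \<ge> 0" using \<eta> by (simp add: L_def)
    have \<psi>L: "\<bar>\<psi> z - \<psi> w\<bar> \<le> L * norm (z - w)" if "z \<in> ?Q" "w \<in> ?Q" for z w
    proof -
      have "\<bar>(p, a) \<bullet> (z - w)\<bar> \<le> norm (p, a) * norm (z - w)" by (rule Cauchy_Schwarz_ineq2)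
      then show ?thesis using \<psi>[OF that] by (simp add: L_def algebra_simps)
    qed
    have strict: "U z - \<psi> z \<le> M - (norm (z - z0))\<^sup>2" if "z \<in> ?Q" for z
      using r3(2)[of z] that r(4) by (auto simp: \<psi>_def M_def dist_commute)
    obtain K where K: "K \<ge> 0" "\<And>n x s t. n \<ge> 1 \<Longrightarrow> s \<in> {0..t0+r} \<Longrightarrow> t \<in> {0..t0+r} \<Longrightarrow>
        \<bar>f n (x, s) - f n (x, t)\<bar> \<le> K * (\<bar>s - t\<bar> + 1 / n)"
      using lipt[of "t0 + r"] by blast
    have times: "snd z > 0" "snd z \<in> {0..t0+r}" if "z \<in> ?Q" for z
    proof -
      have "z \<in> ?W" using that r r1(2) by auto
      then show "snd z > 0" by auto
      have "\<bar>snd z - t0\<bar> \<le> norm (z - z0)"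
        using norm_snd_le'[of "z - z0"] by (simp add: z0_def)
      then show "snd z \<in> {0..t0+r}" using that \<open>snd z > 0\<close> by (auto simp: dist_norm norm_minus_commute)
    qed
    have K0: "K0 \<ge> 0" using lipx[of 0 "axis undefined 1" 0 0] by (simp add: norm_axis_real)
    have fequi: "\<bar>f n z - f n w\<bar> \<le> (K0 + K) * norm (z - w) + K / n"
      if "z \<in> ?Q" "w \<in> ?Q" "n \<ge> 1" for n z w
    proof -
      obtain x t y s where [simp]: "z = (x, t)" "w = (y, s)" by (metis surj_pair)
      have "\<bar>f n (x, t) - f n (x, s)\<bar> \<le> K * (\<bar>t - s\<bar> + 1 / n)"
        using times(2)[OF that(1)] times(2)[OF that(2)] that(3) by (intro K(2)) auto
      moreover have "\<bar>f n (x, s) - f n (y, s)\<bar> \<le> K0 * norm (x - y)" by (rule lipx)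
      moreover have "K0 * norm (x - y) \<le> K0 * norm (z - w)" using K0 norm_fst_le[of "x - y" "t - s"] by (simp add: mult_left_mono)
      moreover have "K * \<bar>t - s\<bar> \<le> K * norm (z - w)" using K(1) norm_snd_le[of "t - s" "x - y"] by (simp add: mult_left_mono)
      ultimately show ?thesis by (simp add: algebra_simps)
    qed
    define q where "q = r\<^sup>2"
    have q: "q > 0" using r by (simp add: q_def)
    \<comment> \<open>On this shell U - \<psi> is at most M - q / 4. The limsup bounds are
      pointwise, so they are used on a finite \<delta>-net and spread by equicontinuity. The errors
      q/16 + q/32 + q/32 leave M - q / 8.\<close>
    define Kout where "Kout = {z \<in> ?Q. r / 2 \<le> norm (z - z0)}"
    have "compact Kout"
    proof -
      have "Kout = ?Q \<inter> {z. r / 2 \<le> norm (z - z0)}" by (auto simp: Kout_def)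
      moreover have "closed {z. r / 2 \<le> norm (z - z0)}" by (intro closed_Collect_le continuous_intros)
      ultimately show ?thesis by (simp add: compact_Int_closed)
    qed
    define G where "G = K0 + K + L + 1"
    define \<delta> where "\<delta> = q / (32 * G)"
    have \<delta>: "\<delta> > 0" "(K0 + K + L) * \<delta> \<le> q / 32"
    proof -
      have pos: "G > 0" using K0 K(1) L unfolding G_def by linarith
      show "\<delta> > 0" using pos q by (simp add: \<delta>_def)
      have "(K0 + K + L) * \<delta> \<le> G * \<delta>" using \<open>\<delta> > 0\<close> by (intro mult_right_mono) (auto simp: G_def)
      also have "\<dots> = q / 32" using pos by (simp add: \<delta>_def)
      finally show "(K0 + K + L) * \<delta> \<le> q / 32" .
    qed
    obtain Z where Z: "Z \<subseteq> Kout" "finite Z" "Kout \<subseteq> (\<Union>z\<in>Z. ball z \<delta>)"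
      by (rule compactE_image[OF \<open>compact Kout\<close>, of Kout "\<lambda>z. ball z \<delta>"]) (use \<delta> in auto)
    have "\<forall>\<^sub>F n in sequentially. f n z < U z + q / 16" if "z \<in> Z" for z
      using q by (intro U1) auto
    then have ev1: "\<forall>\<^sub>F n in sequentially. \<forall>z\<in>Z. f n z < U z + q / 16"
      using Z(2) by (simp add: eventually_ball_finite)
    have lim0: "(\<lambda>n. A / real n) \<longlonglongrightarrow> 0" for A :: real by (rule lim_const_over_n)
    have ev2: "\<forall>\<^sub>F n in sequentially. A / real n < e" if "e > 0" for A e :: real
      using order_tendstoD(2)[OF lim0 that] .
    \<comment> \<open>A limsup is approached only along infinitely many n; one of these is taken for
      which all the eventual properties hold too.\<close>
    have "U z0 - q / 32 < U z0" using q by simp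
    then have "\<exists>\<^sub>F n in sequentially. U z0 - q / 32 < f n z0" by (rule U2)
    moreover have "\<forall>\<^sub>F n in sequentially. n \<ge> 1 \<and> (\<forall>z\<in>Z. f n z < U z + q / 16) \<and> 1 / real n < r / 8
        \<and> (c * (norm b0 + 1)) / real n < r / 8 \<and> (K0 + K + L + K) / real n < q / 32"
      using eventually_ge_at_top[of "1::nat"] ev1 ev2[of "r / 8" 1] ev2[of "r / 8" "c * (norm b0 + 1)"] ev2[of "q / 32" "K0 + K + L + K"] r q
      by (auto simp: eventually_conj_iff)
    ultimately have freq: "\<exists>\<^sub>F n in sequentially. U z0 - q / 32 < f n z0 \<and> (n \<ge> 1 \<and> (\<forall>z\<in>Z. f n z < U z + q / 16) \<and> 1 / real n < r / 8
        \<and> (c * (norm b0 + 1)) / real n < r / 8 \<and> (K0 + K + L + K) / real n < q / 32)"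
      by (rule frequently_eventually_frequently)
    from frequently_ex[OF freq] obtain n where n: "U z0 - q / 32 < f n z0" "n \<ge> 1" "\<And>z. z \<in> Z \<Longrightarrow> f n z < U z + q / 16"
       "1 / real n < r / 8" "(c * (norm b0 + 1)) / real n < r / 8" "(K0 + K + L + K) / real n < q / 32"
      by blast
    have n0: "real n > 0" using n(2) by simp
    have Kn: "K / n \<le> q / 32" "(K0 + K + L) / n + K / n < q / 32"
    proof -
      show "(K0 + K + L) / n + K / n < q / 32" using n(6) by (simp add: add_divide_distrib)
      moreover have "(K0 + K + L) / n \<ge> 0" using K0 K L by simp
      ultimately show "K / n \<le> q / 32" by linarith
    qed
    have out: "f n w - \<psi> w < M - q / 8" if w: "w \<in> Kout" for w
    proof -
      obtain z where z: "z \<in> Z" "norm (w - z) < \<delta>" using Z(3) w by (auto simp: dist_norm norm_minus_commute)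
      then have zK: "z \<in> Kout" using Z(1) by auto
      then have zQ: "z \<in> ?Q" and wQ: "w \<in> ?Q" using w by (auto simp: Kout_def)
      have "(r / 2)\<^sup>2 \<le> (norm (z - z0))\<^sup>2" using zK r by (intro power_mono) (auto simp: Kout_def)
      then have 1: "U z - \<psi> z \<le> M - q / 4" using strict[OF zQ] by (simp add: q_def power2_eq_square)
      have "(K0 + K + L) * norm (w - z) \<le> (K0 + K + L) * \<delta>"
        using z(2) K0 K(1) L by (intro mult_left_mono) auto
      then have 2: "(K0 + K) * norm (w - z) + L * norm (w - z) \<le> q / 32" using \<delta>(2) by (simp add: algebra_simps)
      show ?thesis
        using fequi[OF wQ zQ n(2)] \<psi>L[OF wQ zQ] n(3)[OF z(1)] 1 2 Kn(1) by linarith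
    qed
    define near where "near j = {x. (x, real j / n) \<in> ?Q}" for j :: nat
    define J where "J = {j. real j / n \<le> t0 + r}"
    have fJ: "finite J"
    proof (rule finite_subset)
      show "J \<subseteq> {..nat \<lceil>(t0 + r) * n\<rceil>}"
      proof
        fix j assume "j \<in> J"
        then have "real j \<le> (t0 + r) * n" using n0 by (simp add: J_def pos_divide_le_eq)
        then have "int j \<le> \<lceil>(t0 + r) * n\<rceil>" by (simp add: le_ceiling_iff)
        then show "j \<in> {..nat \<lceil>(t0 + r) * n\<rceil>}" by simp
      qed
    qed auto
    have cN: "compact (near j)" for j
    proof -
      have "near j = fst ` (?Q \<inter> snd -` {real j / n})" by (force simp: near_def)
      moreover have "compact (?Q \<inter> snd -` {real j / n})"
        by (intro compact_Int_closed closed_vimage continuous_on_snd continuous_on_id) auto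
      ultimately show ?thesis by (simp add: compact_continuous_image continuous_on_fst)
    qed
    have coN: "continuous_on (near j) (\<lambda>x. f n (x, real j / n) - \<psi> (x, real j / n))" for j
    proof -
      have "(K0 + L)-lipschitz_on (near j) (\<lambda>x. f n (x, real j / n) - \<psi> (x, real j / n))"
      proof (rule lipschitz_onI)
        fix x y assume "x \<in> near j" "y \<in> near j"
        then have "\<bar>\<psi> (x, real j / n) - \<psi> (y, real j / n)\<bar> \<le> L * norm (x - y)"
          using \<psi>L[of "(x, real j / n)" "(y, real j / n)"] by (simp add: near_def)
        then show "dist (f n (x, real j / n) - \<psi> (x, real j / n)) (f n (y, real j / n) - \<psi> (y, real j / n)) \<le> (K0 + L) * dist x y"
          using lipx[of n x "real j / n" y] unfolding dist_norm real_norm_def by (simp add: distrib_right)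
      qed (use K0 L in simp)
      then show ?thesis by (rule lipschitz_on_continuous_on)
    qed
    define j0 where "j0 = nat \<lfloor>n * t0\<rfloor>"
    have j0: "\<bar>real j0 / n - t0\<bar> \<le> 1 / n"
    proof -
      have "real j0 = of_int \<lfloor>n * t0\<rfloor>" using t0 by (simp add: j0_def)
      then have "\<bar>real j0 - n * t0\<bar> \<le> 1" by linarith
      moreover have "real j0 / n - t0 = (real j0 - n * t0) / n" using n0 by (simp add: diff_divide_distrib)
      ultimately show ?thesis using n0 by (simp add: abs_divide divide_right_mono)
    qed
    have w0: "(x0, real j0 / n) \<in> ?Q" "norm ((x0, real j0 / n) - z0) \<le> 1 / n"
    proof -
      have "norm ((x0, real j0 / n) - z0) = \<bar>real j0 / n - t0\<bar>" by (simp add: z0_def norm_Pair)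
      then show *: "norm ((x0, real j0 / n) - z0) \<le> 1 / n" using j0 by simp
      then show "(x0, real j0 / n) \<in> ?Q" using n(4) r(1) by (simp add: dist_norm norm_minus_commute)
    qed
    have "j0 \<in> J" using j0 n(4) r(1) by (simp add: J_def abs_le_iff)
    have "x0 \<in> near j0" using w0 by (simp add: near_def)
    obtain j x where j: "j \<in> J" "x \<in> near j"
      and jmax: "\<And>i y. i \<in> J \<Longrightarrow> y \<in> near i \<Longrightarrow>
        f n (y, real i / n) - \<psi> (y, real i / n) \<le> f n (x, real j / n) - \<psi> (x, real j / n)"
      by (rule finite_compact_attains_sup[where g="\<lambda>j x. f n (x, real j / n) - \<psi> (x, real j / n)" and K=near, OF fJ cN coN \<open>j0 \<in> J\<close> \<open>x0 \<in> near j0\<close>]) blast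
    define t where "t = real j / n"
    define m where "m = f n (x, t) - \<psi> (x, t)"
    have xt: "(x, t) \<in> ?Q" using j by (simp add: near_def t_def)
    have "m \<ge> f n (x0, real j0 / n) - \<psi> (x0, real j0 / n)"
      unfolding m_def t_def using \<open>j0 \<in> J\<close> \<open>x0 \<in> near j0\<close> by (rule jmax)
    moreover have "(K0 + K) * norm ((x0, real j0 / n) - z0) + L * norm ((x0, real j0 / n) - z0) \<le> (K0 + K + L) / n"
    proof -
      have "(K0 + K + L) * norm ((x0, real j0 / n) - z0) \<le> (K0 + K + L) * (1 / n)"
        using w0(2) K0 K(1) L by (intro mult_left_mono) auto
      then show ?thesis by (simp add: distrib_right)
    qed
    moreover have z0Q: "z0 \<in> ?Q" using r by simp
    moreover have "\<psi> z0 = \<phi> z0" by (simp add: \<psi>_def)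
    ultimately have "m > M - q / 16"
      using fequi[OF w0(1) z0Q n(2)] \<psi>L[OF w0(1) z0Q] n(1) Kn(2) unfolding M_def by linarith
    \<comment> \<open>The grid maximum exceeds M - q / 16 while the shell stays below M - q / 8. The
      maximiser is thus within r / 2 of z0, leaving room for one time step and one stencil width of
      at most r / 8 each.\<close>
    then have "(x, t) \<notin> Kout" using out[of "(x, t)"] q by (auto simp: m_def)
    then have inner: "norm ((x, t) - z0) < r / 2" using xt by (auto simp: Kout_def)
    have "t > 0" using times(1)[OF xt] by simp
    then have "j \<noteq> 0" by (cases j) (auto simp: t_def)
    then obtain i where i: "j = Suc i" using not0_implies_Suc by blast
    define s where "s = real i / n"
    have ts: "t - s = 1 / n" by (simp add: t_def s_def i diff_divide_distrib[symmetric])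
    define \<xi> where "\<xi> = B t - B s"
    have near_s: "(y, s) \<in> ?Q" if "norm (y - x) \<le> r / 8" for y
    proof -
      have "norm ((y, s) - (x, t)) \<le> norm (y - x) + norm (s - t)"
        using norm_Pair_le[of "y - x" "s - t"] by simp
      moreover have "norm ((y, s) - z0) \<le> norm ((y, s) - (x, t)) + norm ((x, t) - z0)"
        using dist_triangle[of "(y, s)" z0 "(x, t)"] unfolding dist_norm .
      moreover have "s - t = - (1 / n)" using ts by simp
      then have "norm (s - t) = 1 / n" by simp
      ultimately have "norm ((y, s) - z0) \<le> r" using inner that n(4) r(1) by linarith
      then show ?thesis by (simp add: dist_norm norm_minus_commute)
    qed
    have xs: "(x, s) \<in> ?Q" using near_s[of x] r by simp
    have cb: "t \<in> cball t0 r2" "s \<in> cball t0 r2"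
    proof -
      have "\<bar>snd z - t0\<bar> \<le> r2" if "z \<in> ?Q" for z
      proof -
        have "\<bar>snd z - t0\<bar> \<le> norm (z - z0)"
          using norm_snd_le'[of "z - z0"] by (simp add: z0_def)
        then show ?thesis using that r(3) by (simp add: dist_norm norm_minus_commute)
      qed
      from this[OF xt] this[OF xs] show "t \<in> cball t0 r2" "s \<in> cball t0 r2"
        by (auto simp: dist_real_def abs_minus_commute)
    qed
    have \<xi>: "norm (\<xi> - (1 / n) *\<^sub>R b0) \<le> \<eta> / n"
      using r2(2)[OF cb] ts by (simp add: \<xi>_def)
    have \<xi>n: "norm \<xi> \<le> (norm b0 + 1) / n"
    proof -
      have "norm \<xi> \<le> norm ((1 / n) *\<^sub>R b0) + norm (\<xi> - (1 / n) *\<^sub>R b0)" by (rule norm_triangle_sub)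
      also have "\<dots> \<le> norm b0 / n + 1 / n"
        using \<xi> \<eta>(2) n0 by (intro add_mono order_trans[OF \<xi>] divide_right_mono) auto
      finally show ?thesis by (simp add: add_divide_distrib)
    qed
    have h: "c * norm \<xi> \<le> r / 8"
    proof -
      have "c * norm \<xi> \<le> c * ((norm b0 + 1) / n)" using c by (intro mult_left_mono \<xi>n) auto
      then show ?thesis using n(5) unfolding times_divide_eq_right by linarith
    qed
    have "i \<in> J" using j(1) n0 by (simp add: J_def i add_divide_distrib) (smt (verit) divide_nonneg_nonneg of_nat_0_le_iff)
    \<comment> \<open>Maximality is used on the preceding time slice, over the whole stencil.
      Monotonicity then lets \<psi> + m replace f n in the step from s to t.\<close>
    have below: "f n (y, s) \<le> \<psi> (y, s) + m" if "y \<in> cball x (c * norm \<xi>)" for y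
    proof -
      have "norm (y - x) \<le> r / 8" using that h by (simp add: dist_norm norm_minus_commute)
      then have "y \<in> near i" using near_s by (simp add: near_def s_def)
      then show ?thesis using jmax[OF \<open>i \<in> J\<close>, of y] unfolding m_def s_def t_def by linarith
    qed
    have "f n (x, t) = lax H c \<xi> (\<lambda>y. f n (y, s)) x"
      using step[OF n(2), of x i] by (simp add: \<xi>_def t_def s_def i add.commute)
    also have "\<dots> \<le> lax H c \<xi> (\<lambda>y. \<psi> (y, s) + m) x"
      by (rule lax_mono[OF lip c cfl below])
    also have "\<dots> = lax H c \<xi> (\<lambda>y. \<psi> (y, s)) x + m" by (rule lax_add_const)
    finally have up: "\<psi> (x, t) \<le> lax H c \<xi> (\<lambda>y. \<psi> (y, s)) x" by (simp add: m_def)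
    have "\<bar>lax H c \<xi> (\<lambda>y. \<psi> (y, s)) x - \<psi> (x, s) - \<xi> \<bullet> H p\<bar> \<le> (c + real CARD('d) * l) * \<eta> * norm \<xi>"
    proof (rule lax_consistent[OF lip c cfl])
      fix y assume "y \<in> cball x (c * norm \<xi>)"
      then have "norm (y - x) \<le> r / 8" using h by (simp add: dist_norm norm_minus_commute)
      then show "\<bar>\<psi> (y, s) - \<psi> (x, s) - p \<bullet> (y - x)\<bar> \<le> \<eta> * norm (y - x)"
        using \<psi>[OF near_s xs, of y] by simp
    qed (use \<eta> in simp)
    then have 1: "\<psi> (x, t) - \<psi> (x, s) \<le> \<xi> \<bullet> H p + (c + real CARD('d) * l) * \<eta> * norm \<xi>"
      using up by linarith
    have "(c + real CARD('d) * l) * \<eta> * norm \<xi> \<le> (c + real CARD('d) * l) * \<eta> * ((norm b0 + 1) / n)"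
      using c l0 \<eta> by (intro mult_left_mono \<xi>n) auto
    moreover have "\<xi> \<bullet> H p \<le> (b0 \<bullet> H p) / n + (\<eta> / n) * norm (H p)"
    proof -
      have "(\<xi> - (1 / n) *\<^sub>R b0) \<bullet> H p \<le> norm (\<xi> - (1 / n) *\<^sub>R b0) * norm (H p)" by (rule norm_cauchy_schwarz)
      also have "\<dots> \<le> (\<eta> / n) * norm (H p)" by (intro mult_right_mono \<xi>) auto
      finally show ?thesis by (simp add: inner_diff_left)
    qed
    moreover have "a / n - \<eta> / n \<le> \<psi> (x, t) - \<psi> (x, s)"
      using \<psi>[OF xt xs] ts by (simp add: norm_Pair abs_le_iff)
    ultimately have "a / n - \<eta> / n \<le> (b0 \<bullet> H p) / n + (\<eta> / n) * norm (H p) + (c + real CARD('d) * l) * \<eta> * ((norm b0 + 1) / n)"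
      using 1 by linarith
    then have "(a / n - \<eta> / n) * n \<le> ((b0 \<bullet> H p) / n + (\<eta> / n) * norm (H p) + (c + real CARD('d) * l) * \<eta> * ((norm b0 + 1) / n)) * n"
      using n0 by (intro mult_right_mono) auto
    also have "(a / n - \<eta> / n) * n = a - \<eta>" using n0 by (simp add: left_diff_distrib)
    also have "((b0 \<bullet> H p) / n + (\<eta> / n) * norm (H p) + (c + real CARD('d) * l) * \<eta> * ((norm b0 + 1) / n)) * n
        = b0 \<bullet> H p + \<eta> * norm (H p) + (c + real CARD('d) * l) * \<eta> * (norm b0 + 1)"
    proof -
      have "(u / n + (v / n) * w + k * (z / n)) * n = u + v * w + k * z" for u v w k z :: real
        using n0 by (simp add: field_simps)
      then show ?thesis by blast
    qed
    finally have "a - H p \<bullet> b0 \<le> \<eta> * C" by (simp add: C_def algebra_simps inner_commute)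
    then show False using \<eta>(3) by simp
  qed
  then show "\<tau> (x0, t0) \<le> H (D (x0, t0)) \<bullet> b t0" by (simp add: p_def a_def b0_def z0_def)
qed

subsection \<open>Existence for smooth paths\<close>

lemma continuous_on_BUC_time:
  assumes "u \<in> BUC_time"
  shows "continuous_on (UNIV \<times> {0<..}) u"
proof -
  have 1: "continuous_on (\<Union>T. UNIV \<times> {0<..<T}) u"
  proof (rule continuous_on_open_UN)
    fix T
    show "continuous_on (UNIV \<times> {0<..<T}) u"
      by (rule continuous_on_subset[OF BUC_time_continuous[OF assms, of T]]) auto
  qed (auto intro: open_Times)
  have 2: "(\<Union>T. UNIV \<times> {0<..<T}) = UNIV \<times> {0::real<..}"
    using gt_ex by auto
  show ?thesis using 1 unfolding 2 .
qed

text \<open>A test function touching a K-Lipschitz function from above has spatial gradient at most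
  K there, so the Hamiltonian is probed only in that ball. This removes the truncation of H once the
  solution is found.\<close>

lemma subsolution_lipschitz_cong:
  fixes u :: "(real^'d) \<times> real \<Rightarrow> real"
  assumes sub: "viscosity_subsolution F u"
    and lip: "\<And>x y t. \<bar>u (x, t) - u (y, t)\<bar> \<le> K * norm (x - y)"
    and eq: "\<And>t p. t > 0 \<Longrightarrow> norm p \<le> K \<Longrightarrow> F t p = G t p"
  shows "viscosity_subsolution G u"
  unfolding viscosity_subsolution_def
proof (intro allI impI)
  fix \<phi> D \<tau> and x :: "real^'d" and t :: real
  assume test: "C1_test \<phi> D \<tau>" and t: "0 < t"
    and mx: "\<forall>\<^sub>F z in nhds (x, t). u z - \<phi> z \<le> u (x, t) - \<phi> (x, t)"
  define p where "p = D (x, t)"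
  have "norm p \<le> K"
  proof (rule ccontr)
    assume "\<not> norm p \<le> K"
    then have pK: "norm p > K" by simp
    have "K \<ge> 0" using lip[of "axis undefined 1" 0 0] by (simp add: norm_axis_real)
    then have p0: "norm p > 0" using pK by linarith
    \<comment> \<open>In direction - p the test function falls at rate |p|^2 > K |p|, faster than u
      can, which contradicts contact from above.\<close>
    have "(\<phi> has_derivative (\<lambda>h. (p, \<tau> (x, t)) \<bullet> h)) (at (x - 0 *\<^sub>R p, t))"
      using test t unfolding C1_test_def has_derivative_pair_inner p_def by simp
    moreover have "((\<lambda>h. (x - h *\<^sub>R p, t)) has_derivative (\<lambda>h. (- (h *\<^sub>R p), 0))) (at 0)"
      by (auto intro!: derivative_eq_intros)
    ultimately have "((\<lambda>h. \<phi> (x - h *\<^sub>R p, t)) has_derivative (\<lambda>h. (p, \<tau> (x, t)) \<bullet> (- (h *\<^sub>R p), 0))) (at 0)"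
      by (rule has_derivative_compose[rotated])
    then have "((\<lambda>h. \<phi> (x - h *\<^sub>R p, t)) has_real_derivative - (p \<bullet> p)) (at 0)"
      unfolding has_field_derivative_def by (rule has_derivative_eq_rhs) (auto simp: fun_eq_iff)
    then have "((\<lambda>h. \<phi> (x - h *\<^sub>R p, t) + K * norm p * h) has_real_derivative - (p \<bullet> p) + K * norm p) (at 0)"
      by (auto intro!: derivative_eq_intros)
    moreover have "- (p \<bullet> p) + K * norm p < 0"
      using mult_strict_right_mono[OF pK p0] by (simp add: power2_norm_eq_inner[symmetric] power2_eq_square)
    ultimately obtain d where d: "d > 0" "\<And>h. 0 < h \<Longrightarrow> h < d \<Longrightarrow>
        \<phi> (x - h *\<^sub>R p, t) + K * norm p * h < \<phi> (x, t)"
      using DERIV_neg_dec_right[of "\<lambda>h. \<phi> (x - h *\<^sub>R p, t) + K * norm p * h" _ 0] by force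
    obtain e where e: "e > 0" "\<And>z. dist z (x, t) < e \<Longrightarrow> u z - \<phi> z \<le> u (x, t) - \<phi> (x, t)"
      using mx unfolding eventually_nhds_metric by blast
    define h where "h = min (d / 2) (e / (2 * norm p))"
    have h: "h > 0" "h < d" "h * norm p < e"
    proof -
      show "h > 0" "h < d" using d(1) e(1) p0 by (auto simp: h_def)
      have "h * norm p \<le> e / (2 * norm p) * norm p" using p0 by (intro mult_right_mono) (auto simp: h_def)
      then show "h * norm p < e" using e(1) p0 by simp
    qed
    have "u (x - h *\<^sub>R p, t) - \<phi> (x - h *\<^sub>R p, t) \<le> u (x, t) - \<phi> (x, t)"
      using h by (intro e(2)) (simp add: dist_Pair_Pair dist_norm)
    moreover have "\<bar>u (x - h *\<^sub>R p, t) - u (x, t)\<bar> \<le> K * (h * norm p)"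
      using lip[of "x - h *\<^sub>R p" t x] h by simp
    moreover have "K * (h * norm p) = K * norm p * h" by simp
    ultimately show False using d(2)[OF h(1,2)] by linarith
  qed
  moreover have "\<tau> (x, t) \<le> F t p"
    using sub[unfolded viscosity_subsolution_def, rule_format, OF test t mx] by (simp add: p_def)
  ultimately show "\<tau> (x, t) \<le> G t (D (x, t))" using eq[OF t] by (simp add: p_def)
qed

lemma C11_loc_lipschitz:
  fixes H :: "real^'d \<Rightarrow> real^'m"
  assumes "C11_loc H"
  obtains l where "\<And>p q. p \<in> cball 0 R \<Longrightarrow> q \<in> cball 0 R \<Longrightarrow> norm (H p - H q) \<le> l * norm (p - q)"
proof -
  obtain H' :: "real^'d \<Rightarrow> (real^'d) \<Rightarrow>\<^sub>L (real^'m)" where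
    "(\<forall>p. (H has_derivative blinfun_apply (H' p)) (at p)) \<and> (\<forall>K. compact K \<longrightarrow> (\<exists>L. L-lipschitz_on K H'))"
    using assms unfolding C11_loc_def ..
  then have H': "\<And>p. (H has_derivative blinfun_apply (H' p)) (at p)"
    and "\<exists>L. L-lipschitz_on (cball 0 R) H'"
    by simp_all
  then have "continuous_on (cball 0 R) H'" using lipschitz_on_continuous_on by blast
  then have "bounded (H' ` cball 0 R)" by (intro compact_imp_bounded compact_continuous_image) auto
  then obtain l where l: "\<And>p. p \<in> cball 0 R \<Longrightarrow> norm (H' p) \<le> l" by (rule bounded_image_norm_le) blast
  show ?thesis
  proof (rule that[of l])
    fix p q :: "real^'d" assume "p \<in> cball 0 R" "q \<in> cball 0 R"
    then show "norm (H p - H q) \<le> l * norm (p - q)"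
      by (intro differentiable_bound[where S="cball 0 R" and f'="\<lambda>p. blinfun_apply (H' p)"])
         (auto intro: has_derivative_at_withinI H' simp: norm_blinfun.rep_eq[symmetric] l)
  qed
qed

text \<open>The upper limit inherits the spatial Lipschitz bound and, the slack 1 / n disappearing,
  is Lipschitz in time on bounded intervals. The last conclusion is retained so that the upper
  limits for f and - f can be compared.\<close>

lemma scheme_limit:
  fixes H :: "real^'d \<Rightarrow> real^'m" and f :: "nat \<Rightarrow> (real^'d) \<times> real \<Rightarrow> real"
  assumes lip: "\<And>p q. norm (H p - H q) \<le> l * norm (p - q)"
    and c: "c > 0" and cfl: "real CARD('d) * l \<le> c"
    and B: "\<And>t. t > 0 \<Longrightarrow> (B has_vector_derivative b t) (at t)" and b: "continuous_on {0..} b"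
    and lipx: "\<And>n x y t. \<bar>f n (x, t) - f n (y, t)\<bar> \<le> K0 * norm (x - y)"
    and lipt: "\<And>T. \<exists>K\<ge>0. \<forall>n\<ge>1. \<forall>x. \<forall>s\<in>{0..T}. \<forall>t\<in>{0..T}. \<bar>f n (x, s) - f n (x, t)\<bar> \<le> K * (\<bar>s - t\<bar> + 1 / n)"
    and step: "\<And>n j x. n \<ge> 1 \<Longrightarrow> f n (x, (real j + 1) / n) =
       lax H c (B ((real j + 1) / n) - B (real j / n)) (\<lambda>y. f n (y, real j / n)) x"
    and start: "\<And>n x t. t \<le> 0 \<Longrightarrow> f n (x, t) = u0 x"
    and bnd: "\<And>x. \<bar>u0 x\<bar> \<le> C"
  obtains U where "U \<in> BUC_time" "viscosity_subsolution (\<lambda>t p. H p \<bullet> b t) U"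
    "\<And>x y t. \<bar>U (x, t) - U (y, t)\<bar> \<le> K0 * norm (x - y)"
    "\<And>x t. t \<le> 0 \<Longrightarrow> U (x, t) = u0 x"
    "\<And>z a. U z < a \<Longrightarrow> \<forall>\<^sub>F n in sequentially. f n z < a"
proof -
  have small: "\<forall>\<^sub>F n in sequentially. A / real n < e" if "e > 0" for A e :: real
    using order_tendstoD(2)[OF lim_const_over_n that] .
  have "\<exists>C'. \<forall>\<^sub>F n in sequentially. \<bar>f n z\<bar> \<le> C'" for z
  proof -
    obtain x t where z: "z = (x, t)" by (metis surj_pair)
    show ?thesis
    proof (cases "t \<le> 0")
      case True
      then show ?thesis using bnd by (auto simp: z start)
    next
      case False
      obtain K where K: "K \<ge> 0" "\<forall>n\<ge>1. \<forall>x. \<forall>s\<in>{0..t}. \<forall>r\<in>{0..t}. \<bar>f n (x, s) - f n (x, r)\<bar> \<le> K * (\<bar>s - r\<bar> + 1 / n)"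
        using lipt[of t] by blast
      have "\<bar>f n z\<bar> \<le> C + K * (t + 1)" if "n \<ge> 1" for n
      proof -
        have "\<bar>f n (x, t) - f n (x, 0)\<bar> \<le> K * (\<bar>t - 0\<bar> + 1 / n)"
          using that False by (intro K(2)[rule_format]) auto
        also have "\<dots> \<le> K * (t + 1)" using that False K(1) by (intro mult_left_mono) auto
        finally show ?thesis using bnd[of x] start[of 0 n x] by (simp add: z)
      qed
      then have "\<forall>\<^sub>F n in sequentially. \<bar>f n z\<bar> \<le> C + K * (t + 1)"
        unfolding eventually_sequentially by blast
      then show ?thesis by blast
    qed
  qed
  then obtain U where U1: "\<And>z a. U z < a \<Longrightarrow> \<forall>\<^sub>F n in sequentially. f n z < a"
    and U2: "\<And>z a. a < U z \<Longrightarrow> \<exists>\<^sub>F n in sequentially. a < f n z"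
    by (rule upper_limit_exists[where f=f]) blast
  \<comment> \<open>Inequalities between two values of f n that hold up to A / n pass to the limsup;
    all regularity of U comes from this.\<close>
  have transfer: "U z \<le> U w + \<delta>" if le: "\<And>n. n \<ge> 1 \<Longrightarrow> f n z \<le> f n w + \<delta> + A / n" for z w \<delta> A
  proof (rule ccontr)
    assume "\<not> ?thesis"
    then have gap: "0 < U z - U w - \<delta>" by simp
    define e where "e = (U z - U w - \<delta>) / 3"
    have "3 * e = U z - U w - \<delta>" by (simp add: e_def)
    then have e: "e > 0" "U w + \<delta> + 2 * e < U z" using gap by linarith+
    have "\<forall>\<^sub>F n in sequentially. f n w < U w + e" using e(1) by (intro U1) simp
    moreover have "\<forall>\<^sub>F n in sequentially. A / real n < e" using e(1) by (rule small)
    ultimately have "\<forall>\<^sub>F n in sequentially. \<not> U w + \<delta> + 2 * e < f n z"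
      using eventually_ge_at_top[of "1::nat"]
    proof eventually_elim
      case (elim n)
      then show ?case using le[of n] by linarith
    qed
    then show False using U2[OF e(2)] by (simp add: frequently_def)
  qed
  have Ux: "\<bar>U (x, t) - U (y, t)\<bar> \<le> K0 * norm (x - y)" for x y t
  proof -
    have "f n (x, t) \<le> f n (y, t) + K0 * norm (x - y) + 0 / real n" for n x y
      using lipx[of n x t y] by simp
    then have "U (x, t) \<le> U (y, t) + K0 * norm (x - y)" for x y by (rule transfer)
    from this[of x y] this[of y x] show ?thesis by (simp add: norm_minus_commute)
  qed
  have U0: "U (x, t) = u0 x" if "t \<le> 0" for x t
  proof (rule antisym)
    show "u0 x \<le> U (x, t)"
      by (rule dense_ge) (use U1[of "(x, t)"] start[OF that] in \<open>auto intro: less_imp_le\<close>)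
    show "U (x, t) \<le> u0 x"
      by (rule dense_le) (use U2[of _ "(x, t)"] start[OF that] in \<open>auto intro: less_imp_le\<close>)
  qed
  have "U \<in> BUC (UNIV \<times> {0..T})" if T: "T \<ge> 0" for T
  proof -
    obtain K where K: "K \<ge> 0" "\<forall>n\<ge>1. \<forall>x. \<forall>s\<in>{0..T}. \<forall>t\<in>{0..T}. \<bar>f n (x, s) - f n (x, t)\<bar> \<le> K * (\<bar>s - t\<bar> + 1 / n)"
      using lipt[of T] by blast
    have Ut: "U (x, s) \<le> U (x, t) + K * \<bar>s - t\<bar>" if "s \<in> {0..T}" "t \<in> {0..T}" for x s t
    proof (rule transfer[where A=K])
      fix n :: nat assume "n \<ge> 1"
      then have "\<bar>f n (x, s) - f n (x, t)\<bar> \<le> K * (\<bar>s - t\<bar> + 1 / n)" using K(2) that by blast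
      then show "f n (x, s) \<le> f n (x, t) + K * \<bar>s - t\<bar> + K / n" by (simp add: distrib_left)
    qed
    have K0: "K0 \<ge> 0" using lipx[of 0 "axis undefined 1" 0 0] by (simp add: norm_axis_real)
    have le: "U z - U w \<le> (K0 + K) * norm (z - w)" if "z \<in> UNIV \<times> {0..T}" "w \<in> UNIV \<times> {0..T}" for z w
    proof -
      obtain x t y s where [simp]: "z = (x, t)" "w = (y, s)" by (metis surj_pair)
      have "K0 * norm (x - y) \<le> K0 * norm (z - w)" using K0 norm_fst_le[of "x - y" "t - s"] by (simp add: mult_left_mono)
      moreover have "K * \<bar>t - s\<bar> \<le> K * norm (z - w)" using K(1) norm_snd_le[of "t - s" "x - y"] by (simp add: mult_left_mono)
      ultimately show ?thesis using Ut[of t s x] Ux[of x s y] that by (simp add: distrib_right abs_le_iff)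
    qed
    have "(K0 + K)-lipschitz_on (UNIV \<times> {0..T}) U"
    proof (rule lipschitz_onI)
      fix z w :: "(real^'d) \<times> real" assume "z \<in> UNIV \<times> {0..T}" "w \<in> UNIV \<times> {0..T}"
      then show "dist (U z) (U w) \<le> (K0 + K) * dist z w"
        using le[of z w] le[of w z] unfolding dist_norm by (simp add: norm_minus_commute abs_le_iff)
    qed (use K0 K in simp)
    then have "uniformly_continuous_on (UNIV \<times> {0..T}) U" by (rule lipschitz_on_uniformly_continuous)
    moreover have "bounded (U ` (UNIV \<times> {0..T}))"
    proof (rule boundedI)
      fix a assume "a \<in> U ` (UNIV \<times> {0..T})"
      then obtain x t where a: "a = U (x, t)" "t \<in> {0..T}" by auto
      have "K * \<bar>t\<bar> \<le> K * T" using a K(1) by (intro mult_left_mono) auto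
      then show "norm a \<le> C + K * T"
        using Ut[of t 0 x] Ut[of 0 t x] a(2) T U0[of 0 x] bnd[of x] by (auto simp: a(1) abs_le_iff)
    qed
    ultimately show ?thesis by (simp add: BUC_def)
  qed
  then have "U \<in> BUC_time" by (simp add: BUC_time_def)
  moreover have "viscosity_subsolution (\<lambda>t p. H p \<bullet> b t) U"
    by (rule scheme_limit_subsolution[OF lip c cfl B b lipx lipt step U1 U2])
  ultimately show ?thesis using that Ux U0 U1 by blast
qed

primrec grid_solution :: "(real^'d \<Rightarrow> real^'m) \<Rightarrow> real \<Rightarrow> (nat \<Rightarrow> real^'m) \<Rightarrow> (real^'d \<Rightarrow> real) \<Rightarrow> nat \<Rightarrow> real^'d \<Rightarrow> real" where
  "grid_solution H c \<xi> f 0 = f"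
| "grid_solution H c \<xi> f (Suc j) = lax H c (\<xi> j) (grid_solution H c \<xi> f j)"

text \<open>The upper limit U of the scheme is a subsolution. The negated scheme is the scheme for p
  \<mapsto> - G (- p); its upper limit V makes - V the lower limit and a supersolution. Comparison
  gives U \<le> - V and lower limit \<le> upper limit gives the converse, so the common function is
  a solution.\<close>

theorem HJ_solution_exists:
  fixes H :: "real^'d \<Rightarrow> real^'m" and u0 :: "real^'d \<Rightarrow> real"
  assumes C11: "C11_loc H" and u0: "\<And>x y. u0 x \<le> u0 y + K0 * norm (x - y)" and bnd: "\<And>x. \<bar>u0 x\<bar> \<le> C"
    and path: "C1_path B" "B 0 = 0"
  shows "\<exists>u\<in>BUC_time. HJ_solution H B u0 u"
proof -
  obtain b where b: "continuous_on {0..} b" "continuous_on {0..} B"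
    "\<And>t. t > 0 \<Longrightarrow> (B has_vector_derivative b t) (at t)"
    "\<And>t. t > 0 \<Longrightarrow> vector_derivative B (at t) = b t"
    "\<And>t. t \<ge> 0 \<Longrightarrow> (B has_vector_derivative b t) (at t within {0..})"
    by (rule C1_path_derivative[OF path(1)]) blast
  have K0: "K0 \<ge> 0" using u0[of "axis undefined 1" 0] u0[of 0 "axis undefined 1"] by (simp add: norm_axis_real)
  obtain l where l: "\<And>p q. p \<in> cball 0 K0 \<Longrightarrow> q \<in> cball 0 K0 \<Longrightarrow> norm (H p - H q) \<le> l * norm (p - q)"
    by (rule C11_loc_lipschitz[OF C11, of K0]) blast
  let ?P = "closest_point (cball 0 K0 :: (real^'d) set)"
  \<comment> \<open>Projecting p onto the ball of radius K0 makes the Hamiltonian globally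
    Lipschitz. The change is invisible, since the scheme keeps the Lipschitz constant K0 of the
    datum.\<close>
  define G where "G p = H (?P p)" for p
  have ball: "(cball 0 K0 :: (real^'d) set) \<noteq> {}" using K0 by simp
  have GH: "G p = H p" if "norm p \<le> K0" for p using that by (simp add: G_def closest_point_self)
  have P: "?P p \<in> cball 0 K0" for p by (rule closest_point_in_set[OF closed_cball ball])
  define l' where "l' = \<bar>l\<bar>"
  have lip: "norm (G p - G q) \<le> l' * norm (p - q)" for p q
  proof -
    have "norm (G p - G q) \<le> l * norm (?P p - ?P q)" unfolding G_def by (rule l[OF P P])
    also have "\<dots> \<le> l' * norm (?P p - ?P q)" by (intro mult_right_mono) (auto simp: l'_def)
    also have "\<dots> \<le> l' * norm (p - q)"
      using closest_point_lipschitz[OF convex_cball closed_cball ball, of p q]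
      by (intro mult_left_mono) (auto simp: l'_def dist_norm)
    finally show ?thesis .
  qed
  \<comment> \<open>The summand 1 keeps the mesh ratio positive even when H is constant on the
    ball.\<close>
  define c where "c = real CARD('d) * l' + 1"
  have c: "c > 0" "real CARD('d) * l' \<le> c" by (auto simp: c_def l'_def intro: add_nonneg_pos)
  define \<xi> where "\<xi> n j = B ((real j + 1) / real n) - B (real j / real n)" for n j
  define w where "w n = grid_solution G c (\<xi> n) u0" for n
  \<comment> \<open>Constant in time between grid points. At negative times \<open>nat\<close> sends
    the index to 0, which continues the datum backwards.\<close>
  define f where "f n z = w n (nat \<lfloor>real n * snd z\<rfloor>) (fst z)" for n and z :: "(real^'d) \<times> real"
  have w_lip: "w n j x \<le> w n j y + K0 * norm (x - y)" for n j x y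
    by (induction j arbitrary: x y) (auto simp: w_def intro!: u0 lax_lipschitz[OF lip c])
  define Cs where "Cs = 2 * c * K0 + norm (G 0)"
  have Cs: "Cs \<ge> 0" using c K0 by (simp add: Cs_def)
  have w_time: "\<bar>w n k x - w n j x\<bar> \<le> (real k - real j) * (Cs * m)"
    if "j \<le> k" "\<And>i. i < k \<Longrightarrow> norm (\<xi> n i) \<le> m" for n j k x m
    using that
  proof (induction k)
    case (Suc k)
    show ?case
    proof (cases "j = Suc k")
      case False
      have "\<bar>w n (Suc k) x - w n k x\<bar> \<le> Cs * norm (\<xi> n k)"
        unfolding w_def grid_solution.simps Cs_def
        by (rule lax_bound[OF lip c w_lip[unfolded w_def] K0])
      also have "\<dots> \<le> Cs * m" using Suc.prems(2)[of k] Cs by (intro mult_left_mono) auto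
      finally have "\<bar>w n (Suc k) x - w n k x\<bar> \<le> Cs * m" .
      moreover have "\<bar>w n k x - w n j x\<bar> \<le> (real k - real j) * (Cs * m)"
        using False Suc.prems by (intro Suc.IH) auto
      ultimately show ?thesis by (simp add: algebra_simps)
    qed auto
  qed auto
  have lipx: "\<bar>f n (x, t) - f n (y, t)\<bar> \<le> K0 * norm (x - y)" for n x y t
    using w_lip[of n "nat \<lfloor>real n * t\<rfloor>" x y] w_lip[of n "nat \<lfloor>real n * t\<rfloor>" y x]
    by (simp add: f_def abs_le_iff norm_minus_commute)
  have lipt: "\<exists>K\<ge>0. \<forall>n\<ge>1. \<forall>x. \<forall>s\<in>{0..T}. \<forall>t\<in>{0..T}. \<bar>f n (x, s) - f n (x, t)\<bar> \<le> K * (\<bar>s - t\<bar> + 1 / real n)" for T :: real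
  proof -
    obtain M where M: "M \<ge> 0" "\<And>t. t \<in> {0..T} \<Longrightarrow> norm (b t) \<le> M"
      by (rule bounded_path[OF b(1), of T]) auto
    have BM: "norm (B s - B t) \<le> M * norm (s - t)" if "s \<in> {0..T}" "t \<in> {0..T}" for s t :: real
    proof (rule differentiable_bound[where S="{0..T}" and f'="\<lambda>t h. h *\<^sub>R b t"])
      fix r assume r: "r \<in> {0..T}"
      show "(B has_derivative (\<lambda>h. h *\<^sub>R b r)) (at r within {0..T})"
        using b(5)[of r] r unfolding has_vector_derivative_def
        by (auto intro: has_derivative_subset)
      show "onorm (\<lambda>h. h *\<^sub>R b r) \<le> M"
      proof (rule onorm_le)
        show "norm (h *\<^sub>R b r) \<le> M * norm h" for h
          using mult_right_mono[OF M(2)[OF r], of "norm h"] by (simp add: mult.commute)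
      qed
    qed (use that in auto)
    have le: "\<bar>f n (x, t) - f n (x, s)\<bar> \<le> (Cs * M) * (\<bar>s - t\<bar> + 1 / real n)"
      if n: "n \<ge> 1" and st: "s \<in> {0..T}" "t \<in> {0..T}" "s \<le> t" for n x and s t :: real
    proof -
      define j k where "j = nat \<lfloor>real n * s\<rfloor>" and "k = nat \<lfloor>real n * t\<rfloor>"
      have n0: "real n > 0" using n by simp
      have nst: "0 \<le> real n * s" "real n * s \<le> real n * t" using st n0 by auto
      have jk: "j \<le> k" using nst by (simp add: j_def k_def nat_mono floor_mono)
      have rj: "real j = of_int \<lfloor>real n * s\<rfloor>" "real k = of_int \<lfloor>real n * t\<rfloor>"
        using nst by (simp_all add: j_def k_def)
      \<comment> \<open>Rounding both times down can add one step; this is the origin of the slack 1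
        / n in \<open>lipt\<close>.\<close>
      have diff: "real k - real j \<le> n * (t - s) + 1"
        unfolding rj right_diff_distrib by linarith
      have inc: "norm (\<xi> n i) \<le> M / n" if "i < k" for i
      proof -
        have "real i + 1 \<le> real k" using that by linarith
        also have "\<dots> \<le> n * T" unfolding rj using st n0 by (smt (verit) atLeastAtMost_iff mult_left_mono of_int_floor_le)
        finally have "(real i + 1) / n \<le> T" using n0 by (simp add: pos_divide_le_eq mult.commute)
        moreover have "real i / n \<le> (real i + 1) / n" using n0 by (simp add: divide_right_mono)
        ultimately have "norm (\<xi> n i) \<le> M * norm ((real i + 1) / n - real i / n)"
          unfolding \<xi>_def using n0 by (intro BM) auto
        then show ?thesis by (simp add: diff_divide_distrib[symmetric])
      qed
      have "\<bar>f n (x, t) - f n (x, s)\<bar> \<le> (real k - real j) * (Cs * (M / n))"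
        using w_time[OF jk inc] by (simp add: f_def j_def k_def)
      also have "\<dots> \<le> (n * (t - s) + 1) * (Cs * (M / n))"
        using diff Cs M(1) by (intro mult_right_mono) auto
      also have "\<dots> = (Cs * M) * (\<bar>s - t\<bar> + 1 / real n)"
        using n0 st(3) by (simp add: field_simps)
      finally show ?thesis .
    qed
    show ?thesis
    proof (intro exI[of _ "Cs * M"] conjI allI ballI impI)
      fix n :: nat and x s t assume A: "1 \<le> n" "s \<in> {0..T}" "t \<in> {0..T}"
      show "\<bar>f n (x, s) - f n (x, t)\<bar> \<le> (Cs * M) * (\<bar>s - t\<bar> + 1 / real n)"
        using le[OF A, of x] le[OF A(1,3,2), of x] by (cases "s \<le> t") (simp_all add: abs_minus_commute)
    qed (use Cs M in simp)
  qed
  have node: "f n (x, real j / n) = w n j x" if "n \<ge> 1" for n j x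
    using that by (simp add: f_def)
  have step: "f n (x, (real j + 1) / n) = lax G c (B ((real j + 1) / n) - B (real j / n)) (\<lambda>y. f n (y, real j / n)) x"
    if "n \<ge> 1" for n j x
  proof -
    have "f n (x, (real j + 1) / n) = w n (Suc j) x"
      using node[OF that, of x "Suc j"] by (simp add: add.commute)
    then show ?thesis by (simp add: node[OF that]) (simp add: w_def \<xi>_def)
  qed
  have start: "f n (x, t) = u0 x" if "t \<le> 0" for n x t
  proof -
    have "real n * t \<le> 0" using that by (simp add: mult_nonneg_nonpos)
    then have "\<lfloor>real n * t\<rfloor> \<le> 0" by linarith
    then show ?thesis by (simp add: f_def w_def)
  qed
  obtain U where U: "U \<in> BUC_time" "viscosity_subsolution (\<lambda>t p. G p \<bullet> b t) U"
    "\<And>x y t. \<bar>U (x, t) - U (y, t)\<bar> \<le> K0 * norm (x - y)"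
    "\<And>x t. t \<le> 0 \<Longrightarrow> U (x, t) = u0 x"
    "\<And>z a. U z < a \<Longrightarrow> \<forall>\<^sub>F n in sequentially. f n z < a"
    by (rule scheme_limit[where f=f, OF lip c b(3,1) lipx lipt step start bnd]) (assumption | rule that)+
  have lip': "norm (- G (- p) - - G (- q)) \<le> l' * norm (p - q)" for p q
    using lip[of "- p" "- q"] by (simp add: norm_minus_commute)
  have lipx': "\<bar>- f n (x, t) - - f n (y, t)\<bar> \<le> K0 * norm (x - y)" for n x y t
    using lipx[of n x t y] by simp
  have lipt': "\<exists>K\<ge>0. \<forall>n\<ge>1. \<forall>x. \<forall>s\<in>{0..T}. \<forall>t\<in>{0..T}. \<bar>- f n (x, s) - - f n (x, t)\<bar> \<le> K * (\<bar>s - t\<bar> + 1 / real n)" for T :: real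
    using lipt[of T] by (simp add: abs_minus_commute)
  have step': "- f n (x, (real j + 1) / n) = lax (\<lambda>p. - G (- p)) c (B ((real j + 1) / n) - B (real j / n)) (\<lambda>y. - f n (y, real j / n)) x"
    if "n \<ge> 1" for n j x
    unfolding step[OF that] by (rule lax_minus[where H=G, symmetric])
  have start': "- f n (x, t) = - u0 x" if "t \<le> 0" for n x t using start[OF that] by simp
  have bnd': "\<bar>- u0 x\<bar> \<le> C" for x using bnd[of x] by simp
  obtain V where V: "V \<in> BUC_time" "viscosity_subsolution (\<lambda>t p. - G (- p) \<bullet> b t) V"
    "\<And>x y t. \<bar>V (x, t) - V (y, t)\<bar> \<le> K0 * norm (x - y)"
    "\<And>x t. t \<le> 0 \<Longrightarrow> V (x, t) = - u0 x"
    "\<And>z a. V z < a \<Longrightarrow> \<forall>\<^sub>F n in sequentially. - f n z < a"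
    by (rule scheme_limit[where f="\<lambda>n z. - f n z", OF lip' c b(3,1) lipx' lipt' step' start' bnd']) (assumption | rule that)+
  have sub: "viscosity_subsolution (driven H B) U"
    by (rule subsolution_lipschitz_cong[OF U(2,3)]) (subst driven_inner, simp add: GH b(4))
  have "viscosity_subsolution (\<lambda>t p. - driven H B t (- p)) V"
    by (rule subsolution_lipschitz_cong[OF V(2,3)]) (subst driven_inner, simp add: GH b(4))
  then have super: "viscosity_supersolution (driven H B) (\<lambda>z. - V z)"
    using subsolution_minus_iff[of "driven H B" "\<lambda>z. - V z"] by simp
  have VB: "(\<lambda>z. - V z) \<in> BUC_time"
    using V(1) by (auto simp: BUC_time_def BUC_def bounded_iff intro: uniformly_continuous_on_minus)
  have "uniformly_continuous_on UNIV u0"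
  proof -
    have "K0-lipschitz_on UNIV u0"
    proof (rule lipschitz_onI)
      show "dist (u0 x) (u0 y) \<le> K0 * dist x y" for x y
        using u0[of x y] u0[of y x] by (simp add: dist_real_def abs_le_iff dist_norm norm_minus_commute)
    qed (rule K0)
    then show ?thesis by (rule lipschitz_on_uniformly_continuous)
  qed
  then have u0B: "u0 \<in> BUC UNIV" using bnd by (auto simp: BUC_def bounded_iff)
  have "U z = - V z" for z
  proof -
    obtain x t where z: "z = (x, t)" by (metis surj_pair)
    show ?thesis
    proof (cases "t \<le> 0")
      case True
      then show ?thesis by (simp add: z U(4) V(4))
    next
      case False
      have "U z \<le> - V z"
        unfolding z by (rule comparison[OF C11 u0B path U(1) VB sub super]) (use False U(4) V(4) in auto)
      \<comment> \<open>For large n both f n z < U z + e / 2 and - f n z < V z + e / 2; adding them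
        gives the lower limit at most the upper one.\<close>
      moreover have "- V z \<le> U z"
      proof (rule field_le_epsilon)
        fix e :: real assume e: "e > 0"
        have "\<forall>\<^sub>F n in sequentially. f n z < U z + e / 2" using e by (intro U(5)) simp
        moreover have "\<forall>\<^sub>F n in sequentially. - f n z < V z + e / 2" using e by (intro V(5)) simp
        ultimately have "\<forall>\<^sub>F n :: nat in sequentially. - V z \<le> U z + e" by eventually_elim linarith
        then show "- V z \<le> U z + e" by simp
      qed
      ultimately show ?thesis by simp
    qed
  qed
  then have "(\<lambda>z. - V z) = U" by auto
  then have "HJ_solution H B u0 U"
    using sub super U(4) continuous_on_BUC_time[OF U(1)] by (simp add: HJ_solution_def viscosity_solution_def)
  then show ?thesis using U(1) by blast
qed

subsection \<open>Approximation and the limit\<close>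

text \<open>The infimum of u0 y + K |x - y| is K-Lipschitz in x. With K = 2 C / r, points y beyond
  distance r pay at least the oscillation 2 C; nearer ones change u0 by less than e.\<close>

lemma inf_convolution:
  fixes u0 :: "'a::real_normed_vector \<Rightarrow> real"
  assumes "u0 \<in> BUC UNIV" "e > 0"
  obtains g K C where "\<And>x y. g x \<le> g y + K * norm (x - y)" "\<And>x. \<bar>g x\<bar> \<le> C" "\<And>x. \<bar>g x - u0 x\<bar> \<le> e"
proof -
  have "bounded (u0 ` UNIV)" using assms(1) by (simp add: BUC_def)
  then obtain C where C: "C \<ge> 0" "\<And>x. \<bar>u0 x\<bar> \<le> C" by (rule bounded_image_norm_le) auto
  have "uniformly_continuous_on UNIV u0" using assms(1) by (simp add: BUC_def)
  then obtain r where r: "r > 0" "\<forall>x. \<forall>y. dist y x < r \<longrightarrow> dist (u0 y) (u0 x) < e"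
    using assms(2) unfolding uniformly_continuous_on_def by blast
  define K where "K = 2 * C / r"
  have K: "K \<ge> 0" using C r by (simp add: K_def)
  define g where "g x = (INF y. u0 y + K * norm (x - y))" for x
  have "- C \<le> u0 y + K * norm (x - y)" for x y
    using C(2)[of y] mult_nonneg_nonneg[OF K norm_ge_zero[of "x - y"]] by linarith
  then have bdd: "bdd_below (range (\<lambda>y. u0 y + K * norm (x - y)))" for x
    by (intro bdd_belowI[of _ "- C"]) auto
  have upper: "g x \<le> u0 y + K * norm (x - y)" for x y
    unfolding g_def by (rule cINF_lower[OF bdd]) simp
  have lower: "u0 x - e \<le> g x" for x
    unfolding g_def
  proof (rule cINF_greatest)
    fix y
    show "u0 x - e \<le> u0 y + K * norm (x - y)"
    proof (cases "dist x y < r")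
      case True
      then have "\<bar>u0 x - u0 y\<bar> < e" using r(2) by (auto simp: dist_real_def)
      then show ?thesis using mult_nonneg_nonneg[OF K norm_ge_zero[of "x - y"]] by linarith
    next
      case False
      then have "K * r \<le> K * norm (x - y)" using K by (intro mult_left_mono) (auto simp: dist_norm)
      moreover have "K * r = 2 * C" using r by (simp add: K_def)
      ultimately show ?thesis using C(2)[of x] C(2)[of y] assms(2) by linarith
    qed
  qed simp
  have close: "\<bar>g x - u0 x\<bar> \<le> e" for x using upper[of x x] lower[of x] by simp
  have "g x \<le> g y + K * norm (x - y)" for x y
  proof -
    have "g x - K * norm (x - y) \<le> u0 z + K * norm (y - z)" for z
    proof -
      have "norm (x - z) \<le> norm (x - y) + norm (y - z)" using norm_triangle_ineq[of "x - y" "y - z"] by simp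
      then have "K * norm (x - z) \<le> K * norm (x - y) + K * norm (y - z)"
        using K by (metis distrib_left mult_left_mono)
      then show ?thesis using upper[of x z] by linarith
    qed
    then have "g x - K * norm (x - y) \<le> g y"
      unfolding g_def[of y] by (intro cINF_greatest) auto
    then show ?thesis by linarith
  qed
  moreover have "\<bar>g x\<bar> \<le> C + e" for x using close[of x] C(2)[of x] by linarith
  ultimately show ?thesis using close by (rule that)
qed

section \<open>Smoothing a path uniformly on the half-line\<close>

lemma antiderivative_real:
  fixes f :: "real \<Rightarrow> 'a::euclidean_space"
  assumes "continuous_on UNIV f"
  obtains F where "\<And>x. (F has_vector_derivative f x) (at x)"
proof -
  have "\<exists>F. \<forall>x::real. - \<infinity> < ereal x \<longrightarrow> ereal x < \<infinity> \<longrightarrow> (F has_vector_derivative f x) (at x)"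
    using assms by (intro einterval_antiderivative) (auto simp: continuous_on_eq_continuous_at)
  then show ?thesis using that by auto
qed

text \<open>A positive continuous window \<open>k\<close> within which \<open>B\<close> oscillates by less than \<open>\<eta>\<close>: the
  distance of \<open>(t + 1, 0)\<close> to the pairs \<open>(a, r)\<close> such that \<open>B\<close> oscillates by \<open>\<eta>\<close> on \<open>[0, a]\<close>
  within a distance \<open>r\<close>. That set is stable under increasing \<open>a\<close>, whence \<open>k\<close> is decreasing.\<close>

lemma oscillation_window:
  fixes B :: "real \<Rightarrow> 'a::euclidean_space"
  assumes B: "continuous_on {0..} B" and \<eta>: "\<eta> > 0"
  obtains k :: "real \<Rightarrow> real" where "continuous_on UNIV k" "\<And>t. k t > 0" "\<And>t. k t \<le> 1" "\<And>s t. s \<le> t \<Longrightarrow> k t \<le> k s"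
    "\<And>s t. 0 \<le> t \<Longrightarrow> t \<le> s \<Longrightarrow> s - t < k t \<Longrightarrow> norm (B s - B t) < \<eta>"
proof -
  \<comment> \<open>The clause r \<ge> 1 makes E nonempty, where \<open>infdist\<close> would
    otherwise be 0, and bounds k by 1.\<close>
  define E where "E = {(a, r). r \<ge> 1 \<or> (\<exists>s\<in>{0..a}. \<exists>t\<in>{0..a}. \<bar>s - t\<bar> \<le> r \<and> \<eta> \<le> norm (B s - B t))}"
  \<comment> \<open>The base point is t + 1 because s - t < k t \<le> 1 puts both s and t in
    [0, t + 1].\<close>
  define k where "k t = infdist (t + 1, 0) E" for t :: real
  have E1: "(a, 1) \<in> E" for a by (auto simp: E_def)
  then have ne: "E \<noteq> {}" by blast
  have "continuous_on UNIV k" unfolding k_def by (intro continuous_intros)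
  moreover have "k t > 0" for t
  proof -
    obtain d where d: "d > 0" "\<And>s r. s \<in> {0..t+2} \<Longrightarrow> r \<in> {0..t+2} \<Longrightarrow> \<bar>s - r\<bar> < d \<Longrightarrow> dist (B s) (B r) < \<eta>"
      by (rule uniformly_continuous_on_path[OF B \<eta>, of "t + 2"]) auto
    \<comment> \<open>A pair in E with |t + 1 - a| < 1 has a \<le> t + 2, hence r \<ge> min 1 d by
      uniform continuity on [0, t + 2]. The other pairs are at distance at least 1.\<close>
    have "min 1 d \<le> infdist (t + 1, 0) E"
      unfolding infdist_notempty[OF ne]
    proof (rule cINF_greatest[OF ne])
      fix z assume z: "z \<in> E"
      obtain a r where zar: "z = (a, r)" by (metis surj_pair)
      have "norm ((t + 1, 0) - z) \<ge> \<bar>t + 1 - a\<bar>" using norm_fst_le[of "t + 1 - a" "- r"] by (simp add: zar)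
      moreover have "norm ((t + 1, 0) - z) \<ge> \<bar>r\<bar>" using norm_snd_le[of "- r" "t + 1 - a"] by (simp add: zar)
      moreover have "min 1 d \<le> r" if "\<bar>t + 1 - a\<bar> < 1"
      proof (cases "r \<ge> 1")
        case False
        then obtain s s' where s: "s \<in> {0..a}" "s' \<in> {0..a}" "\<bar>s - s'\<bar> \<le> r" "\<eta> \<le> norm (B s - B s')"
          using z unfolding E_def zar by blast
        have "a \<le> t + 2" using that by linarith
        then have "\<not> \<bar>s - s'\<bar> < d" using d(2)[of s s'] s by (auto simp: dist_norm)
        then show ?thesis using s(3) by simp
      qed simp
      ultimately show "min 1 d \<le> dist (t + 1, 0) z" unfolding dist_norm by (cases "\<bar>t + 1 - a\<bar> < 1") auto
    qed
    then show ?thesis using d(1) by (simp add: k_def)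
  qed
  moreover have "k t \<le> 1" for t
    using infdist_le[OF E1, of "(t + 1, 0)" "t + 1"] by (simp add: k_def dist_Pair_Pair)
  moreover have "k t \<le> k s" if "s \<le> t" for s t
    unfolding k_def[of s] infdist_notempty[OF ne]
  proof (rule cINF_greatest[OF ne])
    fix z assume z: "z \<in> E"
    obtain a r where zar: "z = (a, r)" by (metis surj_pair)
    have "{0..a} \<subseteq> {0..a + (t - s)}" using that by auto
    then have "(a + (t - s), r) \<in> E" using z unfolding zar E_def by blast
    then have "k t \<le> dist (t + 1, 0) (a + (t - s), r)" unfolding k_def by (rule infdist_le)
    also have "\<dots> = dist (s + 1, 0) z" by (simp add: zar dist_Pair_Pair dist_real_def algebra_simps)
    finally show "k t \<le> dist (s + 1, 0) z" .
  qed
  moreover have "norm (B s - B t) < \<eta>" if st: "0 \<le> t" "t \<le> s" "s - t < k t" for s t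
  proof (rule ccontr)
    assume "\<not> ?thesis"
    moreover have "s \<le> t + 1" using st \<open>k t \<le> 1\<close> by linarith
    ultimately have "s \<in> {0..t + 1}" "t \<in> {0..t + 1}" "\<bar>s - t\<bar> \<le> s - t" "\<eta> \<le> norm (B s - B t)"
      using st by auto
    then have "(t + 1, s - t) \<in> E" unfolding E_def mem_Collect_eq prod.case by blast
    then have "k t \<le> dist (t + 1, 0) (t + 1, s - t)" unfolding k_def by (rule infdist_le)
    then show False using st by (simp add: dist_Pair_Pair dist_real_def)
  qed
  ultimately show ?thesis by (rule that)
qed

text \<open>A moving average of B over [t, t + w t]. A fixed window could fail, since B need not be
  uniformly continuous on the half-line; the window shrinks as the oscillation of B requires and
  must itself be C^1.\<close>

lemma C1_path_approximation:
  fixes B :: "real \<Rightarrow> real^'m"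
  assumes B: "continuous_on {0..} B" "B 0 = 0" and e: "e > 0"
  obtains P where "C1_path P" "P 0 = 0" "\<And>t. t \<ge> 0 \<Longrightarrow> norm (P t - B t) \<le> e"
proof -
  define \<eta> where "\<eta> = e / 2"
  have \<eta>: "\<eta> > 0" using e by (simp add: \<eta>_def)
  obtain k :: "real \<Rightarrow> real" where k: "continuous_on UNIV k" "\<And>t. k t > 0" "\<And>t. k t \<le> 1" "\<And>s t. s \<le> t \<Longrightarrow> k t \<le> k s"
    "\<And>s t. 0 \<le> t \<Longrightarrow> t \<le> s \<Longrightarrow> s - t < k t \<Longrightarrow> norm (B s - B t) < \<eta>"
    by (rule oscillation_window[OF B(1) \<eta>]) blast
  define Bh where "Bh t = B (max 0 t)" for t
  have cBh: "continuous_on UNIV Bh" unfolding Bh_def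
    by (rule continuous_on_compose2[OF B(1)]) (auto intro!: continuous_intros)
  obtain A where A: "\<And>t. (A has_vector_derivative Bh t) (at t)"
    by (rule antiderivative_real[OF cBh]) blast
  obtain I where I: "\<And>t. (I has_vector_derivative k t) (at t)"
    by (rule antiderivative_real[OF k(1)]) blast
  have I': "(I has_real_derivative k t) (at t)" for t
    using I[of t] by (simp add: has_real_derivative_iff_has_vector_derivative)
  \<comment> \<open>Half the mean of k over [t, t + 1]: averaging makes it C^1, and since k is
    decreasing and positive it lies strictly between 0 and k t.\<close>
  define w where "w t = (I (t + 1) - I t) / 2" for t
  define w' where "w' t = (k (t + 1) - k t) / 2" for t
  have w_pos: "w t > 0" and w_less: "w t < k t" for t
  proof -
    obtain z where z: "t < z" "z < t + 1" "I (t + 1) - I t = (t + 1 - t) * k z"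
      using MVT2[of t "t + 1" I k] I' by auto
    then have "w t = k z / 2" by (simp add: w_def)
    moreover have "k z \<le> k t" using z by (intro k(4)) simp
    ultimately show "w t > 0" "w t < k t" using k(2)[of z] by simp_all
  qed
  have dI1: "((\<lambda>t. I (t + 1)) has_real_derivative k (t + 1)) (at t)" for t
    by (rule DERIV_shift[THEN iffD1, OF I'])
  have dw: "(w has_real_derivative w' t) (at t)" for t
    unfolding w_def w'_def by (auto intro!: derivative_eq_intros dI1 I')
  define Q where "Q t = (1 / w t) *\<^sub>R (A (t + w t) - A t)" for t
  define Q' where "Q' t = (1 / w t) *\<^sub>R ((1 + w' t) *\<^sub>R Bh (t + w t) - Bh t) + (- (w' t / (w t * w t))) *\<^sub>R (A (t + w t) - A t)" for t
  have dA: "((\<lambda>t. A (t + w t)) has_vector_derivative (1 + w' t) *\<^sub>R Bh (t + w t)) (at t)" for t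
  proof -
    have "((\<lambda>t. t + w t) has_real_derivative 1 + w' t) (at t)"
      by (auto intro!: derivative_eq_intros dw)
    then have "((\<lambda>t. t + w t) has_vector_derivative 1 + w' t) (at t)"
      by (simp add: has_real_derivative_iff_has_vector_derivative)
    from vector_diff_chain_at[OF this A] show ?thesis by (simp add: o_def)
  qed
  have dinv: "((\<lambda>t. 1 / w t) has_real_derivative - (w' t / (w t * w t))) (at t)" for t
    using w_pos[of t] by (auto intro!: derivative_eq_intros dw simp: field_simps)
  have dQ: "(Q has_vector_derivative Q' t) (at t)" for t
    unfolding Q_def Q'_def
    by (rule has_vector_derivative_scaleR[OF dinv has_vector_derivative_diff[OF dA A]])
  have cw: "continuous_on UNIV w"
    using dw by (intro continuous_at_imp_continuous_on) (auto intro: DERIV_isCont)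
  have cA: "continuous_on UNIV A"
    using A by (intro continuous_at_imp_continuous_on) (auto intro: has_vector_derivative_continuous)
  have cQ': "continuous_on UNIV Q'"
  proof -
    have 1: "continuous_on UNIV (\<lambda>t. Bh (t + w t))" "continuous_on UNIV (\<lambda>t. A (t + w t))" "continuous_on UNIV (\<lambda>t. k (t + 1))"
      by (auto intro!: continuous_on_compose2[OF cBh] continuous_on_compose2[OF cA] continuous_on_compose2[OF k(1)] continuous_intros cw)
    have 2: "continuous_on UNIV w'" unfolding w'_def by (intro continuous_intros 1 k(1)) auto
    have "w t \<noteq> 0" for t using w_pos[of t] by simp
    then show ?thesis unfolding Q'_def by (intro continuous_intros 1 2 cw cA cBh) auto
  qed
  have Q_close: "norm (Q t - B t) \<le> \<eta>" if t: "t \<ge> 0" for t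
  proof -
    \<comment> \<open>Subtracting the linear path with velocity B t leaves the derivative Bh s - B
      t, which is below \<eta> throughout the window.\<close>
    define h where "h s = A s - s *\<^sub>R B t" for s
    have "norm (h (t + w t) - h t) \<le> \<eta> * norm (t + w t - t)"
    proof (rule differentiable_bound[where S="{t..t + w t}" and f'="\<lambda>s r. r *\<^sub>R (Bh s - B t)"])
      fix s assume s: "s \<in> {t..t + w t}"
      have "(h has_vector_derivative (Bh s - B t)) (at s)"
        unfolding h_def by (auto intro!: derivative_eq_intros A)
      then show "(h has_derivative (\<lambda>r. r *\<^sub>R (Bh s - B t))) (at s within {t..t + w t})"
        unfolding has_vector_derivative_def by (rule has_derivative_at_withinI)
      have "norm (Bh s - B t) < \<eta>"
        using k(5)[of t s] s t w_less[of t] by (simp add: Bh_def max_def)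
      then show "onorm (\<lambda>r. r *\<^sub>R (Bh s - B t)) \<le> \<eta>"
        by (intro onorm_le) (simp add: mult.commute[of \<eta>] mult_left_mono)
    qed (use w_pos[of t] in auto)
    then have "norm (A (t + w t) - A t - w t *\<^sub>R B t) \<le> \<eta> * w t"
      using w_pos[of t] by (simp add: h_def algebra_simps)
    moreover have "Q t - B t = (1 / w t) *\<^sub>R (A (t + w t) - A t - w t *\<^sub>R B t)"
      using w_pos[of t] by (simp add: Q_def scaleR_diff_right)
    ultimately show ?thesis using w_pos[of t] by (simp add: pos_divide_le_eq)
  qed
  \<comment> \<open>Normalising P 0 = 0 costs a second error \<eta>, whence \<eta> = e / 2.\<close>
  define P where "P t = Q t - Q 0" for t
  have dP: "(P has_vector_derivative Q' t) (at t)" for t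
  proof -
    have "(P has_vector_derivative Q' t - 0) (at t)"
      unfolding P_def by (rule has_vector_derivative_diff[OF dQ has_vector_derivative_const])
    then show ?thesis by simp
  qed
  show ?thesis
  proof (rule that[of P])
    show "C1_path P" unfolding C1_path_def
      using dP continuous_on_subset[OF cQ'] by (auto intro: has_vector_derivative_at_within)
    show "P 0 = 0" by (simp add: P_def)
    show "norm (P t - B t) \<le> e" if "t \<ge> 0" for t
    proof -
      have "P t - B t = (Q t - B t) - (Q 0 - B 0)" by (simp add: P_def B(2))
      then have "norm (P t - B t) \<le> norm (Q t - B t) + norm (Q 0 - B 0)" by (simp only: norm_triangle_ineq4)
      then show ?thesis using Q_close[OF that] Q_close[of 0] by (simp add: \<eta>_def)
    qed
  qed
qed

lemma BUC_time_uniform_limit: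
  fixes u :: "(real^'d) \<times> real \<Rightarrow> real"
  assumes s: "\<And>e. e > 0 \<Longrightarrow> \<exists>v\<in>BUC_time. \<forall>x. \<forall>t\<ge>0. \<bar>v (x, t) - u (x, t)\<bar> \<le> e"
  shows "u \<in> BUC_time"
  unfolding BUC_time_def BUC_def mem_Collect_eq
proof (intro allI impI conjI)
  fix T :: real assume T: "T \<ge> 0"
  obtain v where v: "v \<in> BUC_time" "\<And>x t. t \<ge> 0 \<Longrightarrow> \<bar>v (x, t) - u (x, t)\<bar> \<le> 1"
    using s[of 1] by auto
  obtain C where C: "C \<ge> 0" "\<And>x t. t \<in> {0..T} \<Longrightarrow> \<bar>v (x, t)\<bar> \<le> C"
    by (rule BUC_time_bounded[OF v(1) T]) blast
  show "bounded (u ` (UNIV \<times> {0..T}))"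
  proof (rule boundedI)
    fix a assume "a \<in> u ` (UNIV \<times> {0..T})"
    then obtain x t where "a = u (x, t)" "t \<in> {0..T}" by auto
    then show "norm a \<le> C + 1" using v(2)[of t x] C(2)[of t x] by simp
  qed
  show "uniformly_continuous_on (UNIV \<times> {0..T}) u"
    unfolding uniformly_continuous_on_def
  proof (intro allI impI)
    fix e :: real assume e: "e > 0"
    obtain v where v: "v \<in> BUC_time" "\<And>x t. t \<ge> 0 \<Longrightarrow> \<bar>v (x, t) - u (x, t)\<bar> \<le> e / 3"
      using s[of "e / 3"] e by auto
    have "uniformly_continuous_on (UNIV \<times> {0..T}) v" using v(1) T by (simp add: BUC_time_def BUC_def)
    then obtain d where d: "d > 0" "\<And>z w. z \<in> UNIV \<times> {0..T} \<Longrightarrow> w \<in> UNIV \<times> {0..T} \<Longrightarrow> dist w z < d \<Longrightarrow> dist (v w) (v z) < e / 3"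
      using e unfolding uniformly_continuous_on_def by (metis zero_less_divide_iff zero_less_numeral)
    show "\<exists>d>0. \<forall>z\<in>UNIV \<times> {0..T}. \<forall>w\<in>UNIV \<times> {0..T}. dist w z < d \<longrightarrow> dist (u w) (u z) < e"
    proof (intro exI[of _ d] conjI ballI impI d(1))
      fix z w :: "(real^'d) \<times> real" assume zw: "z \<in> UNIV \<times> {0..T}" "w \<in> UNIV \<times> {0..T}" "dist w z < d"
      have "\<bar>v y - u y\<bar> \<le> e / 3" if "y \<in> UNIV \<times> {0..T}" for y
        using v(2)[of "snd y" "fst y"] that by auto
      from this[OF zw(1)] this[OF zw(2)] show "dist (u w) (u z) < e"
        using d(2)[OF zw] unfolding dist_real_def by linarith
    qed
  qed
qed

theorem theorem5p1:
  fixes H :: "real^'d \<Rightarrow> real^'m"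
    and u0 :: "real^'d \<Rightarrow> real"
    and B :: "real \<Rightarrow> real^'m"
  assumes "C11_loc H"
    and "u0 \<in> BUC UNIV"
    and "continuous_on {0..} B"
    and "B 0 = 0"
  shows "\<exists>u \<in> BUC_time. \<forall>\<J> \<in> {compact_times, all_times}.
           approximation_limit \<J> H u0 B u \<and>
           (\<forall>v \<in> BUC_time. approximation_limit \<J> H u0 B v \<longrightarrow>
              (\<forall>x. \<forall>t\<ge>0. v (x, t) = u (x, t)))"
proof -
  \<comment> \<open>A reference family indexed by its tolerance e: path and datum within e of B and
    u0, together with a solution. It serves both to construct u and to prove uniqueness.\<close>
  define good where "good e P g s \<longleftrightarrow> C1_path P \<and> P 0 = 0 \<and> (\<forall>t\<ge>0. norm (P t - B t) \<le> e) \<and>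
    g \<in> BUC UNIV \<and> (\<forall>x. \<bar>g x - u0 x\<bar> \<le> e) \<and> s \<in> BUC_time \<and> HJ_solution H P g s" for e P g s
  have "\<exists>P g s. good e P g s" if e: "e > 0" for e
  proof -
    obtain P where P: "C1_path P" "P 0 = 0" "\<And>t. t \<ge> 0 \<Longrightarrow> norm (P t - B t) \<le> e"
      by (rule C1_path_approximation[OF assms(3,4) e]) blast
    obtain g K C where g: "\<And>x y. g x \<le> g y + K * norm (x - y)" "\<And>x. \<bar>g x\<bar> \<le> C" "\<And>x. \<bar>g x - u0 x\<bar> \<le> e"
      by (rule inf_convolution[OF assms(2) e]) blast
    have K: "K \<ge> 0" using g(1)[of "axis undefined 1" 0] g(1)[of 0 "axis undefined 1"] by (simp add: norm_axis_real)
    have "K-lipschitz_on UNIV g"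
    proof (rule lipschitz_onI)
      show "dist (g x) (g y) \<le> K * dist x y" for x y
        using g(1)[of x y] g(1)[of y x] by (simp add: dist_real_def abs_le_iff dist_norm norm_minus_commute)
    qed (rule K)
    then have "g \<in> BUC UNIV"
      using g(2) by (auto simp: BUC_def bounded_iff intro: lipschitz_on_uniformly_continuous)
    moreover obtain s where "s \<in> BUC_time" "HJ_solution H P g s"
      using HJ_solution_exists[OF assms(1) g(1,2) P(1,2)] by blast
    ultimately show ?thesis using P g(3) unfolding good_def by blast
  qed
  then obtain P g s where fam: "\<And>e. e > 0 \<Longrightarrow> good e (P e) (g e) (s e)" by metis
  have Cauchy: "\<exists>d>0. \<forall>r r' x t. 0 < r \<longrightarrow> r \<le> d \<longrightarrow> 0 < r' \<longrightarrow> r' \<le> d \<longrightarrow> t \<ge> 0 \<longrightarrow> \<bar>s r (x, t) - s r' (x, t)\<bar> \<le> e" if e: "e > 0" for e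
  proof -
    obtain d where d: "d > 0" "\<And>B1 B2 u1 u2 v1 v2 T x t.
      \<lbrakk>C1_path B1; C1_path B2; B1 0 = 0; B2 0 = 0; u1 \<in> BUC_time; u2 \<in> BUC_time;
       HJ_solution H B1 v1 u1; HJ_solution H B2 v2 u2;
       \<And>x. \<bar>v1 x - u0 x\<bar> \<le> d; \<And>x. \<bar>v2 x - u0 x\<bar> \<le> d;
       \<And>t. t \<in> {0..T} \<Longrightarrow> norm (B1 t - B2 t) \<le> d; t \<in> {0..T}\<rbrakk> \<Longrightarrow> \<bar>u1 (x, t) - u2 (x, t)\<bar> \<le> e"
      by (rule HJ_solutions_close[OF assms(1,2) e]) blast
    show ?thesis
    proof (intro exI[of _ "d / 2"] conjI allI impI)
      fix r r' t :: real and x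
      assume r: "0 < r" "r \<le> d / 2" "0 < r'" "r' \<le> d / 2" "t \<ge> 0"
      note G = fam[OF r(1), unfolded good_def] fam[OF r(3), unfolded good_def]
      show "\<bar>s r (x, t) - s r' (x, t)\<bar> \<le> e"
      proof (rule d(2)[where T=t])
        show "\<bar>g r y - u0 y\<bar> \<le> d" "\<bar>g r' y - u0 y\<bar> \<le> d" for y
          using G r d(1) by (auto intro: order_trans)
        show "norm (P r q - P r' q) \<le> d" if "q \<in> {0..t}" for q
        proof -
          have "norm (P r q - B q) \<le> r" "norm (P r' q - B q) \<le> r'" using G that by auto
          moreover have "norm (P r q - P r' q) \<le> norm (P r q - B q) + norm (P r' q - B q)"
            using norm_triangle_ineq4[of "P r q - B q" "P r' q - B q"] by simp
          ultimately show ?thesis using r by linarith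
        qed
      qed (use G r in auto)
    qed (use d in auto)
  qed
  \<comment> \<open>The limit is taken along 1 / (n + 1), but the Cauchy bound gives convergence of
    the whole family, uniformly in x and t \<ge> 0.\<close>
  define u where "u z = lim (\<lambda>n. s (1 / real (Suc n)) z)" for z
  have small: "\<forall>\<^sub>F n in sequentially. 1 / real (Suc n) \<le> d" if "d > 0" for d
    using order_tendstoD(2)[OF LIMSEQ_inverse_real_of_nat that] by eventually_elim (simp add: inverse_eq_divide)
  have u_close: "\<exists>d>0. \<forall>r x t. 0 < r \<longrightarrow> r \<le> d \<longrightarrow> t \<ge> 0 \<longrightarrow> \<bar>s r (x, t) - u (x, t)\<bar> \<le> e" if e: "e > 0" for e
  proof -
    have conv: "(\<lambda>n. s (1 / real (Suc n)) (x, t)) \<longlonglongrightarrow> u (x, t)" if t: "t \<ge> 0" for x t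
    proof -
      have "Cauchy (\<lambda>n. s (1 / real (Suc n)) (x, t))"
      proof (rule metric_CauchyI)
        fix e :: real assume "e > 0"
        then obtain d where d: "d > 0" "\<And>r r'. 0 < r \<Longrightarrow> r \<le> d \<Longrightarrow> 0 < r' \<Longrightarrow> r' \<le> d \<Longrightarrow> \<bar>s r (x, t) - s r' (x, t)\<bar> \<le> e / 2"
          using Cauchy[of "e / 2"] t by auto
        obtain N where N: "\<forall>n\<ge>N. 1 / real (Suc n) \<le> d"
          using small[OF d(1)] unfolding eventually_sequentially by blast
        show "\<exists>N. \<forall>m\<ge>N. \<forall>n\<ge>N. dist (s (1 / real (Suc m)) (x, t)) (s (1 / real (Suc n)) (x, t)) < e"
        proof (intro exI[of _ N] allI impI)
          fix m n assume "m \<ge> N" "n \<ge> N"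
          then have "1 / real (Suc m) \<le> d" "1 / real (Suc n) \<le> d" using N by blast+
          then have "\<bar>s (1 / real (Suc m)) (x, t) - s (1 / real (Suc n)) (x, t)\<bar> \<le> e / 2"
            by (intro d(2)) simp_all
          then show "dist (s (1 / real (Suc m)) (x, t)) (s (1 / real (Suc n)) (x, t)) < e"
            using \<open>e > 0\<close> unfolding dist_real_def by linarith
        qed
      qed
      then show ?thesis unfolding u_def using Cauchy_convergent convergent_LIMSEQ_iff by blast
    qed
    obtain d where d: "d > 0" "\<And>r r' x t. 0 < r \<Longrightarrow> r \<le> d \<Longrightarrow> 0 < r' \<Longrightarrow> r' \<le> d \<Longrightarrow> t \<ge> 0 \<Longrightarrow> \<bar>s r (x, t) - s r' (x, t)\<bar> \<le> e"
      using Cauchy[OF e] by blast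
    have "\<bar>s r (x, t) - u (x, t)\<bar> \<le> e" if r: "0 < r" "r \<le> d" "t \<ge> 0" for r x t
    proof (rule tendsto_upperbound)
      show "(\<lambda>n. \<bar>s r (x, t) - s (1 / real (Suc n)) (x, t)\<bar>) \<longlonglongrightarrow> \<bar>s r (x, t) - u (x, t)\<bar>"
        by (intro tendsto_intros conv r)
      show "\<forall>\<^sub>F n in sequentially. \<bar>s r (x, t) - s (1 / real (Suc n)) (x, t)\<bar> \<le> e"
        using small[OF d(1)] by eventually_elim (intro d(2) r, auto)
    qed simp
    then show ?thesis using d(1) by blast
  qed
  have uB: "u \<in> BUC_time"
  proof (rule BUC_time_uniform_limit)
    fix e :: real assume "e > 0"
    from u_close[OF this] obtain d where
      d: "d > 0" "\<forall>r x t. 0 < r \<longrightarrow> r \<le> d \<longrightarrow> t \<ge> 0 \<longrightarrow> \<bar>s r (x, t) - u (x, t)\<bar> \<le> e" by blast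
    show "\<exists>v\<in>BUC_time. \<forall>x. \<forall>t\<ge>0. \<bar>v (x, t) - u (x, t)\<bar> \<le> e"
    proof (rule bexI[of _ "s d"])
      show "\<forall>x. \<forall>t\<ge>0. \<bar>s d (x, t) - u (x, t)\<bar> \<le> e" using d by simp
      show "s d \<in> BUC_time" using fam[OF d(1)] by (simp add: good_def)
    qed
  qed
  \<comment> \<open>Both time structures enter only through two properties: each J contains [0, t]
    with every t in it, and the sets J cover [0, \<infinity>). The first matters because the
    estimate at t uses the paths on all of [0, t].\<close>
  have main: "approximation_limit \<J> H u0 B u \<and>
           (\<forall>v \<in> BUC_time. approximation_limit \<J> H u0 B v \<longrightarrow> (\<forall>x. \<forall>t\<ge>0. v (x, t) = u (x, t)))"
    if times: "\<And>J t. J \<in> \<J> \<Longrightarrow> t \<in> J \<Longrightarrow> t \<ge> 0 \<and> {0..t} \<subseteq> J" and cover: "\<And>t. t \<ge> 0 \<Longrightarrow> \<exists>J\<in>\<J>. t \<in> J" for \<J>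
  proof
    show lim: "approximation_limit \<J> H u0 B u"
      unfolding approximation_limit_def
    proof (intro allI impI ballI)
      fix B\<epsilon> :: "real \<Rightarrow> real \<Rightarrow> real^'m" and u0\<epsilon> :: "real \<Rightarrow> real^'d \<Rightarrow> real" and u\<epsilon> :: "real \<Rightarrow> (real^'d) \<times> real \<Rightarrow> real" and J
      assume A: "\<forall>\<epsilon>>0. C1_path (B\<epsilon> \<epsilon>) \<and> B\<epsilon> \<epsilon> 0 = 0" "\<forall>\<epsilon>>0. u0\<epsilon> \<epsilon> \<in> BUC UNIV"
        "\<forall>J\<in>\<J>. uniform_limit J B\<epsilon> B (at_right 0)" "uniform_limit UNIV u0\<epsilon> u0 (at_right 0)"
        "\<forall>\<epsilon>>0. u\<epsilon> \<epsilon> \<in> BUC_time \<and> HJ_solution H (B\<epsilon> \<epsilon>) (u0\<epsilon> \<epsilon>) (u\<epsilon> \<epsilon>)" and J: "J \<in> \<J>"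
      show "uniform_limit (UNIV \<times> J) u\<epsilon> u (at_right 0)"
        unfolding uniform_limit_iff
      proof (intro allI impI)
        fix e :: real assume "e > 0"
        then have e3: "e / 3 > 0" by simp
        obtain d where d: "d > 0" "\<And>B1 B2 u1 u2 v1 v2 T x t.
          \<lbrakk>C1_path B1; C1_path B2; B1 0 = 0; B2 0 = 0; u1 \<in> BUC_time; u2 \<in> BUC_time;
           HJ_solution H B1 v1 u1; HJ_solution H B2 v2 u2;
           \<And>x. \<bar>v1 x - u0 x\<bar> \<le> d; \<And>x. \<bar>v2 x - u0 x\<bar> \<le> d;
           \<And>t. t \<in> {0..T} \<Longrightarrow> norm (B1 t - B2 t) \<le> d; t \<in> {0..T}\<rbrakk> \<Longrightarrow> \<bar>u1 (x, t) - u2 (x, t)\<bar> \<le> e / 3"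
          by (rule HJ_solutions_close[OF assms(1,2) e3]) blast
        obtain d' where d': "d' > 0" "\<And>r x t. 0 < r \<Longrightarrow> r \<le> d' \<Longrightarrow> t \<ge> 0 \<Longrightarrow> \<bar>s r (x, t) - u (x, t)\<bar> \<le> e / 3"
          using u_close[OF e3] by blast
        define r where "r = min d' (d / 2)"
        have r: "r > 0" "r \<le> d'" "r \<le> d / 2" using d d' by (auto simp: r_def)
        note G = fam[OF r(1), unfolded good_def]
        have d2: "d / 2 > 0" using d by simp
        have "\<forall>\<^sub>F \<epsilon> in at_right 0. \<forall>t\<in>J. dist (B\<epsilon> \<epsilon> t) (B t) < d / 2"
          using A(3) J d2 unfolding uniform_limit_iff by blast
        moreover have "\<forall>\<^sub>F \<epsilon> in at_right 0. \<forall>x\<in>UNIV. dist (u0\<epsilon> \<epsilon> x) (u0 x) < d"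
          using A(4) d(1) unfolding uniform_limit_iff by blast
        moreover have "\<forall>\<^sub>F \<epsilon> in at_right (0::real). \<epsilon> > 0" by (rule eventually_at_right_less)
        ultimately show "\<forall>\<^sub>F \<epsilon> in at_right 0. \<forall>z\<in>UNIV \<times> J. dist (u\<epsilon> \<epsilon> z) (u z) < e"
        proof eventually_elim
          case (elim \<epsilon>)
          show ?case
          proof
            fix z :: "(real^'d) \<times> real" assume "z \<in> UNIV \<times> J"
            then obtain x t where z: "z = (x, t)" "t \<in> J" by auto
            have t: "t \<ge> 0" "{0..t} \<subseteq> J" using times[OF J z(2)] by auto
            have "\<bar>u\<epsilon> \<epsilon> (x, t) - s r (x, t)\<bar> \<le> e / 3"
            proof (rule d(2)[where T=t])
              show "\<bar>u0\<epsilon> \<epsilon> y - u0 y\<bar> \<le> d" for y using elim(2) by (auto simp: dist_real_def intro: less_imp_le)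
              show "\<bar>g r y - u0 y\<bar> \<le> d" for y
              proof -
                have "\<bar>g r y - u0 y\<bar> \<le> r" using G by blast
                then show ?thesis using r(1,3) by linarith
              qed
              show "norm (B\<epsilon> \<epsilon> q - P r q) \<le> d" if "q \<in> {0..t}" for q
              proof -
                have "norm (B\<epsilon> \<epsilon> q - B q) < d / 2" using elim(1) that t(2) by (auto simp: dist_norm)
                moreover have "norm (P r q - B q) \<le> r" using G that by auto
                moreover have "norm (B\<epsilon> \<epsilon> q - P r q) \<le> norm (B\<epsilon> \<epsilon> q - B q) + norm (P r q - B q)"
                  using norm_triangle_ineq4[of "B\<epsilon> \<epsilon> q - B q" "P r q - B q"] by simp
                ultimately show ?thesis using r(3) by linarith
              qed
            qed (use G A elim(3) t in auto)
            moreover have "\<bar>s r (x, t) - u (x, t)\<bar> \<le> e / 3" using r t by (intro d'(2))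
            ultimately show "dist (u\<epsilon> \<epsilon> z) (u z) < e" using \<open>e > 0\<close> unfolding z dist_real_def by linarith
          qed
        qed
      qed
    qed
    show "\<forall>v \<in> BUC_time. approximation_limit \<J> H u0 B v \<longrightarrow> (\<forall>x. \<forall>t\<ge>0. v (x, t) = u (x, t))"
    proof (intro ballI impI allI)
      fix v x and t :: real
      assume v: "approximation_limit \<J> H u0 B v" and t: "t \<ge> 0"
      obtain J where J: "J \<in> \<J>" "t \<in> J" using cover[OF t] by blast
      \<comment> \<open>The reference family is itself an admissible approximation, so v and u must
        both be the limit of s \<epsilon> at (x, t).\<close>
      have P_lim: "uniform_limit J P B (at_right 0)" if "J \<in> \<J>" for J
        unfolding uniform_limit_iff
      proof (intro allI impI)
        fix e :: real assume e: "e > 0"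
        show "\<forall>\<^sub>F \<epsilon> in at_right 0. \<forall>q\<in>J. dist (P \<epsilon> q) (B q) < e"
          using eventually_at_right_real[OF e]
        proof eventually_elim
          case (elim \<epsilon>)
          show ?case
          proof
            fix q assume "q \<in> J"
            then have "norm (P \<epsilon> q - B q) \<le> \<epsilon>"
              using times[OF that] fam[of \<epsilon>] elim by (auto simp: good_def)
            then show "dist (P \<epsilon> q) (B q) < e" using elim by (simp add: dist_norm)
          qed
        qed
      qed
      have g_lim: "uniform_limit UNIV g u0 (at_right 0)"
        unfolding uniform_limit_iff
      proof (intro allI impI)
        fix e :: real assume e: "e > 0"
        show "\<forall>\<^sub>F \<epsilon> in at_right 0. \<forall>y\<in>UNIV. dist (g \<epsilon> y) (u0 y) < e"
          using eventually_at_right_real[OF e]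
        proof eventually_elim
          case (elim \<epsilon>)
          then have "\<bar>g \<epsilon> y - u0 y\<bar> \<le> \<epsilon>" for y using fam[of \<epsilon>] by (auto simp: good_def)
          then show ?case using elim unfolding dist_real_def by (auto intro: order.strict_trans1)
        qed
      qed
      have limit: "((\<lambda>\<epsilon>. s \<epsilon> (x, t)) \<longlongrightarrow> w (x, t)) (at_right 0)" if w: "approximation_limit \<J> H u0 B w" for w
      proof -
        have "uniform_limit (UNIV \<times> J) s w (at_right 0)"
          by (rule w[unfolded approximation_limit_def, rule_format, of P g])
             (use fam P_lim g_lim J(1) in \<open>auto simp: good_def\<close>)
        then show ?thesis by (rule tendsto_uniform_limitI) (use J in auto)
      qed
      show "v (x, t) = u (x, t)"
        using tendsto_unique[OF _ limit[OF v] limit[OF lim]] by simp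
    qed
  qed
  have "\<forall>\<J> \<in> {compact_times, all_times}. approximation_limit \<J> H u0 B u \<and>
           (\<forall>v \<in> BUC_time. approximation_limit \<J> H u0 B v \<longrightarrow> (\<forall>x. \<forall>t\<ge>0. v (x, t) = u (x, t)))"
  proof
    fix \<J> assume "\<J> \<in> {compact_times, all_times}"
    then consider "\<J> = compact_times" | "\<J> = all_times" by blast
    then show "approximation_limit \<J> H u0 B u \<and>
           (\<forall>v \<in> BUC_time. approximation_limit \<J> H u0 B v \<longrightarrow> (\<forall>x. \<forall>t\<ge>0. v (x, t) = u (x, t)))"
    proof cases
      case 1
      show ?thesis
      proof (rule main)
        show "t \<ge> 0 \<and> {0..t} \<subseteq> J" if "J \<in> \<J>" "t \<in> J" for J t using that by (auto simp: 1 compact_times_def)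
        show "\<exists>J\<in>\<J>. t \<in> J" if "t \<ge> 0" for t
          unfolding 1 compact_times_def using that by (intro bexI[of _ "{0..t}"]) auto
      qed
    next
      case 2
      show ?thesis
      proof (rule main)
        show "t \<ge> 0 \<and> {0..t} \<subseteq> J" if "J \<in> \<J>" "t \<in> J" for J t using that by (auto simp: 2 all_times_def)
        show "\<exists>J\<in>\<J>. t \<in> J" if "t \<ge> 0" for t using that by (auto simp: 2 all_times_def)
      qed
    qed
  qed
  then show ?thesis by (rule bexI[OF _ uB])
qed

end
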